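(* Let $(H,\mathcal{R})$ be a quasitriangular quantum groupoid, $L$ a quantum groupoid with counit $\underline{\varepsilon}$ and antipode $\underline{S}$, and $f:H\to L$ a quantum groupoid map. Equip $C_L(L_s)$ with the left $H$-action $h\cdot l=f(h_1)\,l\,f(S(h_2))$; the multiplication $\mu_{\mathcal{R}}(a\otimes_t b)=ab$; the unit $\eta_{\mathcal{R}}:H_t\to C_L(L_s)$, $x\mapsto f(x)$; the comultiplication $\Delta_{\mathcal{R}}:C_L(L_s)\to C_L(L_s)\otimes_t C_L(L_s)$, $l\mapsto l_1f(S(R^{(2)}))\otimes R^{(1)}\cdot l_2$; and the counit $\varepsilon_{\mathcal{R}}:C_L(L_s)\to H_t$, $l\mapsto\underline{\varepsilon}(f(1_1)l)1_2$. Then $C_L(L_s)$ is a Hopf algebra in the braided monoidal category ${}_H\mathcal{M}$, with antipode $$S_{\mathcal{R}}:C_L(L_s)\to C_L(L_s),\qquad l\mapsto f(R^{(2)})\,\underline{S}(R^{(1)}\cdot l),\qquad l\in C_L(L_s).$$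
   Context: Let $k$ be a field; Sweedler notation $\Delta(c)=c_1\otimes c_2$ is used, and $\Delta(1)=1_1\otimes 1_2=1'_1\otimes 1'_2$. Quantum groupoids (weak Hopf algebras). A weak bialgebra $H$ is a $k$-algebra and a $k$-coalgebra $(H,\Delta,\varepsilon)$ with $\Delta(hl)=\Delta(h)\Delta(l)$, $\Delta^2(1)=1_1\otimes 1_2 1'_1\otimes 1'_2=1_1\otimes 1'_1 1_2\otimes 1'_2$, and $\varepsilon(hgl)=\varepsilon(hg_1)\varepsilon(g_2l)=\varepsilon(hg_2)\varepsilon(g_1l)$. Put $\varepsilon_t(h)=\varepsilon(1_1h)1_2$ and $\varepsilon_s(h)=1_1\varepsilon(h1_2)$. $H$ is a quantum groupoid if there is a linear map $S:H\to H$ (the antipode) with $S*\mathrm{id}=\varepsilon_s$, $\mathrm{id}*S=\varepsilon_t$, $S*\mathrm{id}*S=S$ ($*$ = convolution). Antipodes are always assumed bijective. $H_t=\varepsilon_t(H)$ and $H_s=\varepsilon_s(H)$. A quantum groupoid map is a linear map that is a unital algebra map and a counital coalgebra map (it commutes with antipodes). A quasitriangular quantum groupoid is a pair $(H,\mathcal{R})$ with $\mathcal{R}=R^{(1)}\otimes R^{(2)}\in\Delta^{cop}(1)(H\otimes H)\Delta(1)$ such that $(\mathrm{id}\otimes\Delta)\mathcal{R}=\mathcal{R}_{13}\mathcal{R}_{12}$, $(\Delta\otimes\mathrm{id})\mathcal{R}=\mathcal{R}_{13}\mathcal{R}_{23}$, $\Delta^{cop}(h)\mathcal{R}=\mathcal{R}\Delta(h)$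 for all $h$, and there is $\mathcal{R}^{-1}\in\Delta(1)(H\otimes H)\Delta^{cop}(1)$ with $\mathcal{R}\mathcal{R}^{-1}=\Delta^{cop}(1)$, $\mathcal{R}^{-1}\mathcal{R}=\Delta(1)$. The category ${}_H\mathcal{M}$ of left $H$-modules is braided monoidal: $V\otimes_t W=\Delta(1)\cdot(V\otimes_k W)$ with $v\otimes_t w=1_1\cdot v\otimes 1_2\cdot w$ and action $h\cdot(v\otimes w)=h_1\cdot v\otimes h_2\cdot w$; unit object $H_t$ with $h\cdot z=\varepsilon_t(hz)$; trivial associator; unit constraints $l(z\otimes_t v)=z\cdot v$, $r(v\otimes_t z)=S^{-1}(z)\cdot v$; braiding $\Psi_{V,W}(v\otimes_t w)=R^{(2)}\cdot w\otimes R^{(1)}\cdot v$. A bialgebra in a braided monoidal category with braiding $\Psi$ is an object with an algebra structure $(\mu,\eta)$ and a coalgebra structure $(\Delta,\varepsilon)$ in the category (all structure maps being morphisms) such that $\Delta\circ\mu=(\mu\otimes\mu)\circ(\mathrm{id}\otimes\Psi\otimes\mathrm{id})\circ(\Delta\otimes\Delta)$, $\varepsilon\circ\mu=\varepsilon\otimes\varepsilon$ and $\Delta\circ\eta=\eta\otimes\eta$ (i.e. $\Delta(1)=1\otimes 1$), identifying $I\otimes I$ with the unit object $I$. It is a Hopf algebra if there is a morphism $S$ in the category (antipode) with $\mu\circ(S\otimes\mathrm{id})\circ\Delta=\eta\circ\varepsilon=\mu\circ(\mathrm{id}\otimes S)\circ\Delta$. $C_L(L_s)=\{l\in L\mid lx=xl\text{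 for all }x\in L_s\}$ is the centralizer of the source space $L_s$ of $L$. In the formula for $\Delta_{\mathcal{R}}$, $l_1\otimes l_2$ is the comultiplication of $L$, and $h\cdot l=f(h_1)lf(S(h_2))$ is applied by the same formula to arbitrary elements of $L$. *)

theory Defs
  imports Main "HOL.Vector_Spaces" "HOL-Library.Function_Algebras"
begin

section \<open>Vector spaces and tensor products\<close>

text \<open>
  A vector space over the field \<^typ>\<open>'k\<close> is a linear subspace (the carrier) of a type that is
  a vector space with scalar multiplication \<open>scl\<close>.
\<close>

record ('k, 'v) vspace =
  carrier :: "'v set"
  scl :: "'k \<Rightarrow> 'v \<Rightarrow> 'v"

definition kspace :: "('k::field, 'v::ab_group_add, 'z) vspace_scheme \<Rightarrow> bool" where
  "kspace V \<longleftrightarrow> vector_space (scl V) \<and> module.subspace (scl V) (carrier V)"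

definition whole :: "('k \<Rightarrow> 'v \<Rightarrow> 'v) \<Rightarrow> ('k, 'v) vspace" where
  "whole s = \<lparr>carrier = UNIV, scl = s\<rparr>"

abbreviation kfield :: "('k::field, 'k) vspace" where
  "kfield \<equiv> whole (*)"

definition klinear ::
  "('k::field, 'v::ab_group_add, 'y) vspace_scheme \<Rightarrow> ('k, 'w::ab_group_add, 'z) vspace_scheme
    \<Rightarrow> ('v \<Rightarrow> 'w) \<Rightarrow> bool" where
  "klinear V W g \<longleftrightarrow>
     (\<forall>x\<in>carrier V. g x \<in> carrier W) \<and>
     (\<forall>x\<in>carrier V. \<forall>y\<in>carrier V. g (x + y) = g x + g y) \<and>
     (\<forall>c. \<forall>x\<in>carrier V. g (scl V c x) = scl W c (g x))"

definition kbilinear ::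
  "('k::field, 'v::ab_group_add, 'x) vspace_scheme \<Rightarrow> ('k, 'w::ab_group_add, 'y) vspace_scheme
    \<Rightarrow> ('k, 'u::ab_group_add, 'z) vspace_scheme \<Rightarrow> ('v \<Rightarrow> 'w \<Rightarrow> 'u) \<Rightarrow> bool" where
  "kbilinear V W X \<phi> \<longleftrightarrow>
     (\<forall>v\<in>carrier V. klinear W X (\<phi> v)) \<and> (\<forall>w\<in>carrier W. klinear V X (\<lambda>v. \<phi> v w))"

text \<open>
  The tensor \<open>v \<otimes> w\<close> is modelled as evaluation at \<open>(v, w)\<close> on the bilinear forms of the two
  ambient spaces. Bilinear forms separate the points of an algebraic tensor product of vector
  spaces, so the span of the \<open>v \<otimes> w\<close> with \<open>v \<in> V\<close> and \<open>w \<in> W\<close> is the tensor product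
  \<open>V \<otimes> W\<close>, contained in the tensor product of the ambient spaces; its universal property is
  \<open>contract_tens\<close> and \<open>klinear_contract\<close> below. Only the scalar multiplications of the
  space arguments of \<open>tens\<close> matter, not their carriers.
\<close>

type_synonym ('v, 'w, 'k) tensor = "('v \<Rightarrow> 'w \<Rightarrow> 'k) \<Rightarrow> 'k"

definition tens ::
  "('k::field, 'v::ab_group_add, 'y) vspace_scheme \<Rightarrow> ('k, 'w::ab_group_add, 'z) vspace_scheme
    \<Rightarrow> 'v \<Rightarrow> 'w \<Rightarrow> ('v, 'w, 'k) tensor" where
  "tens V W v w = (\<lambda>\<beta>. if kbilinear (whole (scl V)) (whole (scl W)) kfield \<beta> then \<beta> v w else 0)"

definition tensor ::
  "('k::field, 'v::ab_group_add, 'y) vspace_scheme \<Rightarrow> ('k, 'w::ab_group_add, 'z) vspace_scheme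
    \<Rightarrow> ('k, ('v, 'w, 'k) tensor) vspace" where
  "tensor V W =
     \<lparr>carrier = {t. \<exists>ps. set ps \<subseteq> carrier V \<times> carrier W \<and> t = (\<Sum>(v, w)\<leftarrow>ps. tens V W v w)},
      scl = (\<lambda>c t \<beta>. c * t \<beta>)\<rparr>"

text \<open>
  \<open>lift_via \<tau> A B \<phi>\<close> is the additive map sending \<open>\<tau> v w\<close> to \<open>\<phi> v w\<close>, computed on an
  arbitrary representation of the argument as a sum of generators \<open>\<tau> v w\<close>. In particular
  \<open>contract V W (\<lambda>v w. \<phi> v w) t\<close> is the Sweedler-style expression \<open>\<phi> t\<^sub>1 t\<^sub>2\<close> for
  \<open>t = t\<^sub>1 \<otimes> t\<^sub>2\<close> in \<open>V \<otimes> W\<close>.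
\<close>

definition lift_via ::
  "('v \<Rightarrow> 'w \<Rightarrow> 't::ab_group_add) \<Rightarrow> 'v set \<Rightarrow> 'w set \<Rightarrow> ('v \<Rightarrow> 'w \<Rightarrow> 'u::ab_group_add)
    \<Rightarrow> 't \<Rightarrow> 'u" where
  "lift_via \<tau> A B \<phi> t =
     (let ps = (SOME ps. set ps \<subseteq> A \<times> B \<and> t = (\<Sum>(v, w)\<leftarrow>ps. \<tau> v w))
      in (\<Sum>(v, w)\<leftarrow>ps. \<phi> v w))"

definition contract ::
  "('k::field, 'v::ab_group_add, 'y) vspace_scheme \<Rightarrow> ('k, 'w::ab_group_add, 'z) vspace_scheme
    \<Rightarrow> ('v \<Rightarrow> 'w \<Rightarrow> 'u::ab_group_add) \<Rightarrow> ('v, 'w, 'k) tensor \<Rightarrow> 'u" where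
  "contract V W = lift_via (tens V W) (carrier V) (carrier W)"

definition tmap ::
  "('k::field, 'v::ab_group_add, 'p) vspace_scheme \<Rightarrow> ('k, 'w::ab_group_add, 'q) vspace_scheme
    \<Rightarrow> ('k, 'v1::ab_group_add, 'r) vspace_scheme \<Rightarrow> ('k, 'w1::ab_group_add, 's) vspace_scheme
    \<Rightarrow> ('v \<Rightarrow> 'v1) \<Rightarrow> ('w \<Rightarrow> 'w1) \<Rightarrow> ('v, 'w, 'k) tensor \<Rightarrow> ('v1, 'w1, 'k) tensor" where
  "tmap V W V1 W1 g h = contract V W (\<lambda>v w. tens V1 W1 (g v) (h w))"

definition tflip ::
  "('k::field, 'v::ab_group_add, 'y) vspace_scheme \<Rightarrow> ('k, 'w::ab_group_add, 'z) vspace_scheme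
    \<Rightarrow> ('v, 'w, 'k) tensor \<Rightarrow> ('w, 'v, 'k) tensor" where
  "tflip V W = contract V W (\<lambda>v w. tens W V w v)"

definition tassoc ::
  "('k::field, 'u::ab_group_add, 'x) vspace_scheme \<Rightarrow> ('k, 'v::ab_group_add, 'y) vspace_scheme
    \<Rightarrow> ('k, 'w::ab_group_add, 'z) vspace_scheme
    \<Rightarrow> (('u, 'v, 'k) tensor, 'w, 'k) tensor \<Rightarrow> ('u, ('v, 'w, 'k) tensor, 'k) tensor" where
  "tassoc U V W = contract (tensor U V) W (\<lambda>p w.
     contract U V (\<lambda>u v. tens U (tensor V W) u (tens V W v w)) p)"

definition tassoc_inv ::
  "('k::field, 'u::ab_group_add, 'x) vspace_scheme \<Rightarrow> ('k, 'v::ab_group_add, 'y) vspace_scheme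
    \<Rightarrow> ('k, 'w::ab_group_add, 'z) vspace_scheme
    \<Rightarrow> ('u, ('v, 'w, 'k) tensor, 'k) tensor \<Rightarrow> (('u, 'v, 'k) tensor, 'w, 'k) tensor" where
  "tassoc_inv U V W = contract U (tensor V W) (\<lambda>u p.
     contract V W (\<lambda>v w. tens (tensor U V) W (tens U V u v) w) p)"

definition tmult ::
  "('k::field, 'v::ab_group_add, 'y) vspace_scheme \<Rightarrow> ('k, 'w::ab_group_add, 'z) vspace_scheme
    \<Rightarrow> ('v \<Rightarrow> 'v \<Rightarrow> 'v) \<Rightarrow> ('w \<Rightarrow> 'w \<Rightarrow> 'w)
    \<Rightarrow> ('v, 'w, 'k) tensor \<Rightarrow> ('v, 'w, 'k) tensor \<Rightarrow> ('v, 'w, 'k) tensor" where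
  "tmult V W m n x y =
     contract V W (\<lambda>a b. contract V W (\<lambda>c d. tens V W (m a c) (n b d)) y) x"


subsection \<open>Universal property of the tensor product\<close>

lemma carrier_whole [simp]: "carrier (whole s) = UNIV"
  and scl_whole [simp]: "scl (whole s) = s"
  by (simp_all add: whole_def)

lemma sum_list_tens_apply:
  assumes "kbilinear (whole (scl V)) (whole (scl W)) kfield \<beta>"
  shows "(\<Sum>(v, w)\<leftarrow>ps. tens V W v w) \<beta> = (\<Sum>(v, w)\<leftarrow>ps. \<beta> v w)"
  using assms by (induction ps) (auto simp: tens_def)

lemma klinear_sum_list:
  assumes X: "kspace X" and l: "klinear X Y l" and "set xs \<subseteq> carrier X"
  shows "(\<Sum>x\<leftarrow>xs. x) \<in> carrier X \<and> l (\<Sum>x\<leftarrow>xs. x) = (\<Sum>x\<leftarrow>xs. l x)"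
  using assms(3)
proof (induction xs)
  case Nil
  interpret vector_space "scl X" using X by (simp add: kspace_def)
  have 0: "0 \<in> carrier X" using X by (simp add: kspace_def subspace_0)
  have "l (0 + 0) = l 0 + l 0" using l 0 unfolding klinear_def by blast
  then show ?case using 0 by simp
next
  case (Cons x xs)
  interpret vector_space "scl X" using X by (simp add: kspace_def)
  show ?case using Cons X l by (auto simp: kspace_def klinear_def intro: subspace_add)
qed

lemma contract_sum_list:
  fixes \<phi> :: "'v::ab_group_add \<Rightarrow> 'w::ab_group_add \<Rightarrow> 'u::ab_group_add"
  assumes V: "kspace V" and W: "kspace W" and X: "kspace X"
    and \<phi>: "kbilinear V W X \<phi>" and ps: "set ps \<subseteq> carrier V \<times> carrier W"
  shows "contract V W \<phi> (\<Sum>(v, w)\<leftarrow>ps. tens V W v w) = (\<Sum>(v, w)\<leftarrow>ps. \<phi> v w)"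
proof -
  let ?t = "\<Sum>(v, w)\<leftarrow>ps. tens V W v w"
  define qs where "qs = (SOME qs. set qs \<subseteq> carrier V \<times> carrier W \<and>
     ?t = (\<Sum>(v, w)\<leftarrow>qs. tens V W v w))"
  have qs: "set qs \<subseteq> carrier V \<times> carrier W" "?t = (\<Sum>(v, w)\<leftarrow>qs. tens V W v w)"
    using someI[of "\<lambda>qs. set qs \<subseteq> carrier V \<times> carrier W \<and> ?t = (\<Sum>(v, w)\<leftarrow>qs. tens V W v w)" ps] ps
    unfolding qs_def by auto
  have proj: "\<exists>p. klinear (whole (scl Z)) Z p \<and> (\<forall>z\<in>carrier Z. p z = z)"
    if "kspace Z" for Z :: "('a, 'z::ab_group_add, 's) vspace_scheme"
  proof -
    interpret vector_space_pair "scl Z" "scl Z"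
      using that by (simp add: kspace_def vector_space_pair_def)
    have "\<exists>g. range g \<subseteq> carrier Z \<and> Vector_Spaces.linear (scl Z) (scl Z) g
        \<and> (\<forall>v\<in>carrier Z. g (id v) = v)"
      using that by (intro linear_exists_left_inverse_on)
        (auto simp: kspace_def vs1.linear_ident)
    then obtain g where g: "range g \<subseteq> carrier Z" "Vector_Spaces.linear (scl Z) (scl Z) g"
      "\<forall>v\<in>carrier Z. g v = v" by auto
    then show ?thesis
      by (intro exI[of _ g]) (auto simp: klinear_def linear_add linear_scale)
  qed
  obtain p where p: "klinear (whole (scl V)) V p" "\<forall>z\<in>carrier V. p z = z" using proj[OF V] by blast
  obtain q where q: "klinear (whole (scl W)) W q" "\<forall>z\<in>carrier W. q z = z" using proj[OF W] by blast
  have "(\<Sum>(v, w)\<leftarrow>qs. \<phi> v w) = (\<Sum>(v, w)\<leftarrow>ps. \<phi> v w)" (is "?a = ?b")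
  proof (rule ccontr)
    assume "?a \<noteq> ?b"
    then have d: "?a - ?b \<noteq> 0" by simp
    interpret XK: vector_space_pair "scl X" "(*) :: 'a \<Rightarrow> 'a \<Rightarrow> 'a"
      using X by (auto simp: kspace_def vector_space_pair_def vector_space_def algebra_simps)
    have "XK.vs1.independent {?a - ?b}" using d by simp
    from XK.linear_independent_extend[OF this, of "\<lambda>_. 1"]
    obtain l where l: "Vector_Spaces.linear (scl X) (*) l" "l (?a - ?b) = 1" by auto
    define \<beta> where "\<beta> = (\<lambda>v w. l (\<phi> (p v) (q w)))"
    have \<beta>: "kbilinear (whole (scl V)) (whole (scl W)) kfield \<beta>"
      using p(1) q(1) \<phi> l(1) XK.linear_add[OF l(1)] XK.linear_scale[OF l(1)]
      by (auto simp: kbilinear_def klinear_def \<beta>_def)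
    have l0: "l 0 = 0" and ladd: "\<And>x y. l (x + y) = l x + l y"
      using XK.linear_0[OF l(1)] XK.linear_add[OF l(1)] by auto
    have ev: "(\<Sum>(v, w)\<leftarrow>rs. \<beta> v w) = l (\<Sum>(v, w)\<leftarrow>rs. \<phi> v w)"
      if "set rs \<subseteq> carrier V \<times> carrier W" for rs
      using that by (induction rs) (auto simp: \<beta>_def l0 ladd p(2) q(2))
    have "l ?a = l ?b"
      using ev[OF qs(1)] ev[OF ps] sum_list_tens_apply[OF \<beta>] qs(2) by metis
    then show False using l(2) XK.linear_diff[OF l(1)] by simp
  qed
  then show ?thesis by (simp add: contract_def lift_via_def Let_def qs_def)
qed

theorem contract_tens:
  assumes "kspace V" "kspace W" "kspace X" "kbilinear V W X \<phi>" "v \<in> carrier V" "w \<in> carrier W"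
  shows "contract V W \<phi> (tens V W v w) = \<phi> v w"
  using contract_sum_list[of V W X \<phi> "[(v, w)]"] assms by simp

theorem klinear_contract:
  fixes \<phi> :: "'v::ab_group_add \<Rightarrow> 'w::ab_group_add \<Rightarrow> 'u::ab_group_add"
  assumes V: "kspace V" and W: "kspace W" and X: "kspace X" and \<phi>: "kbilinear V W X \<phi>"
  shows "klinear (tensor V W) X (contract V W \<phi>)"
proof -
  note eq = contract_sum_list[OF V W X \<phi>]
  interpret V: vector_space "scl V" using V by (simp add: kspace_def)
  interpret X: vector_space "scl X" using X by (simp add: kspace_def)
  have inX: "(\<Sum>(v, w)\<leftarrow>ps. \<phi> v w) \<in> carrier X" if "set ps \<subseteq> carrier V \<times> carrier W" for ps
    using that
  proof (induction ps)
    case Nil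
    then show ?case using X by (simp add: kspace_def X.subspace_0)
  next
    case (Cons a ps)
    then show ?case using X \<phi>
      by (auto simp: kspace_def kbilinear_def klinear_def intro!: X.subspace_add)
  qed
  have scale: "(\<lambda>\<beta>. c * (\<Sum>(v, w)\<leftarrow>ps. tens V W v w) \<beta>)
      = (\<Sum>(v, w)\<leftarrow>map (\<lambda>(v, w). (scl V c v, w)) ps. tens V W v w)" for c ps
  proof (induction ps)
    case (Cons a ps)
    have "(\<lambda>\<beta>. c * tens V W (fst a) (snd a) \<beta>) = tens V W (scl V c (fst a)) (snd a)"
      by (auto simp: tens_def fun_eq_iff kbilinear_def klinear_def)
    then show ?case using Cons by (auto simp: fun_eq_iff algebra_simps split: prod.splits)
  qed (simp add: fun_eq_iff)
  have \<phi>scale: "(\<Sum>(v, w)\<leftarrow>map (\<lambda>(v, w). (scl V c v, w)) ps. \<phi> v w) = scl X c (\<Sum>(v, w)\<leftarrow>ps. \<phi> v w)"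
    if "set ps \<subseteq> carrier V \<times> carrier W" for c ps
    using that \<phi> by (induction ps) (auto simp: kbilinear_def klinear_def X.scale_right_distrib)
  have mem: "set (map (\<lambda>(v, w). (scl V c v, w)) ps) \<subseteq> carrier V \<times> carrier W"
    if "set ps \<subseteq> carrier V \<times> carrier W" for c ps
    using that V by (auto simp: kspace_def V.subspace_scale)
  show ?thesis
    unfolding klinear_def
  proof (intro conjI ballI allI)
    fix x assume "x \<in> carrier (tensor V W)"
    then obtain ps where ps: "set ps \<subseteq> carrier V \<times> carrier W" "x = (\<Sum>(v, w)\<leftarrow>ps. tens V W v w)"
      by (auto simp: tensor_def)
    show "contract V W \<phi> x \<in> carrier X" using eq[OF ps(1)] inX[OF ps(1)] ps(2) by simp
    fix c show "contract V W \<phi> (scl (tensor V W) c x) = scl X c (contract V W \<phi> x)"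
      using eq[OF ps(1)] eq[OF mem[OF ps(1)], of c] scale[of c ps] \<phi>scale[OF ps(1), of c] ps(2)
      by (simp add: tensor_def)
  next
    fix x y assume "x \<in> carrier (tensor V W)" "y \<in> carrier (tensor V W)"
    then obtain ps qs where ps: "set ps \<subseteq> carrier V \<times> carrier W" "x = (\<Sum>(v, w)\<leftarrow>ps. tens V W v w)"
      and qs: "set qs \<subseteq> carrier V \<times> carrier W" "y = (\<Sum>(v, w)\<leftarrow>qs. tens V W v w)"
      by (auto simp: tensor_def)
    have "set (ps @ qs) \<subseteq> carrier V \<times> carrier W" using ps(1) qs(1) by simp
    from eq[OF this] show "contract V W \<phi> (x + y) = contract V W \<phi> x + contract V W \<phi> y"
      using eq[OF ps(1)] eq[OF qs(1)] ps(2) qs(2) by simp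
  qed
qed


section \<open>Weak bialgebras and quantum groupoids\<close>

text \<open>
  The product and unit of a \<open>k\<close>-algebra are those of the type \<^typ>\<open>'h\<close>; the sort
  \<open>{ring, monoid_mult}\<close> (rather than \<open>ring_1\<close>) does not exclude the zero algebra.
\<close>

definition k_algebra :: "('k::field, 'h::{ring,monoid_mult}, 'z) vspace_scheme \<Rightarrow> bool" where
  "k_algebra A \<longleftrightarrow> kspace A \<and> carrier A = UNIV \<and>
     (\<forall>c x y. scl A c (x * y) = scl A c x * y \<and> scl A c (x * y) = x * scl A c y)"

record ('k, 'h) qgroupoid = "('k, 'h) vspace" +
  comul :: "'h \<Rightarrow> ('h, 'h, 'k) tensor"
  counit :: "'h \<Rightarrow> 'k"
  antipode :: "'h \<Rightarrow> 'h"

definition k_coalgebra :: "('k::field, 'h::ab_group_add) qgroupoid \<Rightarrow> bool" where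
  "k_coalgebra C \<longleftrightarrow> kspace C \<and>
     klinear C (tensor C C) (comul C) \<and> klinear C kfield (counit C) \<and>
     (\<forall>x\<in>carrier C. tassoc C C C (tmap C C (tensor C C) C (comul C) id (comul C x))
                  = tmap C C C (tensor C C) id (comul C) (comul C x)) \<and>
     (\<forall>x\<in>carrier C. contract C C (\<lambda>a b. scl C (counit C a) b) (comul C x) = x) \<and>
     (\<forall>x\<in>carrier C. contract C C (\<lambda>a b. scl C (counit C b) a) (comul C x) = x)"

definition mult2 :: "('k::field, 'h::{ring,monoid_mult}) qgroupoid
    \<Rightarrow> ('h, 'h, 'k) tensor \<Rightarrow> ('h, 'h, 'k) tensor \<Rightarrow> ('h, 'h, 'k) tensor" where
  "mult2 H = tmult H H (*) (*)"

definition mult3 :: "('k::field, 'h::{ring,monoid_mult}) qgroupoid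
    \<Rightarrow> ('h, ('h, 'h, 'k) tensor, 'k) tensor \<Rightarrow> ('h, ('h, 'h, 'k) tensor, 'k) tensor
    \<Rightarrow> ('h, ('h, 'h, 'k) tensor, 'k) tensor" where
  "mult3 H = tmult H (tensor H H) (*) (mult2 H)"

definition weak_bialgebra :: "('k::field, 'h::{ring,monoid_mult}) qgroupoid \<Rightarrow> bool" where
  "weak_bialgebra H \<longleftrightarrow> k_algebra H \<and> k_coalgebra H \<and>
     (\<forall>h l. comul H (h * l) = mult2 H (comul H h) (comul H l)) \<and>
     tmap H H H (tensor H H) id (comul H) (comul H 1)
       = contract H H (\<lambda>a b. contract H H (\<lambda>a' b'.
           tens H (tensor H H) a (tens H H (b * a') b')) (comul H 1)) (comul H 1) \<and>
     tmap H H H (tensor H H) id (comul H) (comul H 1)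
       = contract H H (\<lambda>a b. contract H H (\<lambda>a' b'.
           tens H (tensor H H) a (tens H H (a' * b) b')) (comul H 1)) (comul H 1) \<and>
     (\<forall>h g l. counit H (h * g * l)
       = contract H H (\<lambda>g1 g2. counit H (h * g1) * counit H (g2 * l)) (comul H g)) \<and>
     (\<forall>h g l. counit H (h * g * l)
       = contract H H (\<lambda>g1 g2. counit H (h * g2) * counit H (g1 * l)) (comul H g))"

definition eps_t :: "('k::field, 'h::{ring,monoid_mult}) qgroupoid \<Rightarrow> 'h \<Rightarrow> 'h" where
  "eps_t H h = contract H H (\<lambda>a b. scl H (counit H (a * h)) b) (comul H 1)"

definition eps_s :: "('k::field, 'h::{ring,monoid_mult}) qgroupoid \<Rightarrow> 'h \<Rightarrow> 'h" where
  "eps_s H h = contract H H (\<lambda>a b. scl H (counit H (h * b)) a) (comul H 1)"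

definition convolution :: "('k::field, 'h::{ring,monoid_mult}) qgroupoid
    \<Rightarrow> ('h \<Rightarrow> 'h) \<Rightarrow> ('h \<Rightarrow> 'h) \<Rightarrow> 'h \<Rightarrow> 'h" where
  "convolution H p q h = contract H H (\<lambda>a b. p a * q b) (comul H h)"

definition quantum_groupoid :: "('k::field, 'h::{ring,monoid_mult}) qgroupoid \<Rightarrow> bool" where
  "quantum_groupoid H \<longleftrightarrow> weak_bialgebra H \<and>
     klinear H H (antipode H) \<and>
     convolution H (antipode H) id = eps_s H \<and>
     convolution H id (antipode H) = eps_t H \<and>
     convolution H (convolution H (antipode H) id) (antipode H) = antipode H \<and>
     bij (antipode H)"

definition quantum_groupoid_map ::
  "('k::field, 'h::{ring,monoid_mult}) qgroupoid \<Rightarrow> ('k, 'l::{ring,monoid_mult}) qgroupoid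
    \<Rightarrow> ('h \<Rightarrow> 'l) \<Rightarrow> bool" where
  "quantum_groupoid_map H L f \<longleftrightarrow> klinear H L f \<and>
     (\<forall>x y. f (x * y) = f x * f y) \<and> f 1 = 1 \<and>
     (\<forall>x. comul L (f x) = tmap H H L L f f (comul H x)) \<and>
     (\<forall>x. counit L (f x) = counit H x)"

definition comul_cop :: "('k::field, 'h::{ring,monoid_mult}) qgroupoid \<Rightarrow> 'h
    \<Rightarrow> ('h, 'h, 'k) tensor" where
  "comul_cop H h = tflip H H (comul H h)"

definition quasitriangular_quantum_groupoid ::
  "('k::field, 'h::{ring,monoid_mult}) qgroupoid \<Rightarrow> ('h, 'h, 'k) tensor \<Rightarrow> bool" where
  "quasitriangular_quantum_groupoid H R \<longleftrightarrow> quantum_groupoid H \<and>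
     (\<exists>x\<in>carrier (tensor H H). R = mult2 H (mult2 H (comul_cop H 1) x) (comul H 1)) \<and>
     (let R12 = contract H H (\<lambda>a b. tens H (tensor H H) a (tens H H b 1)) R;
          R13 = contract H H (\<lambda>a b. tens H (tensor H H) a (tens H H 1 b)) R;
          R23 = contract H H (\<lambda>a b. tens H (tensor H H) 1 (tens H H a b)) R
      in tmap H H H (tensor H H) id (comul H) R = mult3 H R13 R12 \<and>
         tassoc H H H (tmap H H (tensor H H) H (comul H) id R) = mult3 H R13 R23) \<and>
     (\<forall>h. mult2 H (comul_cop H h) R = mult2 H R (comul H h)) \<and>
     (\<exists>R'. (\<exists>x\<in>carrier (tensor H H). R' = mult2 H (mult2 H (comul H 1) x) (comul_cop H 1)) \<and>
           mult2 H R R' = comul_cop H 1 \<and> mult2 H R' R = comul H 1)"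


section \<open>The braided monoidal category of left modules\<close>

record ('k, 'v, 'h) hmod = "('k, 'v) vspace" +
  act :: "'h \<Rightarrow> 'v \<Rightarrow> 'v"

definition left_module ::
  "('k::field, 'h::{ring,monoid_mult}) qgroupoid \<Rightarrow> ('k, 'v::ab_group_add, 'h) hmod \<Rightarrow> bool" where
  "left_module H V \<longleftrightarrow> kspace V \<and> kbilinear H V V (act V) \<and>
     (\<forall>v\<in>carrier V. act V 1 v = v) \<and>
     (\<forall>g h. \<forall>v\<in>carrier V. act V (g * h) v = act V g (act V h v))"

definition hmod_hom ::
  "('k::field, 'h::{ring,monoid_mult}) qgroupoid \<Rightarrow> ('k, 'v::ab_group_add, 'h) hmod
    \<Rightarrow> ('k, 'w::ab_group_add, 'h) hmod \<Rightarrow> ('v \<Rightarrow> 'w) \<Rightarrow> bool" where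
  "hmod_hom H V W g \<longleftrightarrow> klinear V W g \<and>
     (\<forall>h. \<forall>v\<in>carrier V. g (act V h v) = act W h (g v))"

definition diag_act ::
  "('k::field, 'h::{ring,monoid_mult}) qgroupoid \<Rightarrow> ('k, 'v::ab_group_add, 'h) hmod
    \<Rightarrow> ('k, 'w::ab_group_add, 'h) hmod \<Rightarrow> 'h \<Rightarrow> ('v, 'w, 'k) tensor \<Rightarrow> ('v, 'w, 'k) tensor" where
  "diag_act H V W h x = contract H H (\<lambda>h1 h2. tmap V W V W (act V h1) (act W h2) x) (comul H h)"

text \<open>The product \<open>V \<otimes>\<^sub>t W = \<Delta>(1) \<cdot> (V \<otimes> W)\<close> and its elements \<open>v \<otimes>\<^sub>t w\<close>.\<close>

definition tprod ::
  "('k::field, 'h::{ring,monoid_mult}) qgroupoid \<Rightarrow> ('k, 'v::ab_group_add, 'h) hmod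
    \<Rightarrow> ('k, 'w::ab_group_add, 'h) hmod \<Rightarrow> ('k, ('v, 'w, 'k) tensor, 'h) hmod" where
  "tprod H V W =
     \<lparr>carrier = diag_act H V W 1 ` carrier (tensor V W),
      scl = scl (tensor V W),
      act = diag_act H V W\<rparr>"

definition tens_t ::
  "('k::field, 'h::{ring,monoid_mult}) qgroupoid \<Rightarrow> ('k, 'v::ab_group_add, 'h) hmod
    \<Rightarrow> ('k, 'w::ab_group_add, 'h) hmod \<Rightarrow> 'v \<Rightarrow> 'w \<Rightarrow> ('v, 'w, 'k) tensor" where
  "tens_t H V W v w = contract H H (\<lambda>a b. tens V W (act V a v) (act W b w)) (comul H 1)"

text \<open>The map on \<open>V \<otimes>\<^sub>t W\<close> given by \<open>v \<otimes>\<^sub>t w \<mapsto> \<phi> v w\<close>.\<close>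

definition contract_t ::
  "('k::field, 'h::{ring,monoid_mult}) qgroupoid \<Rightarrow> ('k, 'v::ab_group_add, 'h) hmod
    \<Rightarrow> ('k, 'w::ab_group_add, 'h) hmod \<Rightarrow> ('v \<Rightarrow> 'w \<Rightarrow> 'u::ab_group_add)
    \<Rightarrow> ('v, 'w, 'k) tensor \<Rightarrow> 'u" where
  "contract_t H V W = lift_via (tens_t H V W) (carrier V) (carrier W)"

definition unit_obj ::
  "('k::field, 'h::{ring,monoid_mult}) qgroupoid \<Rightarrow> ('k, 'h, 'h) hmod" where
  "unit_obj H = \<lparr>carrier = range (eps_t H), scl = scl H, act = (\<lambda>h z. eps_t H (h * z))\<rparr>"

definition lunit ::
  "('k::field, 'h::{ring,monoid_mult}) qgroupoid \<Rightarrow> ('k, 'v::ab_group_add, 'h) hmod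
    \<Rightarrow> ('h, 'v, 'k) tensor \<Rightarrow> 'v" where
  "lunit H V = contract_t H (unit_obj H) V (\<lambda>z v. act V z v)"

definition runit ::
  "('k::field, 'h::{ring,monoid_mult}) qgroupoid \<Rightarrow> ('k, 'v::ab_group_add, 'h) hmod
    \<Rightarrow> ('v, 'h, 'k) tensor \<Rightarrow> 'v" where
  "runit H V = contract_t H V (unit_obj H) (\<lambda>v z. act V (inv (antipode H) z) v)"

definition braiding ::
  "('k::field, 'h::{ring,monoid_mult}) qgroupoid \<Rightarrow> ('h, 'h, 'k) tensor
    \<Rightarrow> ('k, 'v::ab_group_add, 'h) hmod \<Rightarrow> ('k, 'w::ab_group_add, 'h) hmod
    \<Rightarrow> ('v, 'w, 'k) tensor \<Rightarrow> ('w, 'v, 'k) tensor" where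
  "braiding H R V W = contract_t H V W (\<lambda>v w.
     contract H H (\<lambda>r1 r2. tens W V (act W r2 w) (act V r1 v)) R)"


section \<open>Hopf algebras in the module category\<close>

definition algebra_in ::
  "('k::field, 'h::{ring,monoid_mult}) qgroupoid \<Rightarrow> ('k, 'v::ab_group_add, 'h) hmod
    \<Rightarrow> (('v, 'v, 'k) tensor \<Rightarrow> 'v) \<Rightarrow> ('h \<Rightarrow> 'v) \<Rightarrow> bool" where
  "algebra_in H V \<mu> \<eta> \<longleftrightarrow>
     (let I = unit_obj H; VV = tprod H V V in
      left_module H V \<and> hmod_hom H VV V \<mu> \<and> hmod_hom H I V \<eta> \<and>
      (\<forall>x\<in>carrier (tprod H VV V).
         \<mu> (tmap VV V V V \<mu> id x) = \<mu> (tmap V VV V V id \<mu> (tassoc V V V x))) \<and>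
      (\<forall>x\<in>carrier (tprod H I V). \<mu> (tmap I V V V \<eta> id x) = lunit H V x) \<and>
      (\<forall>x\<in>carrier (tprod H V I). \<mu> (tmap V I V V id \<eta> x) = runit H V x))"

definition coalgebra_in ::
  "('k::field, 'h::{ring,monoid_mult}) qgroupoid \<Rightarrow> ('k, 'v::ab_group_add, 'h) hmod
    \<Rightarrow> ('v \<Rightarrow> ('v, 'v, 'k) tensor) \<Rightarrow> ('v \<Rightarrow> 'h) \<Rightarrow> bool" where
  "coalgebra_in H V \<Delta> \<epsilon> \<longleftrightarrow>
     (let I = unit_obj H; VV = tprod H V V in
      left_module H V \<and> hmod_hom H V VV \<Delta> \<and> hmod_hom H V I \<epsilon> \<and>
      (\<forall>v\<in>carrier V. tassoc V V V (tmap V V VV V \<Delta> id (\<Delta> v)) = tmap V V V VV id \<Delta> (\<Delta> v)) \<and>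
      (\<forall>v\<in>carrier V. lunit H V (tmap V V I V \<epsilon> id (\<Delta> v)) = v) \<and>
      (\<forall>v\<in>carrier V. runit H V (tmap V V V I id \<epsilon> (\<Delta> v)) = v))"

text \<open>\<open>id \<otimes> \<Psi> \<otimes> id\<close> on \<open>(V \<otimes> V) \<otimes> (V \<otimes> V)\<close>, with the associators made explicit.\<close>

definition middle_braiding ::
  "('k::field, 'h::{ring,monoid_mult}) qgroupoid \<Rightarrow> ('h, 'h, 'k) tensor
    \<Rightarrow> ('k, 'v::ab_group_add, 'h) hmod
    \<Rightarrow> (('v, 'v, 'k) tensor, ('v, 'v, 'k) tensor, 'k) tensor
    \<Rightarrow> (('v, 'v, 'k) tensor, ('v, 'v, 'k) tensor, 'k) tensor" where
  "middle_braiding H R V x =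
     (let VV = tprod H V V; V_VV = tprod H V VV; VV_V = tprod H VV V in
      tassoc_inv V V VV
       (tmap V VV_V V V_VV id (tassoc V V V)
         (tmap V VV_V V VV_V id (tmap VV V VV V (braiding H R V V) id)
           (tmap V V_VV V VV_V id (tassoc_inv V V V)
             (tassoc V V VV x)))))"

text \<open>
  The unit object is identified with its tensor square by \<open>lunit H (unit_obj H)\<close>; the
  condition \<open>\<Delta> \<circ> \<eta> = \<eta> \<otimes> \<eta>\<close> is stated on \<open>I \<otimes>\<^sub>t I\<close>.
\<close>

definition bialgebra_in ::
  "('k::field, 'h::{ring,monoid_mult}) qgroupoid \<Rightarrow> ('h, 'h, 'k) tensor
    \<Rightarrow> ('k, 'v::ab_group_add, 'h) hmod
    \<Rightarrow> (('v, 'v, 'k) tensor \<Rightarrow> 'v) \<Rightarrow> ('h \<Rightarrow> 'v)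
    \<Rightarrow> ('v \<Rightarrow> ('v, 'v, 'k) tensor) \<Rightarrow> ('v \<Rightarrow> 'h) \<Rightarrow> bool" where
  "bialgebra_in H R V \<mu> \<eta> \<Delta> \<epsilon> \<longleftrightarrow>
     (let I = unit_obj H; VV = tprod H V V in
      algebra_in H V \<mu> \<eta> \<and> coalgebra_in H V \<Delta> \<epsilon> \<and>
      (\<forall>x\<in>carrier VV. \<Delta> (\<mu> x)
         = tmap VV VV V V \<mu> \<mu> (middle_braiding H R V (tmap V V VV VV \<Delta> \<Delta> x))) \<and>
      (\<forall>x\<in>carrier VV. \<epsilon> (\<mu> x) = lunit H I (tmap V V I I \<epsilon> \<epsilon> x)) \<and>
      (\<forall>x\<in>carrier (tprod H I I). \<Delta> (\<eta> (lunit H I x)) = tmap I I V V \<eta> \<eta> x))"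

definition hopf_algebra_in ::
  "('k::field, 'h::{ring,monoid_mult}) qgroupoid \<Rightarrow> ('h, 'h, 'k) tensor
    \<Rightarrow> ('k, 'v::ab_group_add, 'h) hmod
    \<Rightarrow> (('v, 'v, 'k) tensor \<Rightarrow> 'v) \<Rightarrow> ('h \<Rightarrow> 'v)
    \<Rightarrow> ('v \<Rightarrow> ('v, 'v, 'k) tensor) \<Rightarrow> ('v \<Rightarrow> 'h) \<Rightarrow> ('v \<Rightarrow> 'v) \<Rightarrow> bool" where
  "hopf_algebra_in H R V \<mu> \<eta> \<Delta> \<epsilon> S \<longleftrightarrow>
     bialgebra_in H R V \<mu> \<eta> \<Delta> \<epsilon> \<and> hmod_hom H V V S \<and>
     (\<forall>v\<in>carrier V. \<mu> (tmap V V V V S id (\<Delta> v)) = \<eta> (\<epsilon> v)) \<and>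
     (\<forall>v\<in>carrier V. \<mu> (tmap V V V V id S (\<Delta> v)) = \<eta> (\<epsilon> v))"


section \<open>The centralizer of the source space\<close>

definition source_centralizer :: "('k::field, 'l::{ring,monoid_mult}) qgroupoid \<Rightarrow> 'l set" where
  "source_centralizer L = {l. \<forall>x\<in>range (eps_s L). l * x = x * l}"

definition adjoint_act ::
  "('k::field, 'h::{ring,monoid_mult}) qgroupoid \<Rightarrow> ('h \<Rightarrow> 'l::{ring,monoid_mult})
    \<Rightarrow> 'h \<Rightarrow> 'l \<Rightarrow> 'l" where
  "adjoint_act H f h l = contract H H (\<lambda>h1 h2. f h1 * l * f (antipode H h2)) (comul H h)"

definition centralizer_module ::
  "('k::field, 'h::{ring,monoid_mult}) qgroupoid \<Rightarrow> ('k, 'l::{ring,monoid_mult}) qgroupoid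
    \<Rightarrow> ('h \<Rightarrow> 'l) \<Rightarrow> ('k, 'l, 'h) hmod" where
  "centralizer_module H L f =
     \<lparr>carrier = source_centralizer L, scl = scl L, act = adjoint_act H f\<rparr>"

definition mult_R ::
  "('k::field, 'h::{ring,monoid_mult}) qgroupoid \<Rightarrow> ('k, 'l::{ring,monoid_mult}) qgroupoid
    \<Rightarrow> ('h \<Rightarrow> 'l) \<Rightarrow> ('l, 'l, 'k) tensor \<Rightarrow> 'l" where
  "mult_R H L f = contract_t H (centralizer_module H L f) (centralizer_module H L f) (\<lambda>a b. a * b)"

definition comul_R ::
  "('k::field, 'h::{ring,monoid_mult}) qgroupoid \<Rightarrow> ('h, 'h, 'k) tensor
    \<Rightarrow> ('k, 'l::{ring,monoid_mult}) qgroupoid \<Rightarrow> ('h \<Rightarrow> 'l) \<Rightarrow> 'l \<Rightarrow> ('l, 'l, 'k) tensor" where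
  "comul_R H R L f l = contract L L (\<lambda>l1 l2. contract H H (\<lambda>r1 r2.
     tens L L (l1 * f (antipode H r2)) (adjoint_act H f r1 l2)) R) (comul L l)"

definition counit_R ::
  "('k::field, 'h::{ring,monoid_mult}) qgroupoid \<Rightarrow> ('k, 'l::{ring,monoid_mult}) qgroupoid
    \<Rightarrow> ('h \<Rightarrow> 'l) \<Rightarrow> 'l \<Rightarrow> 'h" where
  "counit_R H L f l = contract H H (\<lambda>a b. scl H (counit L (f a * l)) b) (comul H 1)"

definition antipode_R ::
  "('k::field, 'h::{ring,monoid_mult}) qgroupoid \<Rightarrow> ('h, 'h, 'k) tensor
    \<Rightarrow> ('k, 'l::{ring,monoid_mult}) qgroupoid \<Rightarrow> ('h \<Rightarrow> 'l) \<Rightarrow> 'l \<Rightarrow> 'l" where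
  "antipode_R H R L f l =
     contract H H (\<lambda>r1 r2. f r2 * antipode L (adjoint_act H f r1 l)) R"

end

theory Submission
  imports Defs
begin

text \<open>
  Let \<open>V = C\<^sub>L(L\<^sub>s)\<close>. The action of \<open>1\<close> is a projection of \<open>L\<close> onto \<open>V\<close>, so Sweedler
  expressions can be computed on all of \<open>L\<close> and restricted to \<open>V\<close> along this projection.
  For \<open>x \<in> V\<close> one has \<open>h x = (h\<^sub>1 \<cdot> x) h\<^sub>2\<close> and \<open>S(h\<^sub>1) (h\<^sub>2 \<cdot> x) = x S(h)\<close>; together with the
  hexagon identities for \<open>R\<close>, \<open>\<Delta>\<^sup>c\<^sup>o\<^sup>p(h) R = R \<Delta>(h)\<close> and the rules that slide elements of the
  source and target spaces from one leg of \<open>\<Delta>(1)\<close> or \<open>R\<close> to the other, these give all the axioms.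
  Coassociativity and \<open>H\<close>-linearity of the comultiplication hold for every \<open>l \<in> L\<close>. The left
  antipode axiom uses \<open>v = R\<^sup>2 S\<^sup>2(R\<^sup>1)\<close>, with \<open>v S\<^sup>2(h) = h v\<close> and \<open>R\<^sup>2 v S(R\<^sup>1) = 1\<close>. On the
  categorical side, morphisms out of iterated products \<open>\<otimes>\<^sub>t\<close> are determined by their values on
  the elements \<open>v \<otimes>\<^sub>t w\<close>.
\<close>

section \<open>Linear maps out of tensor products\<close>

text \<open>A Sweedler expression is a sum over an arbitrarily chosen list of pairs, so nothing is
  known about a single leg: the pairs representing \<open>comul L l\<close> for l in V need not lie
  in V. Information about legs enters through identities saying that a projection may be inserted at
  a leg at no cost: \<open>es\<close> and \<open>et\<close> at the legs of \<Delta>(1), the action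
  of 1 at l_2 and at both legs of the transmuted coproduct. Each change of representation costs a
  multilinearity proof; the rules in \<open>lin\<close> are stated for compositions with an inner
  linear map so that they chain. The factor S(R^2) \<otimes> R^1 in the comultiplication answers an
  obstacle. \<Delta>(h \<cdot> l) has the legs h_1 l_1 S(h_3) and h_2 \<cdot> l_2, where h_2 and h_3
  stand in the wrong order for H-linearity, and the intertwining property of R exchanges them. The
  element v enters because the antipode of l_1 S(R^2) contains S^2 of a leg of R, and passing v
  across removes this S^2.\<close>

named_theorems lin

section \<open>Linear, bilinear and trilinear maps on whole types\<close>

abbreviation klin :: "('k::field \<Rightarrow> 'a::ab_group_add \<Rightarrow> 'a) \<Rightarrow> ('k \<Rightarrow> 'b::ab_group_add \<Rightarrow> 'b) \<Rightarrow> ('a \<Rightarrow> 'b) \<Rightarrow> bool" where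
  "klin \<equiv> Vector_Spaces.linear"

text \<open>The scalar multiplication of a tensor space does not depend on the factors. A name of
  its own lets linearity rules apply to tensors of any kind, including those of
  \<open>tprod\<close>.\<close>

definition tscl :: "'k::field \<Rightarrow> ('v, 'w, 'k) tensor \<Rightarrow> ('v, 'w, 'k) tensor" where
  "tscl c t = (\<lambda>\<beta>. c * t \<beta>)"

lemma scl_tensor [simp]: "scl (tensor V W) = tscl"
  by (simp add: tensor_def tscl_def fun_eq_iff)

lemma vs_tscl [lin]: "vector_space tscl"
  by unfold_locales (simp_all add: tscl_def fun_eq_iff algebra_simps)

lemma vs_field [lin]: "vector_space ((*) :: 'k::field \<Rightarrow> 'k \<Rightarrow> 'k)"
  by unfold_locales (simp_all add: algebra_simps)

text \<open>Unlike \<open>kbilinear\<close>, this refers to no carriers: such a \<phi> can be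
  applied to the legs of any representation, and its target needs only a scalar
  multiplication.\<close>

definition bil :: "('k::field \<Rightarrow> 'a::ab_group_add \<Rightarrow> 'a) \<Rightarrow> ('k \<Rightarrow> 'b::ab_group_add \<Rightarrow> 'b)
    \<Rightarrow> ('k \<Rightarrow> 'c::ab_group_add \<Rightarrow> 'c) \<Rightarrow> ('a \<Rightarrow> 'b \<Rightarrow> 'c) \<Rightarrow> bool" where
  "bil s1 s2 t \<phi> \<longleftrightarrow> (\<forall>b. klin s1 t (\<lambda>a. \<phi> a b)) \<and> (\<forall>a. klin s2 t (\<phi> a))"

definition tri :: "('k::field \<Rightarrow> 'a::ab_group_add \<Rightarrow> 'a) \<Rightarrow> ('k \<Rightarrow> 'b::ab_group_add \<Rightarrow> 'b)
    \<Rightarrow> ('k \<Rightarrow> 'c::ab_group_add \<Rightarrow> 'c) \<Rightarrow> ('k \<Rightarrow> 'd::ab_group_add \<Rightarrow> 'd)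
    \<Rightarrow> ('a \<Rightarrow> 'b \<Rightarrow> 'c \<Rightarrow> 'd) \<Rightarrow> bool" where
  "tri s1 s2 s3 t \<phi> \<longleftrightarrow> (\<forall>b c. klin s1 t (\<lambda>a. \<phi> a b c)) \<and> (\<forall>a c. klin s2 t (\<lambda>b. \<phi> a b c))
     \<and> (\<forall>a b. klin s3 t (\<phi> a b))"

lemma bilI [lin]:
  assumes "\<And>b. klin s1 t (\<lambda>a. \<phi> a b)" "\<And>a. klin s2 t (\<lambda>b. \<phi> a b)"
  shows "bil s1 s2 t \<phi>"
  using assms by (simp add: bil_def)

lemma triI [lin]:
  assumes "\<And>b c. klin s1 t (\<lambda>a. \<phi> a b c)" "\<And>a c. klin s2 t (\<lambda>b. \<phi> a b c)"
    "\<And>a b. klin s3 t (\<lambda>c. \<phi> a b c)"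
  shows "tri s1 s2 s3 t \<phi>"
  using assms by (simp add: tri_def)

lemma klin_comp:
  assumes "klin s t h" "klin r s g"
  shows "klin r t (\<lambda>x. h (g x))"
  using Vector_Spaces.linear_compose[OF assms(2,1)] by (simp add: o_def)

lemma bil_vs: "bil s1 s2 t \<phi> \<Longrightarrow> vector_space t"
  by (auto simp: bil_def Vector_Spaces.linear_iff)

lemma bil_bal: "bil s1 s2 t \<phi> \<Longrightarrow> \<phi> (s1 k a) b = \<phi> a (s2 k b)"
  by (simp add: bil_def Vector_Spaces.linear_iff)

text \<open>In this composed form, a bilinear map that is only a variable takes part in the search
  by \<open>lin\<close>; hence the local declarations of \<open>bilD\<close> throughout.\<close>

lemma bil1: "bil s1 s2 t \<phi> \<Longrightarrow> klin r s1 g \<Longrightarrow> klin r t (\<lambda>x. \<phi> (g x) b)"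
  and bil2: "bil s1 s2 t \<phi> \<Longrightarrow> klin r s2 g \<Longrightarrow> klin r t (\<lambda>x. \<phi> a (g x))"
  by (auto simp: bil_def intro: klin_comp)

lemmas bilD = bil1 bil2 bil_vs

lemma tri1: "tri s1 s2 s3 t \<phi> \<Longrightarrow> klin r s1 g \<Longrightarrow> klin r t (\<lambda>x. \<phi> (g x) b c)"
  and tri2: "tri s1 s2 s3 t \<phi> \<Longrightarrow> klin r s2 g \<Longrightarrow> klin r t (\<lambda>x. \<phi> a (g x) c)"
  and tri3: "tri s1 s2 s3 t \<phi> \<Longrightarrow> klin r s3 g \<Longrightarrow> klin r t (\<lambda>x. \<phi> a b (g x))"
  by (auto simp: tri_def intro: klin_comp[of s1 t "\<lambda>a. \<phi> a b c"] klin_comp[of s2 t "\<lambda>b. \<phi> a b c"]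
        klin_comp[of s3 t "\<phi> a b"])

lemma tri_bil: "tri s1 s2 s3 t T \<Longrightarrow> bil s2 s3 t (T a)"
  by (auto simp: tri_def bil_def)

lemma klin_id: "vector_space s \<Longrightarrow> klin s s (\<lambda>x. x)"
  by (simp add: vector_space.linear_ident)

lemma klin_add: "klin s t g \<Longrightarrow> g (x + y) = g x + g y"
  and klin_scale: "klin s t g \<Longrightarrow> g (s c x) = t c (g x)"
  by (simp_all add: Vector_Spaces.linear_iff)

lemma klin_0: "klin s t g \<Longrightarrow> g 0 = 0"
  using klin_add[of s t g 0 0] by simp

lemma klin_vs: "klin s t g \<Longrightarrow> vector_space s" "klin s t g \<Longrightarrow> vector_space t"
  by (simp_all add: Vector_Spaces.linear_iff)

section \<open>Contractions over a chosen representation\<close>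

definition pairs_of where
  "pairs_of V W t = (SOME ps. set ps \<subseteq> carrier V \<times> carrier W \<and> t = (\<Sum>(v, w)\<leftarrow>ps. tens V W v w))"

text \<open>
  Since \<open>contract\<close> is a sum over a chosen list of pairs, contractions commute with each other
  and with additive maps unconditionally; multilinearity is needed only for passing to another
  representation of a tensor.
\<close>

lemma contract_pairs_of: "contract V W \<phi> t = (\<Sum>(v, w)\<leftarrow>pairs_of V W t. \<phi> v w)"
  by (simp add: contract_def lift_via_def pairs_of_def Let_def)

lemma pairs_of:
  assumes "t \<in> carrier (tensor V W)"
  shows "set (pairs_of V W t) \<subseteq> carrier V \<times> carrier W" "(\<Sum>(v, w)\<leftarrow>pairs_of V W t. tens V W v w) = t"
  using assms someI_ex[of "\<lambda>ps. set ps \<subseteq> carrier V \<times> carrier W \<and> t = (\<Sum>(v, w)\<leftarrow>ps. tens V W v w)"]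
  unfolding pairs_of_def tensor_def by auto

lemma klin_sum_list: "klin s t g \<Longrightarrow> g (\<Sum>x\<leftarrow>xs. h x) = (\<Sum>x\<leftarrow>xs. g (h x))"
  by (induction xs) (auto simp: klin_add klin_0)

lemma klin_contract:
  assumes "klin s t g"
  shows "g (contract V W \<phi> u) = contract V W (\<lambda>a b. g (\<phi> a b)) u"
  unfolding contract_pairs_of by (simp add: klin_sum_list[OF assms] split_def)

lemma bil_contract1: "bil s1 s2 t \<phi> \<Longrightarrow> \<phi> (contract V W \<psi> u) b = contract V W (\<lambda>x y. \<phi> (\<psi> x y) b) u"
  and bil_contract2: "bil s1 s2 t \<phi> \<Longrightarrow> \<phi> a (contract V W \<psi> u) = contract V W (\<lambda>x y. \<phi> a (\<psi> x y)) u"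
  using klin_contract[of s1 t "\<lambda>x. \<phi> x b"] klin_contract[of s2 t "\<phi> a"] by (auto simp: bil_def)

lemma contract_mult_right: "contract V W \<phi> u * (c :: 'a::ring) = contract V W (\<lambda>a b. \<phi> a b * c) u"
  unfolding contract_pairs_of split_def by (simp add: sum_list_mult_const)

lemma contract_mult_left: "(c :: 'a::ring) * contract V W \<phi> u = contract V W (\<lambda>a b. c * \<phi> a b) u"
  unfolding contract_pairs_of split_def by (simp add: sum_list_const_mult)

lemma contract_swap:
  "contract V W (\<lambda>a b. contract V' W' (\<lambda>c d. \<phi> a b c d) s) t
   = contract V' W' (\<lambda>c d. contract V W (\<lambda>a b. \<phi> a b c d) t) s"
proof -
  have "(\<Sum>p\<leftarrow>xs. \<Sum>q\<leftarrow>ys. (g p q :: 'x::ab_group_add)) = (\<Sum>q\<leftarrow>ys. \<Sum>p\<leftarrow>xs. g p q)"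
    for xs :: "'y list" and ys :: "'z list" and g
    by (induction xs) (auto simp: sum_list_addf)
  then show ?thesis unfolding contract_pairs_of split_def .
qed

lemma contract_cong:
  assumes "\<And>a b. \<phi> a b = \<psi> a b"
  shows "contract V W \<phi> t = contract V W \<psi> t"
  using assms by presburger

lemma contract_cong_carrier:
  assumes "t \<in> carrier (tensor V W)" "\<And>a b. a \<in> carrier V \<Longrightarrow> b \<in> carrier W \<Longrightarrow> \<phi> a b = \<psi> a b"
  shows "contract V W \<phi> t = contract V W \<psi> t"
  unfolding contract_pairs_of using pairs_of(1)[OF assms(1)]
  by (intro arg_cong[where f=sum_list] map_cong) (auto intro: assms(2))

lemma klin_contract_fun [lin]:
  assumes "\<And>a b. klin s t (\<lambda>x. \<phi> x a b)" "vector_space s" "vector_space t"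
  shows "klin s t (\<lambda>x. contract V W (\<phi> x) u)"
proof -
  have "klin s t (\<lambda>x. \<Sum>p\<leftarrow>xs. \<phi> x (fst p) (snd p))" for xs
  proof (induction xs)
    case Nil
    interpret vector_space t by fact
    show ?case using assms(2,3) by (simp add: Vector_Spaces.linear_iff)
  next
    case (Cons a xs)
    interpret vector_space t by fact
    show ?case
      using Cons assms by (simp add: Vector_Spaces.linear_iff scale_right_distrib add_ac)
  qed
  then show ?thesis unfolding contract_pairs_of split_def .
qed

lemma tens_add1: "tens V W (a + b) x = tens V W a x + tens V W b x"
  and tens_add2: "tens V W a (x + y) = tens V W a x + tens V W a y"
  and tens_scale1: "tens V W (scl V k a) x = tscl k (tens V W a x)"
  and tens_scale2: "tens V W a (scl W k x) = tscl k (tens V W a x)"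
  by (auto simp: tens_def fun_eq_iff tscl_def kbilinear_def klinear_def)

lemma klin_tens1:
  assumes "klin s (scl V) g"
  shows "klin s tscl (\<lambda>x. tens V W (g x) c)"
  using assms vs_tscl by (auto simp: Vector_Spaces.linear_iff tens_add1 tens_scale1)

lemma klin_tens2:
  assumes "klin s (scl W) g"
  shows "klin s tscl (\<lambda>x. tens V W c (g x))"
  using assms vs_tscl by (auto simp: Vector_Spaces.linear_iff tens_add2 tens_scale2)

lemma klin_tens1_tensor [lin]: "klin s tscl g \<Longrightarrow> klin s tscl (\<lambda>x. tens (tensor V W) Z (g x) c)"
  and klin_tens2_tensor [lin]: "klin s tscl g \<Longrightarrow> klin s tscl (\<lambda>x. tens Z (tensor V W) c (g x))"
  by (simp_all add: klin_tens1 klin_tens2)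

lemma tens_cong_scl: "scl V = scl V' \<Longrightarrow> scl W = scl W' \<Longrightarrow> tens V W = tens V' W'"
  unfolding tens_def by (simp only:)

section \<open>Tensor products of subspaces\<close>

definition full :: "('k::field, 'v::ab_group_add, 'z) vspace_scheme \<Rightarrow> bool" where
  "full V \<longleftrightarrow> vector_space (scl V) \<and> carrier V = UNIV"

lemma full_kspace: "full V \<Longrightarrow> kspace V"
  by (simp add: full_def kspace_def vector_space_def module.subspace_UNIV module_def)

lemma kspace_whole: "vector_space s \<Longrightarrow> kspace (whole s)"
  by (rule full_kspace) (simp add: full_def)

lemma kbilinear_of_bil: "bil (scl V) (scl W) t \<phi> \<Longrightarrow> kbilinear V W (whole t) \<phi>"
  by (auto simp: bil_def kbilinear_def klinear_def Vector_Spaces.linear_iff)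

lemma tens_in [simp]: "a \<in> carrier V \<Longrightarrow> b \<in> carrier W \<Longrightarrow> tens V W a b \<in> carrier (tensor V W)"
  by (auto simp: tensor_def intro!: exI[of _ "[(a, b)]"])

lemma sum_list_tens_in: "set ps \<subseteq> carrier V \<times> carrier W \<Longrightarrow> (\<Sum>(v, w)\<leftarrow>ps. tens V W v w) \<in> carrier (tensor V W)"
  by (auto simp: tensor_def)

lemma contract_tens_bil:
  assumes "kspace V" "kspace W" "bil (scl V) (scl W) t \<phi>" "a \<in> carrier V" "b \<in> carrier W"
  shows "contract V W \<phi> (tens V W a b) = \<phi> a b"
  using contract_tens[OF assms(1,2) kspace_whole[OF bil_vs[OF assms(3)]] kbilinear_of_bil[OF assms(3)]] assms(4,5)
  by blast

lemma kspace_tensor: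
  assumes V: "kspace V"
  shows "kspace (tensor V W)"
proof -
  interpret vector_space "tscl :: 'a \<Rightarrow> ('b, 'd, 'a) tensor \<Rightarrow> _" by (rule vs_tscl)
  have 0: "0 \<in> carrier (tensor V W)" using sum_list_tens_in[of "[]" V W] by simp
  have add: "x + y \<in> carrier (tensor V W)" if "x \<in> carrier (tensor V W)" "y \<in> carrier (tensor V W)" for x y
  proof -
    from that obtain ps qs where "set ps \<subseteq> carrier V \<times> carrier W" "x = (\<Sum>(v, w)\<leftarrow>ps. tens V W v w)"
      "set qs \<subseteq> carrier V \<times> carrier W" "y = (\<Sum>(v, w)\<leftarrow>qs. tens V W v w)"
      by (auto simp: tensor_def)
    then show ?thesis using sum_list_tens_in[of "ps @ qs" V W] by simp
  qed
  have scl: "tscl c x \<in> carrier (tensor V W)" if x: "x \<in> carrier (tensor V W)" for c x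
  proof -
    have Vs: "scl V c v \<in> carrier V" if "v \<in> carrier V" for v
    proof -
      interpret V: vector_space "scl V" using V by (simp add: kspace_def)
      show ?thesis using V that by (simp add: kspace_def V.subspace_scale)
    qed
    from x obtain ps where ps: "set ps \<subseteq> carrier V \<times> carrier W" "x = (\<Sum>(v, w)\<leftarrow>ps. tens V W v w)"
      by (auto simp: tensor_def)
    have "tscl c (\<Sum>(v, w)\<leftarrow>ps. tens V W v w) = (\<Sum>(v, w)\<leftarrow>map (\<lambda>(v, w). (scl V c v, w)) ps. tens V W v w)"
      by (induction ps) (auto simp: fun_eq_iff tens_scale1 tscl_def algebra_simps split_def)
    moreover have "set (map (\<lambda>(v, w). (scl V c v, w)) ps) \<subseteq> carrier V \<times> carrier W"
      using ps(1) Vs by auto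
    ultimately show ?thesis using sum_list_tens_in ps(2) by metis
  qed
  show ?thesis
    unfolding kspace_def scl_tensor
    using 0 add scl by (auto simp: vs_tscl subspace_def)
qed

lemma kspace_sum_list:
  assumes "kspace X" "\<And>p. p \<in> set ps \<Longrightarrow> h p \<in> carrier X"
  shows "(\<Sum>p\<leftarrow>ps. h p) \<in> carrier X"
proof -
  interpret vector_space "scl X" using assms by (simp add: kspace_def)
  show ?thesis using assms by (induction ps) (auto simp: kspace_def subspace_0 subspace_add)
qed

lemma contract_in:
  assumes "kspace X" "t \<in> carrier (tensor V W)"
    "\<And>a b. a \<in> carrier V \<Longrightarrow> b \<in> carrier W \<Longrightarrow> \<phi> a b \<in> carrier X"
  shows "contract V W \<phi> t \<in> carrier X"
  unfolding contract_pairs_of using pairs_of(1)[OF assms(2)] by (intro kspace_sum_list assms) (auto intro: assms(3))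

lemma contract_tens_self: "t \<in> carrier (tensor V W) \<Longrightarrow> contract V W (tens V W) t = t"
  unfolding contract_pairs_of by (simp add: pairs_of)

text \<open>For maps that are linear on a carrier only: the chosen pairs lie in the carriers of V
  and W, so every summand that occurs lies in X.\<close>

lemma klinear_contract_elem:
  assumes "klinear X Y g" "kspace X" "t \<in> carrier (tensor V W)"
    "\<And>a b. a \<in> carrier V \<Longrightarrow> b \<in> carrier W \<Longrightarrow> \<phi> a b \<in> carrier X"
  shows "g (contract V W \<phi> t) = contract V W (\<lambda>a b. g (\<phi> a b)) t"
proof -
  have "set (map (\<lambda>(a, b). \<phi> a b) (pairs_of V W t)) \<subseteq> carrier X"
    using pairs_of(1)[OF assms(3)] assms(4) by auto
  from klinear_sum_list[OF assms(2,1) this] show ?thesis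
    unfolding contract_pairs_of by (simp add: o_def split_def)
qed

lemma tensor_ext:
  assumes "klinear (tensor V W) X F" "klinear (tensor V W) X' G" "kspace V"
    "\<And>v w. v \<in> carrier V \<Longrightarrow> w \<in> carrier W \<Longrightarrow> F (tens V W v w) = G (tens V W v w)"
    "t \<in> carrier (tensor V W)"
  shows "F t = G t"
proof -
  have "F t = F (contract V W (tens V W) t)" "G t = G (contract V W (tens V W) t)"
    by (simp_all add: contract_tens_self assms)
  then show ?thesis
    using klinear_contract_elem[OF assms(1) kspace_tensor[OF assms(3)] assms(5), of "tens V W"]
      klinear_contract_elem[OF assms(2) kspace_tensor[OF assms(3)] assms(5), of "tens V W"]
      contract_cong_carrier[OF assms(5,4)]
    by simp
qed

text \<open>The two contractions may choose different lists, but one list representing t over the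
  smaller spaces also represents it over the larger ones, and bilinearity evaluates both on that
  list.\<close>

lemma contract_mono:
  assumes V: "kspace V" "kspace V'" and W: "kspace W" "kspace W'" and X: "kspace X"
    and sub: "carrier V \<subseteq> carrier V'" "carrier W \<subseteq> carrier W'"
    and scl: "scl V = scl V'" "scl W = scl W'"
    and \<phi>: "kbilinear V' W' X \<phi>" and t: "t \<in> carrier (tensor V W)"
  shows "contract V W \<phi> t = contract V' W' \<phi> t"
proof -
  from t obtain ps where ps: "set ps \<subseteq> carrier V \<times> carrier W" "t = (\<Sum>(v, w)\<leftarrow>ps. tens V W v w)"
    by (auto simp: tensor_def)
  have \<phi>': "kbilinear V W X \<phi>" using \<phi> sub scl by (auto simp: kbilinear_def klinear_def subset_iff)
  have t': "t = (\<Sum>(v, w)\<leftarrow>ps. tens V' W' v w)" using ps(2) tens_cong_scl[OF scl] by simp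
  have "set ps \<subseteq> carrier V' \<times> carrier W'" using ps(1) sub by auto
  from contract_sum_list[OF V(2) W(2) X \<phi> this] contract_sum_list[OF V(1) W(1) X \<phi>' ps(1)]
  show ?thesis using ps(2) t' by simp
qed

lemma tensor_mono:
  assumes "carrier V \<subseteq> carrier V'" "carrier W \<subseteq> carrier W'" "scl V = scl V'" "scl W = scl W'"
  shows "carrier (tensor V W) \<subseteq> carrier (tensor V' W')"
  using assms(1,2) tens_cong_scl[OF assms(3,4)] by (fastforce simp: tensor_def)

lemma klinear_contract_bil:
  assumes "kspace V" "kspace W" "bil (scl V) (scl W) t \<phi>"
  shows "klinear (tensor V W) (whole t) (contract V W \<phi>)"
  using klinear_contract[OF assms(1,2) kspace_whole[OF bil_vs[OF assms(3)]] kbilinear_of_bil[OF assms(3)]] .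

text \<open>A contraction is linear only on genuine tensors, since elsewhere the chosen list is
  arbitrary. This is why g must take its values in the tensor product.\<close>

lemma klin_contract_arg:
  assumes "klin s tscl g" "\<And>x. g x \<in> carrier (tensor V W)" "kspace V" "kspace W" "bil (scl V) (scl W) t \<phi>"
  shows "klin s t (\<lambda>x. contract V W \<phi> (g x))"
  using klinear_contract_bil[OF assms(3-5)] assms(1,2) bil_vs[OF assms(5)]
  by (auto simp: klinear_def Vector_Spaces.linear_iff)

lemma contract_contract:
  assumes "kspace V" "kspace W" "bil (scl V) (scl W) t \<phi>" "kspace V'" "u \<in> carrier (tensor V' W')"
    "\<And>a b. a \<in> carrier V' \<Longrightarrow> b \<in> carrier W' \<Longrightarrow> \<psi> a b \<in> carrier (tensor V W)"
  shows "contract V W \<phi> (contract V' W' \<psi> u) = contract V' W' (\<lambda>a b. contract V W \<phi> (\<psi> a b)) u"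
  using klinear_contract_elem[OF klinear_contract_bil[OF assms(1-3)] kspace_tensor[OF assms(1)] assms(5,6)]
  by simp

text \<open>The conclusion is \<open>kbilinear\<close> rather than \<open>bil\<close> because the
  inner contraction is additive in p only for p in the tensor product. This and its mirror image
  make the nested contractions in the associators well behaved.\<close>

lemma kbilinear_contract_left:
  assumes V: "kspace V" and W: "kspace W" and T: "tri (scl V) (scl W) (scl Z) t T"
  shows "kbilinear (tensor V W) Z (whole t) (\<lambda>p c. contract V W (\<lambda>a b. T a b c) p)"
proof -
  have b: "bil (scl V) (scl W) t (\<lambda>a b. T a b c)" for c
    using T by (auto simp: tri_def bil_def)
  have z: "klin (scl Z) t (\<lambda>c. contract V W (\<lambda>a b. T a b c) p)" for p
    using T klin_vs[of "scl Z" t "T undefined undefined"] by (intro klin_contract_fun) (auto simp: tri_def)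
  show ?thesis
    using klinear_contract_bil[OF V W b] z
    by (auto simp: kbilinear_def klinear_def Vector_Spaces.linear_iff)
qed

lemma kbilinear_contract_right:
  assumes V: "kspace V" and W: "kspace W" and T: "tri (scl Z) (scl V) (scl W) t T"
  shows "kbilinear Z (tensor V W) (whole t) (\<lambda>c p. contract V W (\<lambda>a b. T c a b) p)"
proof -
  have b: "bil (scl V) (scl W) t (T c)" for c
    using T by (auto simp: tri_def bil_def)
  have z: "klin (scl Z) t (\<lambda>c. contract V W (T c) p)" for p
    using T klin_vs[of "scl Z" t "\<lambda>c. T c undefined undefined"] by (intro klin_contract_fun) (auto simp: tri_def)
  show ?thesis
    using klinear_contract_bil[OF V W b] z
    by (auto simp: kbilinear_def klinear_def Vector_Spaces.linear_iff)
qed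

lemma klin_scale_fun:
  assumes "vector_space t" "klin s (*) g"
  shows "klin s t (\<lambda>x. t (g x) v)"
  using assms by (auto simp: Vector_Spaces.linear_iff vector_space_def module_def)

lemma klin_scale_const:
  assumes "klin s t g"
  shows "klin s t (\<lambda>x. t c (g x))"
  using assms
  by (auto simp: Vector_Spaces.linear_iff vector_space_def module_def mult.commute)

lemma klin_field1 [lin]: "klin s (*) g \<Longrightarrow> klin s (*) (\<lambda>x. g x * (c::'k::field))"
  and klin_field2 [lin]: "klin s (*) g \<Longrightarrow> klin s (*) (\<lambda>x. (c::'k::field) * g x)"
  by (auto simp: Vector_Spaces.linear_iff algebra_simps)

lemmas [lin] = klin_id klin_scale_const[of _ "tscl"] klin_scale_fun[OF vs_tscl]

lemma klinear_contract_fun: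
  assumes "\<And>a b. klinear V (whole t) (\<lambda>x. \<phi> x a b)" "vector_space t"
  shows "klinear V (whole t) (\<lambda>x. contract A B (\<phi> x) u)"
proof -
  interpret vector_space t by fact
  have "klinear V (whole t) (\<lambda>x. \<Sum>p\<leftarrow>xs. \<phi> x (fst p) (snd p))" for xs
    using assms(1) by (induction xs) (auto simp: klinear_def scale_right_distrib add_ac)
  then show ?thesis unfolding contract_pairs_of split_def .
qed

text \<open>The variant of \<open>klin_contract_fun\<close> for module actions, where h \<cdot> v is
  linear in h for v in the carrier.\<close>

lemma klin_contract_fun_carrier:
  assumes "u \<in> carrier (tensor V W)" "\<And>a b. a \<in> carrier V \<Longrightarrow> b \<in> carrier W \<Longrightarrow> klin s t (\<lambda>x. \<phi> x a b)"
    and "vector_space s" "vector_space t"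
  shows "klin s t (\<lambda>x. contract V W (\<phi> x) u)"
proof -
  have "klin s t (\<lambda>x. \<Sum>p\<leftarrow>xs. \<phi> x (fst p) (snd p))" if "set xs \<subseteq> carrier V \<times> carrier W" for xs
    using that
  proof (induction xs)
    case Nil
    interpret vector_space t by fact
    show ?case using assms(3,4) by (simp add: Vector_Spaces.linear_iff)
  next
    case (Cons a xs)
    interpret vector_space t by fact
    have "klin s t (\<lambda>x. \<phi> x (fst a) (snd a))" using Cons.prems by (intro assms(2)) auto
    then show ?case
      using Cons by (simp add: Vector_Spaces.linear_iff scale_right_distrib add_ac)
  qed
  from this[OF pairs_of(1)[OF assms(1)]] show ?thesis unfolding contract_pairs_of split_def .
qed

lemma klinear_whole: "klinear V X g \<Longrightarrow> klinear V (whole (scl X)) g"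
  by (simp add: klinear_def)

lemma klinear_into: "klinear V (whole (scl X)) g \<Longrightarrow> (\<And>v. v \<in> carrier V \<Longrightarrow> g v \<in> carrier X) \<Longrightarrow> klinear V X g"
  by (simp add: klinear_def)

lemma klinear_sub: "klinear V X g \<Longrightarrow> carrier V' \<subseteq> carrier V \<Longrightarrow> scl V' = scl V \<Longrightarrow> klinear V' X g"
  by (simp add: klinear_def subset_iff)

lemma kspace_0: "kspace V \<Longrightarrow> 0 \<in> carrier V"
  and kspace_add: "kspace V \<Longrightarrow> x \<in> carrier V \<Longrightarrow> y \<in> carrier V \<Longrightarrow> x + y \<in> carrier V"
  and kspace_scale: "kspace V \<Longrightarrow> x \<in> carrier V \<Longrightarrow> scl V c x \<in> carrier V"
proof -
  assume "kspace V"
  then interpret vector_space "scl V" by (simp add: kspace_def)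
  have "subspace (carrier V)" using \<open>kspace V\<close> by (simp add: kspace_def)
  then show "0 \<in> carrier V" "x \<in> carrier V \<Longrightarrow> y \<in> carrier V \<Longrightarrow> x + y \<in> carrier V"
    "x \<in> carrier V \<Longrightarrow> scl V c x \<in> carrier V"
    by (auto intro: subspace_0 subspace_add subspace_scale)
qed

lemma klinear_comp: "klinear V W g \<Longrightarrow> klinear W X h \<Longrightarrow> klinear V X (\<lambda>v. h (g v))"
  by (simp add: klinear_def)

lemma klinear_in: "klinear V W g \<Longrightarrow> v \<in> carrier V \<Longrightarrow> g v \<in> carrier W"
  by (simp add: klinear_def)

lemma klinear_tens_left: "klinear V (whole (scl A)) g \<Longrightarrow> klinear V (whole tscl) (\<lambda>v. tens A B (g v) b)"
  by (simp add: klinear_def tens_add1 tens_scale1)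

lemma klinear_tens_right: "klinear V (whole (scl B)) g \<Longrightarrow> klinear V (whole tscl) (\<lambda>v. tens A B a (g v))"
  by (simp add: klinear_def tens_add2 tens_scale2)

lemma klinear_tens2: "klinear V (whole tscl) g \<Longrightarrow> klinear V (whole tscl) (\<lambda>x. tens Z (tensor V' W') c (g x))"
  by (auto simp: klinear_def tens_add2 tens_scale2[where W = "tensor V' W'", simplified])

lemma klinear_of_klin: "klin (scl V) t g \<Longrightarrow> klinear V (whole t) g"
  by (auto simp: klinear_def Vector_Spaces.linear_iff)

lemma kspace_vs: "kspace V \<Longrightarrow> vector_space (scl V)"
  by (simp add: kspace_def)

section \<open>Tensor products of maps and associators\<close>

lemma tmap_tens:
  assumes "kspace V" "kspace W" "klinear V V1 g" "klinear W W1 h" "v \<in> carrier V" "w \<in> carrier W"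
  shows "tmap V W V1 W1 g h (tens V W v w) = tens V1 W1 (g v) (h w)"
    and "klinear (tensor V W) (whole tscl) (tmap V W V1 W1 g h)"
proof -
  have k: "kbilinear V W (whole tscl) (\<lambda>v w. tens V1 W1 (g v) (h w))"
    unfolding kbilinear_def
    by (intro conjI ballI klinear_tens_left klinear_tens_right klinear_whole assms)
  show "tmap V W V1 W1 g h (tens V W v w) = tens V1 W1 (g v) (h w)"
    unfolding tmap_def by (rule contract_tens[OF assms(1,2) kspace_whole[OF vs_tscl] k assms(5,6)])
  show "klinear (tensor V W) (whole tscl) (tmap V W V1 W1 g h)"
    unfolding tmap_def by (rule klinear_contract[OF assms(1,2) kspace_whole[OF vs_tscl] k])
qed

lemma contract_tmap:
  assumes V: "kspace V" and W: "kspace W" and X: "kspace X" and Y: "kspace Y" and Z: "kspace Z"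
    and g: "klinear V X g" and h: "klinear W Y h" and \<phi>: "kbilinear X Y Z \<phi>" and t: "t \<in> carrier (tensor V W)"
  shows "contract X Y \<phi> (tmap V W X Y g h t) = contract V W (\<lambda>v w. \<phi> (g v) (h w)) t"
proof -
  have "contract X Y \<phi> (tmap V W X Y g h t) = contract V W (\<lambda>v w. contract X Y \<phi> (tens X Y (g v) (h w))) t"
    unfolding tmap_def
    by (rule klinear_contract_elem[OF klinear_contract[OF X Y Z \<phi>] kspace_tensor[OF X] t])
      (intro tens_in klinear_in[OF g] klinear_in[OF h])
  also have "\<dots> = contract V W (\<lambda>v w. \<phi> (g v) (h w)) t"
    by (rule contract_cong_carrier[OF t], rule contract_tens[OF X Y Z \<phi>])
      (auto intro: klinear_in[OF g] klinear_in[OF h])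
  finally show ?thesis .
qed

lemma klinear_tassoc:
  assumes "kspace U" "kspace V" "kspace W"
  shows "klinear (tensor (tensor U V) W) (whole tscl) (tassoc U V W)"
    and "p \<in> carrier (tensor U V) \<Longrightarrow> w \<in> carrier W \<Longrightarrow>
      tassoc U V W (tens (tensor U V) W p w) = contract U V (\<lambda>u v. tens U (tensor V W) u (tens V W v w)) p"
proof -
  note [lin] = klin_tens1[of _ U] klin_tens1[of _ V] klin_tens2[of _ W] assms[THEN kspace_vs]
  have "tri (scl U) (scl V) (scl W) tscl (\<lambda>u v w. tens U (tensor V W) u (tens V W v w))"
    by (rule lin)+
  note k = kbilinear_contract_left[OF assms(1,2) this]
  note * = kspace_tensor[OF assms(1), of V] assms(3) kspace_whole[OF vs_tscl] k
  show "klinear (tensor (tensor U V) W) (whole tscl) (tassoc U V W)"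
    unfolding tassoc_def by (rule klinear_contract[OF *])
  show "p \<in> carrier (tensor U V) \<Longrightarrow> w \<in> carrier W \<Longrightarrow>
      tassoc U V W (tens (tensor U V) W p w) = contract U V (\<lambda>u v. tens U (tensor V W) u (tens V W v w)) p"
    unfolding tassoc_def by (rule contract_tens[OF *])
qed

lemma klinear_tassoc_inv:
  assumes "kspace U" "kspace V" "kspace W"
  shows "klinear (tensor U (tensor V W)) (whole tscl) (tassoc_inv U V W)"
    and "u \<in> carrier U \<Longrightarrow> p \<in> carrier (tensor V W) \<Longrightarrow>
      tassoc_inv U V W (tens U (tensor V W) u p) = contract V W (\<lambda>v w. tens (tensor U V) W (tens U V u v) w) p"
proof -
  note [lin] = klin_tens1[of _ U] klin_tens2[of _ V] klin_tens2[of _ W] assms[THEN kspace_vs]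
  have "tri (scl U) (scl V) (scl W) tscl (\<lambda>u v w. tens (tensor U V) W (tens U V u v) w)"
    by (rule lin)+
  note k = kbilinear_contract_right[OF assms(2,3) this]
  note * = assms(1) kspace_tensor[OF assms(2), of W] kspace_whole[OF vs_tscl] k
  show "klinear (tensor U (tensor V W)) (whole tscl) (tassoc_inv U V W)"
    unfolding tassoc_inv_def by (rule klinear_contract[OF *])
  show "u \<in> carrier U \<Longrightarrow> p \<in> carrier (tensor V W) \<Longrightarrow>
      tassoc_inv U V W (tens U (tensor V W) u p) = contract V W (\<lambda>v w. tens (tensor U V) W (tens U V u v) w) p"
    unfolding tassoc_inv_def by (rule contract_tens[OF *])
qed

section \<open>Weak Hopf algebras\<close>

locale qgroupoid =
  fixes H :: "('k::field, 'h::{ring,monoid_mult}) qgroupoid"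
  assumes quantum_groupoid_H: "quantum_groupoid H"
begin

text \<open>
  \<open>D h \<phi>\<close> is the Sweedler expression \<open>\<phi>(h\<^sub>1, h\<^sub>2)\<close>. An identity between elements of \<open>H \<otimes> H\<close> is
  stated for its images under an arbitrary bilinear \<open>\<phi>\<close>.
\<close>

abbreviation D :: "'h \<Rightarrow> ('h \<Rightarrow> 'h \<Rightarrow> 'u::ab_group_add) \<Rightarrow> 'u" where
  "D h \<phi> \<equiv> contract H H \<phi> (comul H h)"
abbreviation "\<epsilon> \<equiv> counit H"
abbreviation "S \<equiv> antipode H"
abbreviation "et \<equiv> eps_t H"
abbreviation "es \<equiv> eps_s H"
abbreviation "sc \<equiv> scl H"

lemma weak_bialgebra_H: "weak_bialgebra H" and k_algebra_H: "k_algebra H" and k_coalgebra_H: "k_coalgebra H"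
  using quantum_groupoid_H by (auto simp: quantum_groupoid_def weak_bialgebra_def)

lemma carrier_H [simp]: "carrier H = UNIV"
  using k_algebra_H by (simp add: k_algebra_def)

lemma ks [simp, intro]: "kspace H"
  using k_algebra_H by (simp add: k_algebra_def)

lemma vs [lin]: "vector_space sc"
  using ks by (simp add: kspace_def)

lemma comul_in [simp]: "comul H h \<in> carrier (tensor H H)"
  using k_coalgebra_H by (simp add: k_coalgebra_def klinear_def)

lemma tens_H_in [simp]: "tens H H a b \<in> carrier (tensor H H)"
  by simp

lemma sc_mult: "sc c (x * y) = sc c x * y" "sc c (x * y) = x * sc c y"
  using k_algebra_H unfolding k_algebra_def by blast+

lemma lin_mult1 [lin]: "klin s sc g \<Longrightarrow> klin s sc (\<lambda>x. g x * c)"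
  and lin_mult2 [lin]: "klin s sc g \<Longrightarrow> klin s sc (\<lambda>x. c * g x)"
  by (simp_all add: Vector_Spaces.linear_iff algebra_simps sc_mult[symmetric])

lemma lin_comul [lin]: "klin s sc g \<Longrightarrow> klin s tscl (\<lambda>x. comul H (g x))"
  and lin_counit [lin]: "klin s sc g \<Longrightarrow> klin s (*) (\<lambda>x. \<epsilon> (g x))"
  using k_coalgebra_H vs_tscl vs_field by (auto simp: k_coalgebra_def klinear_def Vector_Spaces.linear_iff)

lemma lin_S [lin]: "klin s sc g \<Longrightarrow> klin s sc (\<lambda>x. S (g x))"
  using quantum_groupoid_H by (auto simp: quantum_groupoid_def klinear_def Vector_Spaces.linear_iff)

lemmas [lin] = klin_scale_fun[OF vs] klin_scale_const[of _ sc] klin_tens1[of _ H] klin_tens2[of _ H]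

lemmas counit_contract = klin_contract[OF lin_counit[OF klin_id[OF vs]]]
  and S_contract = klin_contract[OF lin_S[OF klin_id[OF vs]]]
  and counit_sc [simp] = klin_scale[OF lin_counit[OF klin_id[OF vs]]]
  and S_sc [simp] = klin_scale[OF lin_S[OF klin_id[OF vs]]]

lemma lin_D [lin]:
  assumes "klin s sc g" "bil sc sc t \<phi>"
  shows "klin s t (\<lambda>x. D (g x) \<phi>)"
  by (rule klin_contract_arg) (auto intro: assms lin_comul)

lemma D_contract:
  assumes "bil sc sc t \<psi>"
  shows "D (contract V W \<phi> u) \<psi> = contract V W (\<lambda>a b. D (\<phi> a b) \<psi>) u"
  by (rule klin_contract[OF lin_D]) (auto intro: assms lin)

lemma contract_tens_H:
  assumes "bil sc sc t \<phi>"
  shows "contract H H \<phi> (tens H H a b) = \<phi> a b"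
  by (rule contract_tens_bil) (auto intro: assms)

lemma contract_contract_H:
  assumes "bil sc sc t \<phi>" "u \<in> carrier (tensor H H)" "\<And>a b. \<psi> a b \<in> carrier (tensor H H)"
  shows "contract H H \<phi> (contract H H \<psi> u) = contract H H (\<lambda>a b. contract H H \<phi> (\<psi> a b)) u"
  by (rule contract_contract) (auto intro: assms)

text \<open>The axioms on threefold tensors are equations in H \<otimes> (H \<otimes> H). Evaluating
  both sides with a trilinear T turns each of them into a Sweedler identity that can be used for
  rewriting.\<close>

definition contract3 :: "('h \<Rightarrow> 'h \<Rightarrow> 'h \<Rightarrow> 'u::ab_group_add) \<Rightarrow> ('h, ('h, 'h, 'k) tensor, 'k) tensor \<Rightarrow> 'u" where
  "contract3 T = contract H (tensor H H) (\<lambda>a p. contract H H (T a) p)"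

lemma klinear_contract3:
  assumes "tri sc sc sc t T"
  shows "klinear (tensor H (tensor H H)) (whole t) (contract3 T)"
  unfolding contract3_def
proof (rule klinear_contract)
  show "kbilinear H (tensor H H) (whole t) (\<lambda>a p. contract H H (T a) p)"
    using kbilinear_contract_right[OF ks ks assms] by simp
  show "kspace (whole t)"
    using assms by (intro kspace_whole) (auto simp: tri_def Vector_Spaces.linear_iff)
qed (auto intro: kspace_tensor)

lemma contract3_tens:
  assumes "tri sc sc sc t T" "p \<in> carrier (tensor H H)"
  shows "contract3 T (tens H (tensor H H) a p) = contract H H (T a) p"
  unfolding contract3_def
proof (rule contract_tens)
  show "kbilinear H (tensor H H) (whole t) (\<lambda>a p. contract H H (T a) p)"
    using kbilinear_contract_right[OF ks ks assms(1)] by simp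
  show "kspace (whole t)"
    using assms by (intro kspace_whole) (auto simp: tri_def Vector_Spaces.linear_iff)
qed (auto intro: kspace_tensor assms)

lemma contract3_contract:
  assumes "tri sc sc sc t T" "u \<in> carrier (tensor H H)" "\<And>a b. \<psi> a b \<in> carrier (tensor H (tensor H H))"
  shows "contract3 T (contract H H \<psi> u) = contract H H (\<lambda>a b. contract3 T (\<psi> a b)) u"
  by (rule klinear_contract_elem[OF klinear_contract3]) (auto intro: kspace_tensor assms)

lemma contract_in_H3:
  "u \<in> carrier (tensor H H) \<Longrightarrow> (\<And>a b. \<phi> a b \<in> carrier (tensor H (tensor H H)))
    \<Longrightarrow> contract H H \<phi> u \<in> carrier (tensor H (tensor H H))"
  by (rule contract_in) (auto intro: kspace_tensor)

lemma contract_in_H2: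
  "u \<in> carrier (tensor H H) \<Longrightarrow> (\<And>a b. \<phi> a b \<in> carrier (tensor H H))
    \<Longrightarrow> contract H H \<phi> u \<in> carrier (tensor H H)"
  by (rule contract_in) (auto intro: kspace_tensor)

lemma tassoc_comul:
  "tassoc H H H (tmap H H (tensor H H) H (comul H) id u)
    = contract H H (\<lambda>a b. D a (\<lambda>c d. tens H (tensor H H) c (tens H H d b))) u"
  if "u \<in> carrier (tensor H H)"
proof -
  let ?\<Phi> = "\<lambda>p w. contract H H (\<lambda>u v. tens H (tensor H H) u (tens H H v w)) p"
  have tri: "tri sc sc sc tscl (\<lambda>u v w. tens H (tensor H H) u (tens H H v w))"
    by (intro lin)
  have k: "kbilinear (tensor H H) H (whole tscl) ?\<Phi>"
    using kbilinear_contract_left[OF ks ks tri] by simp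
  have "tassoc H H H (tmap H H (tensor H H) H (comul H) id u)
    = contract H H (\<lambda>a b. contract (tensor H H) H ?\<Phi> (tens (tensor H H) H (comul H a) b)) u"
    unfolding tassoc_def tmap_def id_def
    by (rule klinear_contract_elem[OF klinear_contract[OF _ _ _ k]])
      (auto intro: kspace_tensor kspace_whole vs_tscl that)
  also have "\<dots> = contract H H (\<lambda>a b. D a (\<lambda>c d. tens H (tensor H H) c (tens H H d b))) u"
    by (rule contract_cong, rule contract_tens[OF _ _ _ k]) (auto intro: kspace_tensor kspace_whole vs_tscl)
  finally show ?thesis .
qed

lemma contract3_tmap:
  assumes "tri sc sc sc t T" "u \<in> carrier (tensor H H)"
  shows "contract3 T (tmap H H H (tensor H H) id (comul H) u) = contract H H (\<lambda>a b. D b (T a)) u"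
  unfolding tmap_def by (simp add: contract3_contract[OF assms] contract3_tens[OF assms(1)])

lemma coassoc:
  assumes T: "tri sc sc sc t T"
  shows "D h (\<lambda>a b. D a (\<lambda>c d. T c d b)) = D h (\<lambda>a b. D b (\<lambda>c d. T a c d))"
proof -
  have "tassoc H H H (tmap H H (tensor H H) H (comul H) id (comul H h))
      = tmap H H H (tensor H H) id (comul H) (comul H h)"
    using k_coalgebra_H by (simp add: k_coalgebra_def)
  then have "contract3 T (D h (\<lambda>a b. D a (\<lambda>c d. tens H (tensor H H) c (tens H H d b)))) = D h (\<lambda>a b. D b (T a))"
    by (simp add: tassoc_comul contract3_tmap[OF T])
  then show ?thesis
    by (simp add: contract3_contract[OF T] contract3_tens[OF T] contract_in_H3 contract_tens_H[OF tri_bil[OF T]])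
qed

lemma D_counit1: "D h (\<lambda>a b. sc (\<epsilon> a) b) = h" and D_counit2: "D h (\<lambda>a b. sc (\<epsilon> b) a) = h"
  using k_coalgebra_H by (simp_all add: k_coalgebra_def)

lemma counit1: "klin sc t g \<Longrightarrow> D h (\<lambda>a b. g (sc (\<epsilon> a) b)) = g h"
  and counit2: "klin sc t g \<Longrightarrow> D h (\<lambda>a b. g (sc (\<epsilon> b) a)) = g h"
  using klin_contract[of sc t g H H "\<lambda>a b. sc (\<epsilon> a) b" "comul H h"]
    klin_contract[of sc t g H H "\<lambda>a b. sc (\<epsilon> b) a" "comul H h"]
  by (auto simp: D_counit1 D_counit2)

lemma mult2_eq: "mult2 H x y = contract H H (\<lambda>a b. contract H H (\<lambda>c d. tens H H (a * c) (b * d)) y) x"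
  by (simp add: mult2_def tmult_def)

lemma mult2_in: "x \<in> carrier (tensor H H) \<Longrightarrow> y \<in> carrier (tensor H H) \<Longrightarrow> mult2 H x y \<in> carrier (tensor H H)"
  unfolding mult2_eq by (intro contract_in_H2 tens_H_in)

lemma contract_mult2:
  assumes "bil sc sc t \<phi>" "x \<in> carrier (tensor H H)" "y \<in> carrier (tensor H H)"
  shows "contract H H \<phi> (mult2 H x y) = contract H H (\<lambda>a b. contract H H (\<lambda>c d. \<phi> (a * c) (b * d)) y) x"
  unfolding mult2_eq
  by (simp add: contract_contract_H[OF assms(1)] contract_tens_H[OF assms(1)] contract_in_H2 assms)

lemma D_mult:
  assumes "bil sc sc t \<phi>"
  shows "D (g * h) \<phi> = D g (\<lambda>a b. D h (\<lambda>c d. \<phi> (a * c) (b * d)))"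
  using weak_bialgebra_H contract_mult2[OF assms, of "comul H g" "comul H h"] by (simp add: weak_bialgebra_def)

lemma unit_axiom1:
  assumes T: "tri sc sc sc t T"
  shows "D 1 (\<lambda>a b. D b (\<lambda>c d. T a c d)) = D 1 (\<lambda>a b. D 1 (\<lambda>c d. T a (b * c) d))"
proof -
  have "contract3 T (tmap H H H (tensor H H) id (comul H) (comul H 1)) = contract3 T (D 1 (\<lambda>a b. D 1 (\<lambda>a' b'.
           tens H (tensor H H) a (tens H H (b * a') b'))))"
    using weak_bialgebra_H unfolding weak_bialgebra_def by (intro arg_cong[where f = "contract3 T"]) blast
  then show ?thesis
    by (simp add: contract3_contract[OF T] contract3_tens[OF T] contract_in_H3 contract_tens_H[OF tri_bil[OF T]] contract3_tmap[OF T])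
qed

lemma unit_axiom2:
  assumes T: "tri sc sc sc t T"
  shows "D 1 (\<lambda>a b. D b (\<lambda>c d. T a c d)) = D 1 (\<lambda>a b. D 1 (\<lambda>c d. T a (c * b) d))"
proof -
  have "contract3 T (tmap H H H (tensor H H) id (comul H) (comul H 1)) = contract3 T (D 1 (\<lambda>a b. D 1 (\<lambda>a' b'.
           tens H (tensor H H) a (tens H H (a' * b) b'))))"
    using weak_bialgebra_H unfolding weak_bialgebra_def by (intro arg_cong[where f = "contract3 T"]) blast
  then show ?thesis
    by (simp add: contract3_contract[OF T] contract3_tens[OF T] contract_in_H3 contract_tens_H[OF tri_bil[OF T]] contract3_tmap[OF T])
qed

lemma eps_mult1: "\<epsilon> (h * g * l) = D g (\<lambda>a b. \<epsilon> (h * a) * \<epsilon> (b * l))"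
  and eps_mult2: "\<epsilon> (h * g * l) = D g (\<lambda>a b. \<epsilon> (h * b) * \<epsilon> (a * l))"
  using weak_bialgebra_H unfolding weak_bialgebra_def by blast+

lemma et_eq: "et h = D 1 (\<lambda>a b. sc (\<epsilon> (a * h)) b)" and es_eq: "es h = D 1 (\<lambda>a b. sc (\<epsilon> (h * b)) a)"
  by (simp_all add: eps_t_def eps_s_def)

lemma S_id: "D h (\<lambda>a b. S a * b) = es h" and id_S: "D h (\<lambda>a b. a * S b) = et h"
proof -
  have "convolution H S id h = es h" "convolution H id S h = et h"
    using quantum_groupoid_H by (auto simp: quantum_groupoid_def)
  then show "D h (\<lambda>a b. S a * b) = es h" "D h (\<lambda>a b. a * S b) = et h"
    by (simp_all add: convolution_def)
qed

lemma es_S: "D h (\<lambda>a b. es a * S b) = S h"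
proof -
  have "convolution H (convolution H S id) S h = S h"
    using quantum_groupoid_H by (auto simp: quantum_groupoid_def)
  then show ?thesis by (simp add: convolution_def S_id[symmetric])
qed

lemma bij_S: "bij S"
  using quantum_groupoid_H by (simp add: quantum_groupoid_def)

lemma lin_et [lin]: "klin s sc g \<Longrightarrow> klin s sc (\<lambda>x. et (g x))"
  and lin_es [lin]: "klin s sc g \<Longrightarrow> klin s sc (\<lambda>x. es (g x))"
  unfolding et_eq es_eq by (intro lin; auto dest: klin_vs)+

lemma one_comul: "bil sc sc t \<phi> \<Longrightarrow> D 1 (\<lambda>a b. D h (\<lambda>c d. \<phi> (a * c) (b * d))) = D h \<phi>"
  and comul_one: "bil sc sc t \<phi> \<Longrightarrow> D h (\<lambda>a b. D 1 (\<lambda>c d. \<phi> (a * c) (b * d))) = D h \<phi>"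
  using D_mult[of t \<phi> 1 h] D_mult[of t \<phi> h 1] by simp_all

text \<open>
  The next four identities arise by applying \<open>id \<otimes> \<epsilon> \<otimes> id\<close> to the products of \<open>\<Delta>\<^sup>2(1)\<close> with
  \<open>\<Delta>(h) \<otimes> 1\<close> and \<open>1 \<otimes> \<Delta>(h)\<close>.
\<close>

lemma comul_et:
  assumes \<phi>: "bil sc sc t \<phi>"
  shows "D h (\<lambda>a b. \<phi> a (et b)) = D 1 (\<lambda>a b. \<phi> (a * h) b)"
proof -
  note [lin] = bilD[OF \<phi>]
  have "D 1 (\<lambda>a b. \<phi> (a * h) b) = D 1 (\<lambda>a b. D (a * h) (\<lambda>c d. \<phi> (sc (\<epsilon> d) c) b))"
    by (rule contract_cong, rule counit2[where g = "\<lambda>x. \<phi> x b" for b, symmetric]; (rule lin)+)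
  also have "\<dots> = D 1 (\<lambda>a b. D a (\<lambda>c d. D h (\<lambda>e g. \<phi> (sc (\<epsilon> (d * g)) (c * e)) b)))"
    by (rule contract_cong, rule D_mult; (rule lin)+)
  also have "\<dots> = D 1 (\<lambda>a b. D b (\<lambda>c d. D h (\<lambda>e g. \<phi> (sc (\<epsilon> (c * g)) (a * e)) d)))"
    by (rule coassoc; (rule lin)+)
  also have "\<dots> = D 1 (\<lambda>a b. D 1 (\<lambda>c d. D h (\<lambda>e g. \<phi> (sc (\<epsilon> (c * b * g)) (a * e)) d)))"
    by (rule unit_axiom2; (rule lin)+)
  also have "\<dots> = D 1 (\<lambda>c d. D 1 (\<lambda>a b. D h (\<lambda>e g. \<phi> (sc (\<epsilon> (c * (b * g))) (a * e)) d)))"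
    by (subst contract_swap) (simp add: mult.assoc)
  also have "\<dots> = D 1 (\<lambda>c d. D h (\<lambda>e g. \<phi> (sc (\<epsilon> (c * g)) e) d))"
    by (rule contract_cong, rule one_comul; (rule lin)+)
  also have "\<dots> = D h (\<lambda>e g. D 1 (\<lambda>c d. \<phi> e (sc (\<epsilon> (c * g)) d)))"
    by (subst contract_swap) (simp add: bil_bal[OF \<phi>])
  also have "\<dots> = D h (\<lambda>e g. \<phi> e (et g))"
    unfolding et_eq by (rule contract_cong, rule klin_contract[symmetric]; (rule lin)+)
  finally show ?thesis ..
qed

lemma comul_es:
  assumes \<phi>: "bil sc sc t \<phi>"
  shows "D h (\<lambda>a b. \<phi> (es a) b) = D 1 (\<lambda>a b. \<phi> a (h * b))"
proof -
  note [lin] = bilD[OF \<phi>]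
  have "D 1 (\<lambda>a b. \<phi> a (h * b)) = D 1 (\<lambda>a b. D (h * b) (\<lambda>c d. \<phi> a (sc (\<epsilon> c) d)))"
    by (rule contract_cong, rule counit1[where g = "\<phi> a" for a, symmetric]; (rule lin)+)
  also have "\<dots> = D 1 (\<lambda>a b. D h (\<lambda>e g. D b (\<lambda>c d. \<phi> a (sc (\<epsilon> (e * c)) (g * d)))))"
    by (rule contract_cong, rule D_mult; (rule lin)+)
  also have "\<dots> = D 1 (\<lambda>a b. D b (\<lambda>c d. D h (\<lambda>e g. \<phi> a (sc (\<epsilon> (e * c)) (g * d)))))"
    by (rule contract_cong, rule contract_swap)
  also have "\<dots> = D 1 (\<lambda>a b. D 1 (\<lambda>c d. D h (\<lambda>e g. \<phi> a (sc (\<epsilon> (e * (c * b))) (g * d)))))"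
    by (rule unit_axiom2; (rule lin)+)
  also have "\<dots> = D 1 (\<lambda>a b. D h (\<lambda>e g. D 1 (\<lambda>c d. \<phi> a (sc (\<epsilon> (e * c * b)) (g * d)))))"
    by (rule contract_cong, subst contract_swap) (simp add: mult.assoc)
  also have "\<dots> = D 1 (\<lambda>a b. D h (\<lambda>e g. \<phi> a (sc (\<epsilon> (e * b)) g)))"
    by (rule contract_cong, rule comul_one; (rule lin)+)
  also have "\<dots> = D h (\<lambda>e g. D 1 (\<lambda>a b. \<phi> (sc (\<epsilon> (e * b)) a) g))"
    by (subst contract_swap) (simp add: bil_bal[OF \<phi>])
  also have "\<dots> = D h (\<lambda>e g. \<phi> (es e) g)"
    unfolding es_eq by (rule contract_cong, rule klin_contract[symmetric]; (rule lin)+)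
  finally show ?thesis ..
qed

lemma comul_eps_one:
  assumes \<phi>: "bil sc sc t \<phi>"
  shows "D h (\<lambda>a b. D 1 (\<lambda>c d. \<phi> (sc (\<epsilon> (b * c)) a) d)) = D 1 (\<lambda>a b. \<phi> (h * a) b)"
proof -
  note [lin] = bilD[OF \<phi>]
  have "D 1 (\<lambda>a b. \<phi> (h * a) b) = D 1 (\<lambda>a b. D (h * a) (\<lambda>c d. \<phi> (sc (\<epsilon> d) c) b))"
    by (rule contract_cong, rule counit2[where g = "\<lambda>x. \<phi> x b" for b, symmetric]; (rule lin)+)
  also have "\<dots> = D 1 (\<lambda>a b. D h (\<lambda>e g. D a (\<lambda>c d. \<phi> (sc (\<epsilon> (g * d)) (e * c)) b)))"
    by (rule contract_cong, rule D_mult; (rule lin)+)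
  also have "\<dots> = D 1 (\<lambda>a b. D a (\<lambda>c d. D h (\<lambda>e g. \<phi> (sc (\<epsilon> (g * d)) (e * c)) b)))"
    by (rule contract_cong, rule contract_swap)
  also have "\<dots> = D 1 (\<lambda>a b. D b (\<lambda>c d. D h (\<lambda>e g. \<phi> (sc (\<epsilon> (g * c)) (e * a)) d)))"
    by (rule coassoc; (rule lin)+)
  also have "\<dots> = D 1 (\<lambda>a b. D 1 (\<lambda>c d. D h (\<lambda>e g. \<phi> (sc (\<epsilon> (g * (b * c))) (e * a)) d)))"
    by (rule unit_axiom1; (rule lin)+)
  also have "\<dots> = D 1 (\<lambda>c d. D 1 (\<lambda>a b. D h (\<lambda>e g. \<phi> (sc (\<epsilon> (g * b * c)) (e * a)) d)))"
    by (subst contract_swap) (simp add: mult.assoc)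
  also have "\<dots> = D 1 (\<lambda>c d. D h (\<lambda>e g. D 1 (\<lambda>a b. \<phi> (sc (\<epsilon> (g * b * c)) (e * a)) d)))"
    by (rule contract_cong, rule contract_swap)
  also have "\<dots> = D 1 (\<lambda>c d. D h (\<lambda>e g. \<phi> (sc (\<epsilon> (g * c)) e) d))"
    by (rule contract_cong, rule comul_one; (rule lin)+)
  also have "\<dots> = D h (\<lambda>e g. D 1 (\<lambda>c d. \<phi> (sc (\<epsilon> (g * c)) e) d))"
    by (rule contract_swap)
  finally show ?thesis ..
qed

lemma one_eps_comul:
  assumes \<phi>: "bil sc sc t \<phi>"
  shows "D h (\<lambda>a b. D 1 (\<lambda>c d. \<phi> c (sc (\<epsilon> (d * a)) b))) = D 1 (\<lambda>a b. \<phi> a (b * h))"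
proof -
  note [lin] = bilD[OF \<phi>]
  have "D 1 (\<lambda>a b. \<phi> a (b * h)) = D 1 (\<lambda>a b. D (b * h) (\<lambda>c d. \<phi> a (sc (\<epsilon> c) d)))"
    by (rule contract_cong, rule counit1[where g = "\<phi> a" for a, symmetric]; (rule lin)+)
  also have "\<dots> = D 1 (\<lambda>a b. D b (\<lambda>c d. D h (\<lambda>e g. \<phi> a (sc (\<epsilon> (c * e)) (d * g)))))"
    by (rule contract_cong, rule D_mult; (rule lin)+)
  also have "\<dots> = D 1 (\<lambda>a b. D 1 (\<lambda>c d. D h (\<lambda>e g. \<phi> a (sc (\<epsilon> (b * c * e)) (d * g)))))"
    by (rule unit_axiom1; (rule lin)+)
  also have "\<dots> = D 1 (\<lambda>a b. D 1 (\<lambda>c d. D h (\<lambda>e g. \<phi> a (sc (\<epsilon> (b * (c * e))) (d * g)))))"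
    by (simp add: mult.assoc)
  also have "\<dots> = D 1 (\<lambda>a b. D h (\<lambda>e g. \<phi> a (sc (\<epsilon> (b * e)) g)))"
    by (rule contract_cong, rule one_comul; (rule lin)+)
  also have "\<dots> = D h (\<lambda>e g. D 1 (\<lambda>a b. \<phi> a (sc (\<epsilon> (b * e)) g)))"
    by (rule contract_swap)
  finally show ?thesis ..
qed

section \<open>The source and target subalgebras\<close>

definition Hs where "Hs = {y. es y = y}"
definition Ht where "Ht = {z. et z = z}"

text \<open>Weak multiplicativity of the counit at the middle argument 1: \<epsilon>(h 1_2)
  \<epsilon>(1_1 l) = \<epsilon>(h l).\<close>

lemma eps_et: "\<epsilon> (h * et l) = \<epsilon> (h * l)"
proof -
  have "\<epsilon> (h * et l) = D 1 (\<lambda>a b. \<epsilon> (h * sc (\<epsilon> (a * l)) b))"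
    by (simp add: et_eq contract_mult_left counit_contract)
  also have "\<dots> = D 1 (\<lambda>a b. \<epsilon> (h * b) * \<epsilon> (a * l))"
    by (simp add: sc_mult[symmetric] mult.commute)
  finally show ?thesis using eps_mult2[of h 1 l] by simp
qed

lemma eps_es: "\<epsilon> (es h * l) = \<epsilon> (h * l)"
proof -
  have "\<epsilon> (es h * l) = D 1 (\<lambda>a b. \<epsilon> (sc (\<epsilon> (h * b)) a * l))"
    by (simp add: es_eq contract_mult_right counit_contract)
  also have "\<dots> = D 1 (\<lambda>a b. \<epsilon> (h * b) * \<epsilon> (a * l))"
    by (simp add: sc_mult[symmetric] mult.commute)
  finally show ?thesis using eps_mult2[of h 1 l] by simp
qed

lemma et_mult_et: "et (h * et l) = et (h * l)"
  by (simp add: et_eq[of "h * _"] eps_et mult.assoc[symmetric])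

lemma es_es_mult: "es (es h * l) = es (h * l)"
  by (simp add: es_eq[of "_ * l"] eps_es mult.assoc)

lemma et_et [simp]: "et (et h) = et h" and es_es [simp]: "es (es h) = es h"
  using et_mult_et[of 1 h] es_es_mult[of h 1] by simp_all

lemma et_Ht [simp, intro]: "et h \<in> Ht" and es_Hs [simp, intro]: "es h \<in> Hs"
  by (simp_all add: Ht_def Hs_def)

lemma et_1 [simp]: "et 1 = 1" and es_1 [simp]: "es 1 = 1"
  by (simp_all add: et_eq es_eq D_counit1 D_counit2)

lemma one_in_Hs [simp]: "1 \<in> Hs"
  by (simp add: Hs_def)

lemma one_et: "bil sc sc t \<phi> \<Longrightarrow> D 1 (\<lambda>a b. \<phi> a (et b)) = D 1 \<phi>"
  and one_es: "bil sc sc t \<phi> \<Longrightarrow> D 1 (\<lambda>a b. \<phi> (es a) b) = D 1 \<phi>"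
  using comul_et[of t \<phi> 1] comul_es[of t \<phi> 1] by simp_all

text \<open>
  The list representing \<open>\<Delta>(1)\<close> need not have its entries in \<open>H\<^sub>s\<close> and \<open>H\<^sub>t\<close>, but one may compute
  as if it had.
\<close>

lemma one_es_et:
  assumes "bil sc sc t \<phi>" "\<And>y z. y \<in> Hs \<Longrightarrow> z \<in> Ht \<Longrightarrow> \<phi> y z = \<psi> y z" "bil sc sc t \<psi>"
  shows "D 1 \<phi> = D 1 \<psi>"
proof -
  have "D 1 \<phi>' = D 1 (\<lambda>a b. \<phi>' (es a) (et b))" if \<phi>': "bil sc sc t \<phi>'" for \<phi>'
  proof -
    note [lin] = bil1[OF \<phi>'] bil2[OF \<phi>']
    have "D 1 (\<lambda>a b. \<phi>' (es a) (et b)) = D 1 (\<lambda>a b. \<phi>' a (et b))"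
      by (rule one_es; (rule lin)+)
    then show ?thesis using one_et[OF \<phi>'] by simp
  qed
  from this[OF assms(1)] this[OF assms(3)] show ?thesis
    by (simp add: assms(2) cong: contract_cong)
qed

text \<open>Elements of H_t are combinations of second legs of \<Delta>(1), and those of H_s of
  first legs; so facts about them reduce to the axioms for \<Delta>^2(1).\<close>

lemma Ht_expand: "z \<in> Ht \<Longrightarrow> klin sc t g \<Longrightarrow> D 1 (\<lambda>a b. g (sc (\<epsilon> (a * z)) b)) = g z"
  and Hs_expand: "y \<in> Hs \<Longrightarrow> klin sc t g \<Longrightarrow> D 1 (\<lambda>a b. g (sc (\<epsilon> (y * b)) a)) = g y"
  using klin_contract[of sc t g H H "\<lambda>a b. sc (\<epsilon> (a * z)) b" "comul H 1"]
    klin_contract[of sc t g H H "\<lambda>a b. sc (\<epsilon> (y * b)) a" "comul H 1"]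
  by (auto simp: et_eq[symmetric] es_eq[symmetric] Ht_def Hs_def)

text \<open>Comultiplying z = \<epsilon>(1_1 z) 1_2 produces \<Delta>^2(1). Its two factorizations
  differ in the order of the middle product and so put z on different sides.\<close>

lemma comul_Ht:
  assumes \<phi>: "bil sc sc t \<phi>" and z: "z \<in> Ht"
  shows "D z \<phi> = D 1 (\<lambda>a b. \<phi> (a * z) b)" "D z \<phi> = D 1 (\<lambda>a b. \<phi> (z * a) b)"
proof -
  note [lin] = bilD[OF \<phi>]
  have z_eq: "z = D 1 (\<lambda>a b. sc (\<epsilon> (a * z)) b)" using z by (simp add: Ht_def et_eq[symmetric])
  have "D z \<phi> = D 1 (\<lambda>a b. D (sc (\<epsilon> (a * z)) b) \<phi>)"
    by (subst (1) z_eq, rule D_contract[OF \<phi>])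
  also have "\<dots> = D 1 (\<lambda>a b. D b (\<lambda>c d. \<phi> (sc (\<epsilon> (a * z)) c) d))"
  proof (rule contract_cong)
    fix a b
    have "D (sc (\<epsilon> (a * z)) b) \<phi> = t (\<epsilon> (a * z)) (D b \<phi>)"
      by (rule klin_scale; (rule lin)+)
    also have "\<dots> = D b (\<lambda>c d. t (\<epsilon> (a * z)) (\<phi> c d))"
      by (rule klin_contract[of t t]; intro klin_scale_const klin_id bil_vs[OF \<phi>])
    also have "\<dots> = D b (\<lambda>c d. \<phi> (sc (\<epsilon> (a * z)) c) d)"
      using \<phi> by (simp add: bil_def Vector_Spaces.linear_iff)
    finally show "D (sc (\<epsilon> (a * z)) b) \<phi> = D b (\<lambda>c d. \<phi> (sc (\<epsilon> (a * z)) c) d)" .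
  qed
  finally have 1: "D z \<phi> = D 1 (\<lambda>a b. D b (\<lambda>c d. \<phi> (sc (\<epsilon> (a * z)) c) d))" .
  have "D 1 (\<lambda>a b. D b (\<lambda>c d. \<phi> (sc (\<epsilon> (a * z)) c) d)) = D 1 (\<lambda>a b. D 1 (\<lambda>c d. \<phi> (sc (\<epsilon> (a * z)) (c * b)) d))"
    by (rule unit_axiom2; (rule lin)+)
  also have "\<dots> = D 1 (\<lambda>c d. D 1 (\<lambda>a b. \<phi> (c * sc (\<epsilon> (a * z)) b) d))"
    by (subst contract_swap) (simp add: sc_mult(2))
  also have "\<dots> = D 1 (\<lambda>c d. \<phi> (c * z) d)"
    by (rule contract_cong, rule Ht_expand[OF z, where g = "\<lambda>x. \<phi> (c * x) d" for c d]; (rule lin)+)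
  finally show "D z \<phi> = D 1 (\<lambda>a b. \<phi> (a * z) b)" using 1 by simp
  have "D 1 (\<lambda>a b. D b (\<lambda>c d. \<phi> (sc (\<epsilon> (a * z)) c) d)) = D 1 (\<lambda>a b. D 1 (\<lambda>c d. \<phi> (sc (\<epsilon> (a * z)) (b * c)) d))"
    by (rule unit_axiom1; (rule lin)+)
  also have "\<dots> = D 1 (\<lambda>c d. D 1 (\<lambda>a b. \<phi> (sc (\<epsilon> (a * z)) b * c) d))"
    by (subst contract_swap) (simp add: sc_mult(1))
  also have "\<dots> = D 1 (\<lambda>c d. \<phi> (z * c) d)"
    by (rule contract_cong, rule Ht_expand[OF z, where g = "\<lambda>x. \<phi> (x * c) d" for c d]; (rule lin)+)
  finally show "D z \<phi> = D 1 (\<lambda>a b. \<phi> (z * a) b)" using 1 by simp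
qed

text \<open>As for H_t, but y = \<epsilon>(y 1_2) 1_1 is built from first legs, so coassociativity
  has to move the comultiplication to the second leg before the two unit axioms apply.\<close>

lemma comul_Hs:
  assumes \<phi>: "bil sc sc t \<phi>" and y: "y \<in> Hs"
  shows "D y \<phi> = D 1 (\<lambda>a b. \<phi> a (b * y))" "D y \<phi> = D 1 (\<lambda>a b. \<phi> a (y * b))"
proof -
  note [lin] = bilD[OF \<phi>]
  have y_eq: "y = D 1 (\<lambda>a b. sc (\<epsilon> (y * b)) a)" using y by (simp add: Hs_def es_eq[symmetric])
  have "D y \<phi> = D 1 (\<lambda>a b. D (sc (\<epsilon> (y * b)) a) \<phi>)"
    by (subst (1) y_eq, rule D_contract[OF \<phi>])
  also have "\<dots> = D 1 (\<lambda>a b. D a (\<lambda>c d. \<phi> c (sc (\<epsilon> (y * b)) d)))"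
  proof (rule contract_cong)
    fix a b
    have "D (sc (\<epsilon> (y * b)) a) \<phi> = t (\<epsilon> (y * b)) (D a \<phi>)"
      by (rule klin_scale; (rule lin)+)
    also have "\<dots> = D a (\<lambda>c d. t (\<epsilon> (y * b)) (\<phi> c d))"
      by (rule klin_contract[of t t]; intro klin_scale_const klin_id bil_vs[OF \<phi>])
    also have "\<dots> = D a (\<lambda>c d. \<phi> c (sc (\<epsilon> (y * b)) d))"
      using \<phi> by (simp add: bil_def Vector_Spaces.linear_iff)
    finally show "D (sc (\<epsilon> (y * b)) a) \<phi> = D a (\<lambda>c d. \<phi> c (sc (\<epsilon> (y * b)) d))" .
  qed
  also have "\<dots> = D 1 (\<lambda>a b. D b (\<lambda>c d. \<phi> a (sc (\<epsilon> (y * d)) c)))"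
    by (rule coassoc; (rule lin)+)
  finally have 1: "D y \<phi> = D 1 (\<lambda>a b. D b (\<lambda>c d. \<phi> a (sc (\<epsilon> (y * d)) c)))" .
  have "D 1 (\<lambda>a b. D b (\<lambda>c d. \<phi> a (sc (\<epsilon> (y * d)) c))) = D 1 (\<lambda>a b. D 1 (\<lambda>c d. \<phi> a (sc (\<epsilon> (y * d)) (b * c))))"
    by (rule unit_axiom1; (rule lin)+)
  also have "\<dots> = D 1 (\<lambda>a b. D 1 (\<lambda>c d. \<phi> a (b * sc (\<epsilon> (y * d)) c)))"
    by (simp add: sc_mult(2))
  also have "\<dots> = D 1 (\<lambda>c d. \<phi> c (d * y))"
    by (rule contract_cong, rule Hs_expand[OF y, where g = "\<lambda>x. \<phi> c (d * x)" for c d]; (rule lin)+)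
  finally show "D y \<phi> = D 1 (\<lambda>a b. \<phi> a (b * y))" using 1 by simp
  have "D 1 (\<lambda>a b. D b (\<lambda>c d. \<phi> a (sc (\<epsilon> (y * d)) c))) = D 1 (\<lambda>a b. D 1 (\<lambda>c d. \<phi> a (sc (\<epsilon> (y * d)) (c * b))))"
    by (rule unit_axiom2; (rule lin)+)
  also have "\<dots> = D 1 (\<lambda>a b. D 1 (\<lambda>c d. \<phi> a (sc (\<epsilon> (y * d)) c * b)))"
    by (simp add: sc_mult(1))
  also have "\<dots> = D 1 (\<lambda>c d. \<phi> c (y * d))"
    by (rule contract_cong, rule Hs_expand[OF y, where g = "\<lambda>x. \<phi> c (x * d)" for c d]; (rule lin)+)
  finally show "D y \<phi> = D 1 (\<lambda>a b. \<phi> a (y * b))" using 1 by simp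
qed

lemma D_mult_Ht:
  assumes \<phi>: "bil sc sc t \<phi>" and z: "z \<in> Ht"
  shows "D (z * h) \<phi> = D h (\<lambda>a b. \<phi> (z * a) b)" "D (h * z) \<phi> = D h (\<lambda>a b. \<phi> (a * z) b)"
proof -
  note [lin] = bilD[OF \<phi>]
  have "D (z * h) \<phi> = D 1 (\<lambda>a b. D h (\<lambda>c d. \<phi> (z * a * c) (b * d)))"
    by (simp only: D_mult[OF \<phi>]) (rule comul_Ht(2)[OF _ z]; (rule lin)+)
  also have "\<dots> = D h (\<lambda>a b. \<phi> (z * a) b)"
    by (simp only: mult.assoc) (rule one_comul; (rule lin)+)
  finally show "D (z * h) \<phi> = D h (\<lambda>a b. \<phi> (z * a) b)" .
  have "D (h * z) \<phi> = D h (\<lambda>a b. D 1 (\<lambda>c d. \<phi> (a * (c * z)) (b * d)))"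
    by (simp only: D_mult[OF \<phi>]) (rule contract_cong, rule comul_Ht(1)[OF _ z]; (rule lin)+)
  also have "\<dots> = D h (\<lambda>a b. \<phi> (a * z) b)"
    by (simp only: mult.assoc[symmetric]) (rule comul_one; (rule lin)+)
  finally show "D (h * z) \<phi> = D h (\<lambda>a b. \<phi> (a * z) b)" .
qed

lemma D_mult_Hs:
  assumes \<phi>: "bil sc sc t \<phi>" and y: "y \<in> Hs"
  shows "D (y * h) \<phi> = D h (\<lambda>a b. \<phi> a (y * b))" "D (h * y) \<phi> = D h (\<lambda>a b. \<phi> a (b * y))"
proof -
  note [lin] = bilD[OF \<phi>]
  have "D (y * h) \<phi> = D 1 (\<lambda>a b. D h (\<lambda>c d. \<phi> (a * c) (y * b * d)))"
    by (simp only: D_mult[OF \<phi>]) (rule comul_Hs(2)[OF _ y]; (rule lin)+)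
  also have "\<dots> = D h (\<lambda>a b. \<phi> a (y * b))"
    by (simp only: mult.assoc) (rule one_comul; (rule lin)+)
  finally show "D (y * h) \<phi> = D h (\<lambda>a b. \<phi> a (y * b))" .
  have "D (h * y) \<phi> = D h (\<lambda>a b. D 1 (\<lambda>c d. \<phi> (a * c) (b * (d * y))))"
    by (simp only: D_mult[OF \<phi>]) (rule contract_cong, rule comul_Hs(1)[OF _ y]; (rule lin)+)
  also have "\<dots> = D h (\<lambda>a b. \<phi> a (b * y))"
    by (simp only: mult.assoc[symmetric]) (rule comul_one; (rule lin)+)
  finally show "D (h * y) \<phi> = D h (\<lambda>a b. \<phi> a (b * y))" .
qed

text \<open>The middle legs of the two expressions for \<Delta>^2(1) are 1_2 1'_1 and 1'_1 1_2.
  Pairing the outer legs with z and y by the counit turns them into z y and y z.\<close>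

lemma Hs_Ht_commute:
  assumes y: "y \<in> Hs" and z: "z \<in> Ht"
  shows "y * z = z * y"
proof -
  have "z * y = D 1 (\<lambda>a b. sc (\<epsilon> (a * z)) b * y)"
    by (rule Ht_expand[OF z, where g = "\<lambda>x. x * y", symmetric]; (rule lin)+)
  also have "\<dots> = D 1 (\<lambda>a b. D 1 (\<lambda>c d. sc (\<epsilon> (a * z)) b * sc (\<epsilon> (y * d)) c))"
    by (rule contract_cong, rule Hs_expand[OF y, where g = "\<lambda>x. sc (\<epsilon> (a * z)) b * x" for a b, symmetric]; (rule lin)+)
  also have "\<dots> = D 1 (\<lambda>a b. D 1 (\<lambda>c d. sc (\<epsilon> (a * z)) (sc (\<epsilon> (y * d)) (b * c))))"
    by (simp add: sc_mult(1)[symmetric], simp add: sc_mult(2)[symmetric])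
  also have "\<dots> = D 1 (\<lambda>a b. D b (\<lambda>c d. sc (\<epsilon> (a * z)) (sc (\<epsilon> (y * d)) c)))"
    by (rule unit_axiom1[symmetric]; (rule lin)+)
  also have "\<dots> = D 1 (\<lambda>a b. D 1 (\<lambda>c d. sc (\<epsilon> (a * z)) (sc (\<epsilon> (y * d)) (c * b))))"
    by (rule unit_axiom2; (rule lin)+)
  also have "\<dots> = D 1 (\<lambda>c d. D 1 (\<lambda>a b. sc (\<epsilon> (y * d)) c * sc (\<epsilon> (a * z)) b))"
    by (subst contract_swap) (simp add: sc_mult(2)[symmetric], simp add: sc_mult(1)[symmetric])
  also have "\<dots> = D 1 (\<lambda>c d. sc (\<epsilon> (y * d)) c * z)"
    by (rule contract_cong, rule Ht_expand[OF z, where g = "\<lambda>x. sc (\<epsilon> (y * d)) c * x" for c d]; (rule lin)+)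
  also have "\<dots> = y * z"
    by (rule Hs_expand[OF y, where g = "\<lambda>x. x * z"]; (rule lin)+)
  finally show ?thesis ..
qed

lemma et_Ht_mult: "z \<in> Ht \<Longrightarrow> et (z * h) = z * et h"
proof -
  assume z: "z \<in> Ht"
  have "D (z * h) (\<lambda>a b. a * S b) = D h (\<lambda>a b. z * a * S b)"
    by (rule D_mult_Ht(1)[OF _ z]; (rule lin)+)
  then show ?thesis by (simp add: id_S[symmetric] contract_mult_left mult.assoc)
qed

lemma es_mult_Hs: "y \<in> Hs \<Longrightarrow> es (h * y) = es h * y"
proof -
  assume y: "y \<in> Hs"
  have "D (h * y) (\<lambda>a b. S a * b) = D h (\<lambda>a b. S a * (b * y))"
    by (rule D_mult_Hs(2)[OF _ y]; (rule lin)+)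
  then show ?thesis by (simp add: S_id[symmetric] contract_mult_right mult.assoc)
qed

lemma Ht_mult [simp]: "z \<in> Ht \<Longrightarrow> w \<in> Ht \<Longrightarrow> z * w \<in> Ht"
  using et_Ht_mult[of z w] by (simp add: Ht_def)

section \<open>The antipode reverses products and coproducts\<close>

text \<open>Associativity of convolution: (S*id)*S = S*(id*S).\<close>

lemma S_et: "D h (\<lambda>a b. S a * et b) = S h"
proof -
  have "S h = D h (\<lambda>a b. D a (\<lambda>c d. S c * d * S b))"
    by (simp add: es_S[symmetric, of h] S_id[symmetric] contract_mult_right)
  also have "\<dots> = D h (\<lambda>a b. D b (\<lambda>c d. S a * c * S d))"
    by (rule coassoc; (rule lin)+)
  also have "\<dots> = D h (\<lambda>a b. S a * et b)"
    by (simp add: id_S[symmetric] contract_mult_left mult.assoc)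
  finally show ?thesis ..
qed

lemma S_Hs: assumes y: "y \<in> Hs" shows "S y = et y"
proof -
  have "S y = D 1 (\<lambda>a b. es a * S (b * y))"
    unfolding es_S[symmetric, of y] by (rule comul_Hs(1)[OF _ y]; (rule lin)+)
  also have "\<dots> = D 1 (\<lambda>a b. a * S (b * y))"
    by (rule one_es; (rule lin)+)
  also have "\<dots> = et y"
    unfolding id_S[symmetric, of y] by (rule comul_Hs(1)[OF _ y, symmetric]; (rule lin)+)
  finally show ?thesis .
qed

lemma S_Ht: assumes z: "z \<in> Ht" shows "S z = es z"
proof -
  have "S z = D 1 (\<lambda>a b. S (a * z) * et b)"
    unfolding S_et[symmetric, of z] by (rule comul_Ht(1)[OF _ z]; (rule lin)+)
  also have "\<dots> = D 1 (\<lambda>a b. S (a * z) * b)"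
    by (rule one_et; (rule lin)+)
  also have "\<dots> = es z"
    unfolding S_id[symmetric, of z] by (rule comul_Ht(1)[OF _ z, symmetric]; (rule lin)+)
  finally show ?thesis .
qed

lemma S_Hs_in [simp]: "y \<in> Hs \<Longrightarrow> S y \<in> Ht" and S_Ht_in [simp]: "z \<in> Ht \<Longrightarrow> S z \<in> Hs"
  by (simp_all add: S_Hs S_Ht)

text \<open>The argument by uniqueness of convolution inverses, with counital maps in place of the
  counit. In S(g_1 h_1) et(g_2 h_2) the second factor expands to g_2 h_2 S(h_3) S(g_3). Regrouping
  yields es(g_1 h_1) = S(h_1) es(g_1) h_2 in front, and since es(g_1) commutes with et(h_2), the
  factors belonging to g and to h separate.\<close>

lemma S_mult: "S (g * h) = S h * S g"
proof -
  have "S (g * h) = D g (\<lambda>a b. D h (\<lambda>c d. S (a * c) * et (b * d)))"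
    unfolding S_et[symmetric, of "g * h"] by (rule D_mult; (rule lin)+)
  also have "\<dots> = D g (\<lambda>a b. D h (\<lambda>c d. D b (\<lambda>p q. S (a * c) * (p * et d * S q))))"
  proof (rule contract_cong, rule contract_cong)
    fix a b c d
    have "et (b * d) = D (b * et d) (\<lambda>p q. p * S q)" by (simp add: id_S et_mult_et)
    also have "\<dots> = D b (\<lambda>p q. p * et d * S q)" by (rule D_mult_Ht(2)[OF _ et_Ht]; (rule lin)+)
    finally show "S (a * c) * et (b * d) = D b (\<lambda>p q. S (a * c) * (p * et d * S q))"
      by (simp add: contract_mult_left)
  qed
  also have "\<dots> = D g (\<lambda>a b. D b (\<lambda>p q. D h (\<lambda>c d. D d (\<lambda>r s. S (a * c) * p * r * S s * S q))))"
    by (subst contract_swap) (simp add: id_S[symmetric] contract_mult_left contract_mult_right mult.assoc)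
  also have "\<dots> = D g (\<lambda>a b. D a (\<lambda>p q. D h (\<lambda>c d. D d (\<lambda>r s. S (p * c) * q * r * S s * S b))))"
    by (rule coassoc[symmetric]; (rule lin)+)
  also have "\<dots> = D g (\<lambda>a b. D a (\<lambda>p q. D h (\<lambda>c d. D c (\<lambda>r s. S (p * r) * q * s * S d * S b))))"
    by (rule contract_cong, rule contract_cong, rule coassoc[symmetric]; (rule lin)+)
  also have "\<dots> = D g (\<lambda>a b. D h (\<lambda>c d. D a (\<lambda>p q. D c (\<lambda>r s. S (p * r) * (q * s))) * S d * S b))"
    by (subst contract_swap) (simp add: contract_mult_right mult.assoc)
  also have "\<dots> = D g (\<lambda>a b. D h (\<lambda>c d. es (a * c) * S d * S b))"
  proof -
    have "D a (\<lambda>p q. D c (\<lambda>r s. S (p * r) * (q * s))) = es (a * c)" for a c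
      unfolding S_id[symmetric] by (rule D_mult[symmetric]; (rule lin)+)
    then show ?thesis by simp
  qed
  also have "\<dots> = D g (\<lambda>a b. D h (\<lambda>c d. D c (\<lambda>p q. S p * (es a * q) * S d * S b)))"
  proof -
    have "es (a * c) = D c (\<lambda>p q. S p * (es a * q))" for a c
      unfolding es_es_mult[symmetric, of a c] S_id[symmetric, of "es a * c"]
      by (rule D_mult_Hs(1)[OF _ es_Hs]; (rule lin)+)
    then show ?thesis by (simp add: contract_mult_right)
  qed
  also have "\<dots> = D g (\<lambda>a b. D h (\<lambda>c d. D d (\<lambda>p q. S c * (es a * p) * S q * S b)))"
    by (rule contract_cong, rule coassoc; (rule lin)+)
  also have "\<dots> = D g (\<lambda>a b. D h (\<lambda>c d. S c * (es a * et d) * S b))"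
    by (simp add: id_S[symmetric] contract_mult_left contract_mult_right mult.assoc)
  also have "\<dots> = D g (\<lambda>a b. D h (\<lambda>c d. S c * (et d * es a) * S b))"
    by (simp only: Hs_Ht_commute[OF es_Hs et_Ht])
  also have "\<dots> = D g (\<lambda>a b. D h (\<lambda>c d. S c * et d) * (es a * S b))"
    by (simp add: mult.assoc contract_mult_right)
  also have "\<dots> = S h * S g"
    by (simp add: S_et contract_mult_left[symmetric] es_S)
  finally show ?thesis .
qed

text \<open>On H_s and H_t the antipode is \<open>et\<close> and \<open>es\<close>. Expanding these
  introduces two further copies of \<Delta>(1), and the original copy disappears by \<epsilon>(c
  1_1) \<epsilon>(1_2 g) = \<epsilon>(c g).\<close>

lemma one_flip:
  assumes \<phi>: "bil sc sc t \<phi>"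
  shows "D 1 (\<lambda>a b. \<phi> (S a) (S b)) = D 1 (\<lambda>a b. \<phi> b a)"
proof -
  note [lin] = bilD[OF \<phi>]
  have "D 1 (\<lambda>a b. \<phi> (S a) (S b)) = D 1 (\<lambda>a b. \<phi> (et a) (es b))"
    by (rule one_es_et; ((rule lin)+ | simp add: S_Hs S_Ht))
  also have "\<dots> = D 1 (\<lambda>a b. D 1 (\<lambda>e g. D 1 (\<lambda>c d. \<phi> (sc (\<epsilon> (c * a)) d) (sc (\<epsilon> (b * g)) e))))"
    by (simp add: et_eq es_eq bil_contract1[OF \<phi>] bil_contract2[OF \<phi>])
  also have "\<dots> = D 1 (\<lambda>e g. D 1 (\<lambda>c d. D 1 (\<lambda>a b. \<phi> (sc (\<epsilon> (c * a) * \<epsilon> (b * g)) d) e)))"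
  proof -
    have "\<phi> (sc k d) (sc l e) = \<phi> (sc (k * l) d) e" for k l d e
      using bil_bal[OF \<phi>, of l "sc k d" e] vs by (simp add: vector_space_def module_def mult.commute)
    then show ?thesis by (subst contract_swap) (simp, subst (2) contract_swap, simp)
  qed
  also have "\<dots> = D 1 (\<lambda>e g. D 1 (\<lambda>c d. \<phi> (sc (\<epsilon> (c * g)) d) e))"
  proof (rule contract_cong, rule contract_cong)
    fix e g c d
    have "D 1 (\<lambda>a b. \<phi> (sc (\<epsilon> (c * a) * \<epsilon> (b * g)) d) e) = \<phi> (sc (D 1 (\<lambda>a b. \<epsilon> (c * a) * \<epsilon> (b * g))) d) e"
      by (rule klin_contract[symmetric, where s = "(*)"]; (rule lin)+)
    then show "D 1 (\<lambda>a b. \<phi> (sc (\<epsilon> (c * a) * \<epsilon> (b * g)) d) e) = \<phi> (sc (\<epsilon> (c * g)) d) e"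
      by (simp add: eps_mult1[of c 1 g, simplified])
  qed
  also have "\<dots> = D 1 (\<lambda>e g. \<phi> (et g) e)"
    by (simp add: et_eq bil_contract1[OF \<phi>])
  also have "\<dots> = D 1 (\<lambda>e g. \<phi> g e)"
    by (rule one_et; (rule lin)+)
  finally show ?thesis .
qed

text \<open>
  \<open>\<Delta> \<circ> S\<close> and \<open>(S \<otimes> S) \<circ> \<Delta>\<^sup>c\<^sup>o\<^sup>p\<close> are both convolution inverses of \<open>\<Delta>\<close> in the weak sense.
\<close>

lemma S_comul:
  assumes \<phi>: "bil sc sc t \<phi>"
  shows "D (S h) \<phi> = D h (\<lambda>a b. \<phi> (S b) (S a))"
proof -
  note [lin] = bilD[OF \<phi>]
  \<comment> \<open>In tensors, \<Delta>(es x) is the product of (S \<otimes> S) applied to the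
    flipped \<Delta>(x_1) with \<Delta>(x_2).\<close>
  have es: "D (es x) \<psi> = D x (\<lambda>a b. D a (\<lambda>c d. D b (\<lambda>e g. \<psi> (S d * e) (S c * g))))"
    if \<psi>: "bil sc sc t \<psi>" for x \<psi>
  proof -
    note [lin] = bilD[OF \<psi>]
    have "D x (\<lambda>a b. D a (\<lambda>c d. D b (\<lambda>e g. \<psi> (S d * e) (S c * g))))
      = D x (\<lambda>a b. D b (\<lambda>c d. D d (\<lambda>e g. \<psi> (S c * e) (S a * g))))"
      by (rule coassoc; (rule lin)+)
    also have "\<dots> = D x (\<lambda>a b. D b (\<lambda>c d. D c (\<lambda>e g. \<psi> (S e * g) (S a * d))))"
      by (rule contract_cong, rule coassoc[symmetric]; (rule lin)+)
    also have "\<dots> = D x (\<lambda>a b. D b (\<lambda>c d. \<psi> (es c) (S a * d)))"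
      by (simp add: S_id[symmetric] bil_contract1[OF \<psi>])
    also have "\<dots> = D x (\<lambda>a b. D 1 (\<lambda>c d. \<psi> c (S a * (b * d))))"
      by (rule contract_cong, rule comul_es; (rule lin)+)
    also have "\<dots> = D 1 (\<lambda>c d. \<psi> c (es x * d))"
      by (subst contract_swap) (simp add: S_id[symmetric] bil_contract2[OF \<psi>]
          contract_mult_right mult.assoc)
    also have "\<dots> = D (es x) \<psi>"
      by (rule comul_Hs(2)[symmetric]; simp?; (rule lin)+)
    finally show ?thesis ..
  qed
  have "D (S h) \<phi> = D h (\<lambda>a b. D (es a) (\<lambda>p q. D (S b) (\<lambda>r s. \<phi> (p * r) (q * s))))"
    by (simp only: es_S[symmetric, of h] D_contract[OF \<phi>] D_mult[OF \<phi>])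
  also have "\<dots> = D h (\<lambda>a b. D a (\<lambda>c d. D c (\<lambda>e g. D d (\<lambda>i j. D (S b) (\<lambda>r s. \<phi> (S g * i * r) (S e * j * s))))))"
    by (rule contract_cong, rule es; (rule lin)+)
  also have "\<dots> = D h (\<lambda>a b. D b (\<lambda>c d. D a (\<lambda>e g. D c (\<lambda>i j. D (S d) (\<lambda>r s. \<phi> (S g * i * r) (S e * j * s))))))"
    by (rule coassoc; (rule lin)+)
  also have "\<dots> = D h (\<lambda>a b. D a (\<lambda>e g. D b (\<lambda>c d. D (c * S d) (\<lambda>x y. \<phi> (S g * x) (S e * y)))))"
  proof (rule contract_cong, subst contract_swap, rule contract_cong, rule contract_cong)
    fix a b e g c d
    show "D c (\<lambda>i j. D (S d) (\<lambda>r s. \<phi> (S g * i * r) (S e * j * s))) = D (c * S d) (\<lambda>x y. \<phi> (S g * x) (S e * y))"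
      unfolding mult.assoc by (rule D_mult[symmetric]; (rule lin)+)
  qed
  also have "\<dots> = D h (\<lambda>a b. D a (\<lambda>e g. D (et b) (\<lambda>x y. \<phi> (S g * x) (S e * y))))"
    unfolding id_S[symmetric] by (rule contract_cong, rule contract_cong, rule D_contract[symmetric]; (rule lin)+)
  also have "\<dots> = D h (\<lambda>a b. D a (\<lambda>e g. D 1 (\<lambda>x y. \<phi> (S g * (et b * x)) (S e * y))))"
    by (rule contract_cong, rule contract_cong, rule comul_Ht(2)[OF _ et_Ht]; (rule lin)+)
  also have "\<dots> = D h (\<lambda>e b. D b (\<lambda>g d. D 1 (\<lambda>x y. \<phi> (S g * (et d * x)) (S e * y))))"
    by (rule coassoc; (rule lin)+)
  also have "\<dots> = D h (\<lambda>e b. D 1 (\<lambda>x y. \<phi> (S b * x) (S e * y)))"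
    by (rule contract_cong, subst contract_swap, subst S_et[symmetric])
      (simp add: contract_mult_right bil_contract1[OF \<phi>] mult.assoc)
  \<comment> \<open>The leftover \<Delta>(1) stands on the right. After the flip its legs join b and
    e under the antipodes, on their left, where \<Delta>(1) \<Delta>(h) = \<Delta>(h) absorbs
    it.\<close>
  also have "\<dots> = D h (\<lambda>e b. D 1 (\<lambda>x y. \<phi> (S b * S y) (S e * S x)))"
    by (rule contract_cong, rule one_flip[symmetric]; (rule lin)+)
  also have "\<dots> = D 1 (\<lambda>x y. D h (\<lambda>e b. \<phi> (S (y * b)) (S (x * e))))"
    by (subst contract_swap) (simp add: S_mult)
  also have "\<dots> = D h (\<lambda>a b. \<phi> (S b) (S a))"
    by (rule one_comul; (rule lin)+)
  finally show ?thesis .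
qed

lemma eps_S_Hs: "y \<in> Hs \<Longrightarrow> \<epsilon> (g * S y) = \<epsilon> (g * y)"
  and eps_S_Ht: "z \<in> Ht \<Longrightarrow> \<epsilon> (S z * g) = \<epsilon> (z * g)"
  by (simp_all add: S_Hs S_Ht eps_et eps_es)

text \<open>Flip \<Delta>(1) in the definition and remove the antipode under the counit. These forms
  exhibit the values of \<open>et\<close> and \<open>es\<close> as antipodes of elements of H_s and
  H_t.\<close>

lemma et_alt: "et h = D 1 (\<lambda>a b. sc (\<epsilon> (b * h)) (S a))"
  and es_alt: "es h = D 1 (\<lambda>a b. sc (\<epsilon> (h * a)) (S b))"
proof -
  have "et h = D 1 (\<lambda>a b. sc (\<epsilon> (S b * h)) (S a))"
    unfolding et_eq by (rule one_flip[symmetric]; (rule lin)+)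
  also have "\<dots> = D 1 (\<lambda>a b. sc (\<epsilon> (b * h)) (S a))"
    by (rule one_es_et; ((rule lin)+ | simp add: eps_S_Ht))
  finally show "et h = D 1 (\<lambda>a b. sc (\<epsilon> (b * h)) (S a))" .
  have "es h = D 1 (\<lambda>a b. sc (\<epsilon> (h * S a)) (S b))"
    unfolding es_eq by (rule one_flip[symmetric]; (rule lin)+)
  also have "\<dots> = D 1 (\<lambda>a b. sc (\<epsilon> (h * a)) (S b))"
    by (rule one_es_et; ((rule lin)+ | simp add: eps_S_Hs))
  finally show "es h = D 1 (\<lambda>a b. sc (\<epsilon> (h * a)) (S b))" .
qed

lemma et_comul:
  assumes \<phi>: "bil sc sc t \<phi>"
  shows "D h (\<lambda>a b. \<phi> (et a) b) = D 1 (\<lambda>a b. \<phi> (S a) (b * h))"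
proof -
  note [lin] = bilD[OF \<phi>]
  have "D h (\<lambda>a b. \<phi> (et a) b) = D h (\<lambda>a b. D 1 (\<lambda>c d. \<phi> (S c) (sc (\<epsilon> (d * a)) b)))"
    by (simp add: et_alt bil_contract1[OF \<phi>] bil_bal[OF \<phi>])
  also have "\<dots> = D 1 (\<lambda>a b. \<phi> (S a) (b * h))"
    by (rule one_eps_comul; (rule lin)+)
  finally show ?thesis .
qed

lemma comul_es':
  assumes \<phi>: "bil sc sc t \<phi>"
  shows "D h (\<lambda>a b. \<phi> a (es b)) = D 1 (\<lambda>a b. \<phi> (h * a) (S b))"
proof -
  note [lin] = bilD[OF \<phi>]
  have "D h (\<lambda>a b. \<phi> a (es b)) = D h (\<lambda>a b. D 1 (\<lambda>c d. \<phi> (sc (\<epsilon> (b * c)) a) (S d)))"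
    by (simp add: es_alt bil_contract2[OF \<phi>] bil_bal[OF \<phi>])
  also have "\<dots> = D 1 (\<lambda>a b. \<phi> (h * a) (S b))"
    by (rule comul_eps_one; (rule lin)+)
  finally show ?thesis .
qed

section \<open>Sliding across the unit coproduct; antipode images\<close>

text \<open>Both sides equal y_1 \<otimes> et(y_2), computed from \<open>comul_et\<close> and from
  \<open>comul_Hs\<close>.\<close>

lemma one_slide_Hs:
  assumes \<phi>: "bil sc sc t \<phi>" and y: "y \<in> Hs"
  shows "D 1 (\<lambda>a b. \<phi> (a * y) b) = D 1 (\<lambda>a b. \<phi> a (b * S y))"
proof -
  note [lin] = bilD[OF \<phi>]
  have "D 1 (\<lambda>a b. \<phi> (a * y) b) = D y (\<lambda>a b. \<phi> a (et b))" by (rule comul_et[OF \<phi>, symmetric])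
  also have "\<dots> = D 1 (\<lambda>a b. \<phi> a (et (b * y)))" by (rule comul_Hs(1)[OF _ y]; (rule lin)+)
  also have "\<dots> = D 1 (\<lambda>a b. \<phi> a (b * S y))"
    by (rule one_es_et; ((rule lin)+ | simp add: et_Ht_mult S_Hs y))
  finally show ?thesis .
qed

lemma one_slide_Ht:
  assumes \<phi>: "bil sc sc t \<phi>" and z: "z \<in> Ht"
  shows "D 1 (\<lambda>a b. \<phi> a (z * b)) = D 1 (\<lambda>a b. \<phi> (S z * a) b)"
proof -
  note [lin] = bilD[OF \<phi>]
  have "D 1 (\<lambda>a b. \<phi> a (z * b)) = D z (\<lambda>a b. \<phi> (es a) b)" by (rule comul_es[OF \<phi>, symmetric])
  also have "\<dots> = D 1 (\<lambda>a b. \<phi> (es (z * a)) b)" by (rule comul_Ht(2)[OF _ z]; (rule lin)+)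
  also have "\<dots> = D 1 (\<lambda>a b. \<phi> (S z * a) b)"
    by (rule one_es_et; ((rule lin)+ | simp add: es_mult_Hs S_Ht z))
  finally show ?thesis .
qed

lemma Ht_S_Hs: "z \<in> Ht \<Longrightarrow> \<exists>y\<in>Hs. z = S y"
proof -
  assume z: "z \<in> Ht"
  \<comment> \<open>Read off from \<open>et_alt\<close>, where z = et(z) is displayed as the
    antipode of this sum.\<close>
  let ?y = "D 1 (\<lambda>c d. sc (\<epsilon> (d * z)) c)"
  have "es ?y = D 1 (\<lambda>c d. es (sc (\<epsilon> (d * z)) c))"
    by (rule klin_contract; (rule lin)+)
  also have "\<dots> = ?y"
    by (rule one_es_et; ((rule lin)+ | simp add: klin_scale[OF lin_es[OF klin_id[OF vs]]] Hs_def))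
  finally have "?y \<in> Hs" by (simp add: Hs_def)
  moreover have "z = S ?y" using z et_alt[of z] by (simp add: S_contract Ht_def)
  ultimately show ?thesis by blast
qed

lemma Hs_S_Ht: "y \<in> Hs \<Longrightarrow> \<exists>z\<in>Ht. y = S z"
proof -
  assume y: "y \<in> Hs"
  let ?z = "D 1 (\<lambda>c d. sc (\<epsilon> (y * c)) d)"
  have "et ?z = D 1 (\<lambda>c d. et (sc (\<epsilon> (y * c)) d))"
    by (rule klin_contract; (rule lin)+)
  also have "\<dots> = ?z"
    by (rule one_es_et; ((rule lin)+ | simp add: klin_scale[OF lin_et[OF klin_id[OF vs]]] Ht_def))
  finally have "?z \<in> Ht" by (simp add: Ht_def)
  moreover have "y = S ?z" using y es_alt[of y] by (simp add: S_contract Hs_def)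
  ultimately show ?thesis by blast
qed

lemma S_inj: "S x = S y \<Longrightarrow> x = y"
  using bij_S by (simp add: bij_def inj_def)

lemma et_S: "et (S h) = S (es h)"
proof -
  have "et (S h) = D h (\<lambda>a b. S b * S (S a))"
    unfolding id_S[symmetric] by (rule S_comul; (rule lin)+)
  then show ?thesis by (simp add: S_id[symmetric] S_contract S_mult)
qed

lemma et_id: "D h (\<lambda>a b. et a * b) = h"
proof -
  have "D h (\<lambda>a b. et a * b) = D 1 (\<lambda>a b. S a * (b * h))" by (rule et_comul; (rule lin)+)
  also have "\<dots> = D 1 (\<lambda>a b. S a * b) * h" by (simp add: contract_mult_right mult.assoc)
  finally show ?thesis by (simp add: S_id)
qed

lemma id_es: "D h (\<lambda>a b. a * es b) = h"
proof -
  have "D h (\<lambda>a b. a * es b) = D 1 (\<lambda>a b. h * a * S b)" by (rule comul_es'; (rule lin)+)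
  also have "\<dots> = h * D 1 (\<lambda>a b. a * S b)" by (simp add: contract_mult_left mult.assoc)
  finally show ?thesis by (simp add: id_S)
qed

section \<open>The tensor product of modules\<close>

lemma module_kspace: "left_module H V \<Longrightarrow> kspace V"
  and act_in: "left_module H V \<Longrightarrow> v \<in> carrier V \<Longrightarrow> act V h v \<in> carrier V"
  and act_1: "left_module H V \<Longrightarrow> v \<in> carrier V \<Longrightarrow> act V 1 v = v"
  and act_mult: "left_module H V \<Longrightarrow> v \<in> carrier V \<Longrightarrow> act V (g * h) v = act V g (act V h v)"
  and klinear_act: "left_module H V \<Longrightarrow> klinear V V (act V h)"
  by (auto simp: left_module_def kbilinear_def klinear_def)

lemma lin_act: "klin s sc g \<Longrightarrow> left_module H V \<Longrightarrow> v \<in> carrier V \<Longrightarrow> klin s (scl V) (\<lambda>x. act V (g x) v)"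
  by (auto simp: left_module_def kbilinear_def klinear_def Vector_Spaces.linear_iff kspace_def)

lemmas modlin = lin_act klin_tens1 klin_tens2

text \<open>The value of \<open>diag_act\<close> on a pure tensor, available without contracting
  over V and W. The generators of the truncated product are the case h = 1.\<close>

definition tens_act :: "('k, 'v::ab_group_add, 'h) hmod \<Rightarrow> ('k, 'w::ab_group_add, 'h) hmod \<Rightarrow> 'h \<Rightarrow> 'v \<Rightarrow> 'w
    \<Rightarrow> ('v, 'w, 'k) tensor" where
  "tens_act V W h v w = D h (\<lambda>a b. tens V W (act V a v) (act W b w))"

lemma tens_t_eq: "tens_t H V W = tens_act V W 1"
  by (simp add: tens_t_def tens_act_def fun_eq_iff)

lemma kbilinear_tens_act:
  assumes "left_module H V" "left_module H W"
  shows "kbilinear V W (whole tscl) (tens_act V W h)"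
  unfolding kbilinear_def tens_act_def
  by (intro conjI ballI klinear_contract_fun klinear_tens_left klinear_tens_right klinear_whole klinear_act assms vs_tscl)

lemma bil_tens_act:
  assumes "left_module H V" "left_module H W" "v \<in> carrier V" "w \<in> carrier W"
  shows "bil sc sc tscl (\<lambda>a b. tens V W (act V a v) (act W b w))"
  by (rule lin) (rule lin modlin assms)+

lemma tens_act_in:
  assumes "left_module H V" "left_module H W" "v \<in> carrier V" "w \<in> carrier W"
  shows "tens_act V W h v w \<in> carrier (tensor V W)"
  unfolding tens_act_def
  by (rule contract_in[OF kspace_tensor[OF module_kspace[OF assms(1)]] comul_in]) (simp add: act_in assms)

lemma diag_act_eq: "diag_act H V W h = contract V W (tens_act V W h)"
  unfolding diag_act_def tmap_def tens_act_def by (subst contract_swap) (rule refl)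

lemma klinear_diag_act:
  assumes "left_module H V" "left_module H W"
  shows "klinear (tensor V W) (tensor V W) (diag_act H V W h)"
proof (rule klinear_into)
  show "klinear (tensor V W) (whole (scl (tensor V W))) (diag_act H V W h)"
    unfolding diag_act_eq using klinear_contract[OF module_kspace[OF assms(1)] module_kspace[OF assms(2)]
        kspace_whole[OF vs_tscl] kbilinear_tens_act[OF assms]] by simp
  show "diag_act H V W h x \<in> carrier (tensor V W)" if "x \<in> carrier (tensor V W)" for x
    unfolding diag_act_eq
    by (rule contract_in[OF kspace_tensor[OF module_kspace[OF assms(1)]] that]) (rule tens_act_in[OF assms])
qed

lemma diag_act_tens:
  assumes "left_module H V" "left_module H W" "v \<in> carrier V" "w \<in> carrier W"
  shows "diag_act H V W h (tens V W v w) = tens_act V W h v w"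
  unfolding diag_act_eq
  by (rule contract_tens[OF module_kspace[OF assms(1)] module_kspace[OF assms(2)] kspace_whole[OF vs_tscl]
        kbilinear_tens_act[OF assms(1,2)] assms(3,4)])

lemma klinear_tens_act:
  assumes "left_module H V" "left_module H W" "v \<in> carrier V" "w \<in> carrier W"
    and F: "klinear (tensor V W) X F"
  shows "F (tens_act V W h v w) = D h (\<lambda>a b. F (tens V W (act V a v) (act W b w)))"
  unfolding tens_act_def
  by (rule klinear_contract_elem[OF F kspace_tensor[OF module_kspace[OF assms(1)]] comul_in]) (simp add: act_in assms)

lemma diag_act_tens_act:
  assumes "left_module H V" "left_module H W" "v \<in> carrier V" "w \<in> carrier W"
  shows "diag_act H V W g (tens_act V W h v w) = tens_act V W (g * h) v w"
proof -
  note [simp] = assms act_in act_mult[symmetric]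
  have "diag_act H V W g (tens_act V W h v w) = D h (\<lambda>a b. tens_act V W g (act V a v) (act W b w))"
    by (simp add: klinear_tens_act[OF assms klinear_diag_act[OF assms(1,2)]] diag_act_tens)
  also have "\<dots> = D g (\<lambda>c d. D h (\<lambda>a b. tens V W (act V (c * a) v) (act W (d * b) w)))"
    unfolding tens_act_def by (subst contract_swap) simp
  also have "\<dots> = tens_act V W (g * h) v w"
    unfolding tens_act_def by (rule D_mult[OF bil_tens_act[OF assms], symmetric])
  finally show ?thesis .
qed

text \<open>Multiplicativity holds before truncation, where 1 acts as an idempotent instead of the
  identity. Its image is \<open>tprod\<close>, which therefore consists of its fixed points.\<close>

lemma diag_act_mult:
  assumes "left_module H V" "left_module H W" "x \<in> carrier (tensor V W)"
  shows "diag_act H V W (g * h) x = diag_act H V W g (diag_act H V W h x)"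
  by (rule tensor_ext[OF klinear_diag_act[OF assms(1,2)] klinear_comp[OF klinear_diag_act[OF assms(1,2)]
          klinear_diag_act[OF assms(1,2)]] module_kspace[OF assms(1)] _ assms(3)])
    (simp add: diag_act_tens diag_act_tens_act assms(1,2))

lemma scl_tprod [simp]: "scl (tprod H V W) = tscl" and act_tprod [simp]: "act (tprod H V W) = diag_act H V W"
  by (simp_all add: tprod_def)

lemma tprod_iff:
  assumes "left_module H V" "left_module H W"
  shows "x \<in> carrier (tprod H V W) \<longleftrightarrow> x \<in> carrier (tensor V W) \<and> diag_act H V W 1 x = x"
  using diag_act_mult[OF assms, of _ 1 1] klinear_in[OF klinear_diag_act[OF assms]]
  by (auto simp: tprod_def image_iff) metis

lemma tprod_sub: "left_module H V \<Longrightarrow> left_module H W \<Longrightarrow> carrier (tprod H V W) \<subseteq> carrier (tensor V W)"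
  by (auto simp: tprod_iff)

lemma kspace_tprod:
  assumes "left_module H V" "left_module H W"
  shows "kspace (tprod H V W)"
proof -
  note kt = kspace_tensor[OF module_kspace[OF assms(1)], of W]
  have "diag_act H V W 1 0 = 0"
    using klinear_sum_list[OF kt klinear_diag_act[OF assms], of "[]" 1] by simp
  then have "module.subspace (scl (tprod H V W)) (carrier (tprod H V W))"
    using klinear_diag_act[OF assms, of 1] kspace_0[OF kt] kspace_add[OF kt] kspace_scale[OF kt]
      kspace_vs[OF kt]
    by (auto simp: module.subspace_def vector_space_def module_def tprod_iff[OF assms] klinear_def)
  then show ?thesis by (simp add: kspace_def vs_tscl)
qed

lemma tprod_module:
  assumes "left_module H V" "left_module H W"
  shows "left_module H (tprod H V W)"
  unfolding left_module_def
proof (intro conjI allI ballI kspace_tprod[OF assms])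
  note it = tprod_iff[OF assms]
  have ia: "diag_act H V W h x \<in> carrier (tprod H V W)" if "x \<in> carrier (tprod H V W)" for h x
    using that diag_act_mult[OF assms, of x 1 h] klinear_in[OF klinear_diag_act[OF assms]] by (auto simp: it)
  show "kbilinear H (tprod H V W) (tprod H V W) (act (tprod H V W))"
    unfolding kbilinear_def act_tprod
  proof (intro conjI ballI)
    fix h
    show "klinear (tprod H V W) (tprod H V W) (diag_act H V W h)"
      by (rule klinear_into[OF _ ia])
        (use klinear_sub[OF klinear_whole[OF klinear_diag_act[OF assms]] tprod_sub[OF assms]] in simp_all)
  next
    fix x assume x: "x \<in> carrier (tprod H V W)"
    have "klin sc tscl (\<lambda>h. diag_act H V W h x)"
      unfolding diag_act_eq tens_act_def
      by (rule klin_contract_fun_carrier[where V = V and W = W];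
        (rule lin_D bil_tens_act klin_id vs vs_tscl assms subsetD[OF tprod_sub[OF assms] x] | assumption)+)
    then show "klinear H (tprod H V W) (\<lambda>h. diag_act H V W h x)"
      using ia[OF x] by (auto simp: klinear_def Vector_Spaces.linear_iff)
  qed
  fix x assume x: "x \<in> carrier (tprod H V W)"
  show "act (tprod H V W) 1 x = x" using x by (simp add: it)
  show "act (tprod H V W) (g * h) x = act (tprod H V W) g (act (tprod H V W) h x)" for g h
    using x diag_act_mult[OF assms] by (simp add: it)
qed

lemma tens_t_in:
  assumes "left_module H V" "left_module H W" "v \<in> carrier V" "w \<in> carrier W"
  shows "tens_t H V W v w \<in> carrier (tprod H V W)"
  using tens_act_in[OF assms] diag_act_tens_act[OF assms, of 1 1] by (simp add: tprod_iff[OF assms(1,2)] tens_t_eq)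

lemma kbilinear_tens_t:
  assumes "left_module H V" "left_module H W"
  shows "kbilinear V W (tprod H V W) (tens_t H V W)"
  using kbilinear_tens_act[OF assms, of 1] tens_t_in[OF assms]
  by (auto simp: kbilinear_def klinear_def tens_t_eq)

text \<open>Since x is fixed by \<Delta>(1), any list of pairs representing x by tensors v \<otimes>
  w also represents it by truncated tensors.\<close>

lemma tprod_expand:
  assumes "left_module H V" "left_module H W" "x \<in> carrier (tprod H V W)"
  shows "contract V W (tens_t H V W) x = x"
  using assms(3) by (simp add: tprod_iff[OF assms(1,2)] tens_t_eq diag_act_eq)

lemma tprod_ext:
  assumes "left_module H V" "left_module H W"
    and "klinear (tprod H V W) X F" "klinear (tprod H V W) X' G"
    and "\<And>v w. v \<in> carrier V \<Longrightarrow> w \<in> carrier W \<Longrightarrow> F (tens_t H V W v w) = G (tens_t H V W v w)"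
    and x: "x \<in> carrier (tprod H V W)"
  shows "F x = G x"
proof -
  have xt: "x \<in> carrier (tensor V W)" using x tprod_sub[OF assms(1,2)] by auto
  note ks = kspace_tprod[OF assms(1,2)]
  have "F x = contract V W (\<lambda>v w. F (tens_t H V W v w)) x"
    using klinear_contract_elem[OF assms(3) ks xt, of "tens_t H V W"] tprod_expand[OF assms(1,2) x] tens_t_in[OF assms(1,2)] by simp
  also have "\<dots> = contract V W (\<lambda>v w. G (tens_t H V W v w)) x"
    by (rule contract_cong_carrier[OF xt assms(5)])
  also have "\<dots> = G x"
    using klinear_contract_elem[OF assms(4) ks xt, of "tens_t H V W"] tprod_expand[OF assms(1,2) x] tens_t_in[OF assms(1,2)] by simp
  finally show ?thesis .
qed

text \<open>The first form stays among generators and serves for morphisms out of truncated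
  products; the second lies in the ambient tensor product and serves for the associators.\<close>

lemma act_tens_t:
  assumes "left_module H V" "left_module H W" "v \<in> carrier V" "w \<in> carrier W"
  shows "diag_act H V W h (tens_t H V W v w) = D h (\<lambda>a b. tens_t H V W (act V a v) (act W b w))"
    and "diag_act H V W h (tens_t H V W v w) = tens_act V W h v w"
proof -
  show 1: "diag_act H V W h (tens_t H V W v w) = tens_act V W h v w"
    using diag_act_tens_act[OF assms, of h 1] by (simp add: tens_t_eq)
  have "tens_act V W h v w = diag_act H V W 1 (tens_act V W h v w)"
    using diag_act_tens_act[OF assms, of 1 h] by simp
  also have "\<dots> = D h (\<lambda>a b. tens_t H V W (act V a v) (act W b w))"
    by (simp add: klinear_tens_act[OF assms klinear_diag_act[OF assms(1,2)]] diag_act_tens assms act_in tens_t_eq)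
  finally show "diag_act H V W h (tens_t H V W v w) = D h (\<lambda>a b. tens_t H V W (act V a v) (act W b w))"
    using 1 by simp
qed

lemma hom_tens_tI:
  assumes "left_module H V" "left_module H W" "left_module H X" "klinear (tprod H V W) X F"
    and "\<And>h v w. v \<in> carrier V \<Longrightarrow> w \<in> carrier W \<Longrightarrow>
      D h (\<lambda>a b. F (tens_t H V W (act V a v) (act W b w))) = act X h (F (tens_t H V W v w))"
  shows "hmod_hom H (tprod H V W) X F"
  unfolding hmod_hom_def act_tprod
proof (intro conjI assms(4) allI ballI)
  fix h x assume x: "x \<in> carrier (tprod H V W)"
  have kd: "klinear (tprod H V W) (tprod H V W) (diag_act H V W h)"
    using klinear_act[OF tprod_module[OF assms(1,2)], of h] by simp
  show "F (diag_act H V W h x) = act X h (F x)"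
  proof (rule tprod_ext[OF assms(1,2) klinear_comp[OF kd assms(4)] klinear_comp[OF assms(4) klinear_act[OF assms(3)]] _ x])
    fix v w assume vw: "v \<in> carrier V" "w \<in> carrier W"
    have "F (diag_act H V W h (tens_t H V W v w)) = F (D h (\<lambda>a b. tens_t H V W (act V a v) (act W b w)))"
      by (simp add: act_tens_t(1) vw assms)
    also have "\<dots> = D h (\<lambda>a b. F (tens_t H V W (act V a v) (act W b w)))"
      by (rule klinear_contract_elem[OF assms(4) kspace_tprod[OF assms(1,2)] comul_in])
        (simp add: tens_t_in act_in vw assms)
    finally show "F (diag_act H V W h (tens_t H V W v w)) = act X h (F (tens_t H V W v w))"
      using assms(5)[OF vw] by simp
  qed
qed

section \<open>Maps prescribed on truncated tensors\<close>

text \<open>The list chosen by \<open>contract_t\<close> represents x by truncated tensors, and need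
  not represent it by the tensors v \<otimes> w. The condition \<open>bal\<close> makes the ordinary
  contraction take the value \<phi> v w on the truncated tensor of v and w, so both choices evaluate
  alike.\<close>

lemma contract_t_eq:
  assumes V: "left_module H V" and W: "left_module H W" and X: "kspace X" and \<phi>: "kbilinear V W X \<phi>"
    and bal: "\<And>v w. v \<in> carrier V \<Longrightarrow> w \<in> carrier W \<Longrightarrow> D 1 (\<lambda>a b. \<phi> (act V a v) (act W b w)) = \<phi> v w"
    and x: "x \<in> carrier (tprod H V W)"
  shows "contract_t H V W \<phi> x = contract V W \<phi> x"
proof -
  define P where "P ps \<longleftrightarrow> set ps \<subseteq> carrier V \<times> carrier W \<and> x = (\<Sum>(v, w)\<leftarrow>ps. tens_t H V W v w)" for ps
  have xt: "x \<in> carrier (tensor V W)" using x tprod_sub[OF V W] by auto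
  have "P (pairs_of V W x)"
    using pairs_of(1)[OF xt] tprod_expand[OF V W x] by (simp add: P_def contract_pairs_of)
  then have "P (SOME ps. P ps)" by (rule someI)
  then obtain ps where ps: "ps = (SOME ps. P ps)" "P ps" by blast
  have kl: "klinear (tensor V W) X (contract V W \<phi>)"
    by (rule klinear_contract[OF module_kspace[OF V] module_kspace[OF W] X \<phi>])
  have gen: "contract V W \<phi> (tens_t H V W v w) = \<phi> v w" if "v \<in> carrier V" "w \<in> carrier W" for v w
    unfolding tens_t_eq klinear_tens_act[OF V W that kl] bal[OF that, symmetric]
    by (rule contract_cong, rule contract_tens[OF module_kspace[OF V] module_kspace[OF W] X \<phi>])
      (simp_all add: act_in V W that)
  have "contract V W \<phi> x = (\<Sum>(v, w)\<leftarrow>ps. \<phi> v w)"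
  proof -
    have s: "set (map (\<lambda>(v, w). tens_t H V W v w) ps) \<subseteq> carrier (tensor V W)"
      using ps(2) tens_t_in[OF V W] tprod_sub[OF V W] by (auto simp: P_def subset_iff)
    have "contract V W \<phi> x = (\<Sum>p\<leftarrow>ps. contract V W \<phi> (case p of (v, w) \<Rightarrow> tens_t H V W v w))"
      using klinear_sum_list[OF kspace_tensor[OF module_kspace[OF V]] kl s] ps(2) by (simp add: P_def o_def)
    also have "\<dots> = (\<Sum>(v, w)\<leftarrow>ps. \<phi> v w)"
      using ps(2) gen by (intro arg_cong[where f = sum_list] map_cong) (auto simp: P_def)
    finally show ?thesis .
  qed
  then show ?thesis
    by (simp add: contract_t_def lift_via_def Let_def P_def[symmetric] ps(1))
qed

lemma contract_t_tens_t:
  assumes V: "left_module H V" and W: "left_module H W" and X: "kspace X" and \<phi>: "kbilinear V W X \<phi>"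
    and bal: "\<And>v w. v \<in> carrier V \<Longrightarrow> w \<in> carrier W \<Longrightarrow> D 1 (\<lambda>a b. \<phi> (act V a v) (act W b w)) = \<phi> v w"
  shows "klinear (tprod H V W) X (contract_t H V W \<phi>)"
    and "v \<in> carrier V \<Longrightarrow> w \<in> carrier W \<Longrightarrow> contract_t H V W \<phi> (tens_t H V W v w) = \<phi> v w"
proof -
  have kl: "klinear (tensor V W) X (contract V W \<phi>)"
    by (rule klinear_contract[OF module_kspace[OF V] module_kspace[OF W] X \<phi>])
  have "klinear (tprod H V W) X (contract V W \<phi>)"
    by (rule klinear_sub[OF kl tprod_sub[OF V W]]) simp
  moreover note kspace_add[OF kspace_tprod[OF V W]] kspace_scale[OF kspace_tprod[OF V W], unfolded scl_tprod]
  ultimately show "klinear (tprod H V W) X (contract_t H V W \<phi>)"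
    unfolding klinear_def scl_tprod
    by (simp add: contract_t_eq[OF V W X \<phi> bal])
  assume vw: "v \<in> carrier V" "w \<in> carrier W"
  have "contract_t H V W \<phi> (tens_t H V W v w) = contract V W \<phi> (tens_act V W 1 v w)"
    using contract_t_eq[OF V W X \<phi> bal tens_t_in[OF V W vw]] by (simp add: tens_t_eq)
  also have "\<dots> = D 1 (\<lambda>a b. \<phi> (act V a v) (act W b w))"
    unfolding klinear_tens_act[OF V W vw kl]
    by (rule contract_cong, rule contract_tens[OF module_kspace[OF V] module_kspace[OF W] X \<phi>])
      (simp_all add: act_in V W vw)
  finally show "contract_t H V W \<phi> (tens_t H V W v w) = \<phi> v w" using bal[OF vw] by simp
qed

text \<open>Equivariance at h = 1 is the balance condition, so one identity gives well-definedness
  and H-linearity together.\<close>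

lemma contract_t_hom:
  assumes V: "left_module H V" and W: "left_module H W" and X: "left_module H X" and \<phi>: "kbilinear V W X \<phi>"
    and eq: "\<And>h v w. v \<in> carrier V \<Longrightarrow> w \<in> carrier W \<Longrightarrow> D h (\<lambda>a b. \<phi> (act V a v) (act W b w)) = act X h (\<phi> v w)"
  shows "hmod_hom H (tprod H V W) X (contract_t H V W \<phi>)"
    and "v \<in> carrier V \<Longrightarrow> w \<in> carrier W \<Longrightarrow> contract_t H V W \<phi> (tens_t H V W v w) = \<phi> v w"
    and "x \<in> carrier (tprod H V W) \<Longrightarrow> contract_t H V W \<phi> x = contract V W \<phi> x"
proof -
  have in_X: "\<phi> v w \<in> carrier X" if "v \<in> carrier V" "w \<in> carrier W" for v w
    using \<phi> that by (auto simp: kbilinear_def klinear_def)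
  have bal: "D 1 (\<lambda>a b. \<phi> (act V a v) (act W b w)) = \<phi> v w" if "v \<in> carrier V" "w \<in> carrier W" for v w
    using eq[OF that, of 1] act_1[OF X in_X[OF that]] by simp
  note gen = contract_t_tens_t[OF V W module_kspace[OF X] \<phi> bal]
  show "hmod_hom H (tprod H V W) X (contract_t H V W \<phi>)"
    by (rule hom_tens_tI[OF V W X gen(1)]) (simp_all add: gen(2) act_in V W eq)
  show "v \<in> carrier V \<Longrightarrow> w \<in> carrier W \<Longrightarrow> contract_t H V W \<phi> (tens_t H V W v w) = \<phi> v w"
    by (rule gen(2))
  show "x \<in> carrier (tprod H V W) \<Longrightarrow> contract_t H V W \<phi> x = contract V W \<phi> x"
    by (rule contract_t_eq[OF V W module_kspace[OF X] \<phi> bal])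
qed

lemma hom_klinear: "hmod_hom H V W g \<Longrightarrow> klinear V W g"
  and hom_act: "hmod_hom H V W g \<Longrightarrow> v \<in> carrier V \<Longrightarrow> g (act V h v) = act W h (g v)"
  by (simp_all add: hmod_hom_def)

lemma tmap_hom:
  assumes V: "left_module H V" and W: "left_module H W" and V1: "left_module H V1" and W1: "left_module H W1"
    and g: "hmod_hom H V V1 g" and h: "hmod_hom H W W1 h"
  shows "hmod_hom H (tprod H V W) (tprod H V1 W1) (tmap V W V1 W1 g h)"
    and "v \<in> carrier V \<Longrightarrow> w \<in> carrier W \<Longrightarrow>
      tmap V W V1 W1 g h (tens_t H V W v w) = tens_t H V1 W1 (g v) (h w)"
proof -
  note gl = hom_klinear[OF g] and hl = hom_klinear[OF h]
  note tm = tmap_tens[OF module_kspace[OF V] module_kspace[OF W] gl hl]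
  have tens_act: "tmap V W V1 W1 g h (tens_act V W k v w) = tens_act V1 W1 k (g v) (h w)"
    if "v \<in> carrier V" "w \<in> carrier W" for k v w
    unfolding klinear_tens_act[OF V W that tm(2)[OF that]]
    by (simp add: tm(1) that act_in V W hom_act[OF g] hom_act[OF h] tens_act_def)
  have t: "tmap V W V1 W1 g h (tens_t H V W v w) = tens_t H V1 W1 (g v) (h w)"
    if "v \<in> carrier V" "w \<in> carrier W" for v w
    using tens_act[OF that] by (simp add: tens_t_eq)
  then show "v \<in> carrier V \<Longrightarrow> w \<in> carrier W \<Longrightarrow>
      tmap V W V1 W1 g h (tens_t H V W v w) = tens_t H V1 W1 (g v) (h w)" .
  have kl: "klinear (tensor V W) (whole tscl) (tmap V W V1 W1 g h)"
    \<comment> \<open>The memberships assumed in \<open>tmap_tens\<close> are discharged at 0, which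
      lies in every subspace.\<close>
    by (rule tmap_tens(2)[OF module_kspace[OF V] module_kspace[OF W] gl hl, of 0 0])
      (use module_kspace[OF V] module_kspace[OF W] in \<open>auto simp: kspace_def module.subspace_0 vector_space_def module_def\<close>)
  have kl': "klinear (tprod H V W) (tprod H V1 W1) (tmap V W V1 W1 g h)"
  proof (rule klinear_into)
    show "klinear (tprod H V W) (whole (scl (tprod H V1 W1))) (tmap V W V1 W1 g h)"
      using klinear_sub[OF kl tprod_sub[OF V W]] by simp
    fix x assume x: "x \<in> carrier (tprod H V W)"
    have xt: "x \<in> carrier (tensor V W)" using x tprod_sub[OF V W] by auto
    have "tmap V W V1 W1 g h x = contract V W (\<lambda>v w. tmap V W V1 W1 g h (tens_t H V W v w)) x"
      using klinear_contract_elem[OF kl kspace_tensor[OF module_kspace[OF V]] xt, of "tens_t H V W"]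
        tprod_expand[OF V W x] tens_t_in[OF V W] tprod_sub[OF V W] by auto
    also have "\<dots> \<in> carrier (tprod H V1 W1)"
      by (rule contract_in[OF kspace_tprod[OF V1 W1] xt])
        (auto simp: t intro!: tens_t_in V1 W1 klinear_in[OF gl] klinear_in[OF hl])
    finally show "tmap V W V1 W1 g h x \<in> carrier (tprod H V1 W1)" .
  qed
  show "hmod_hom H (tprod H V W) (tprod H V1 W1) (tmap V W V1 W1 g h)"
    by (rule hom_tens_tI[OF V W tprod_module[OF V1 W1] kl'])
      (simp add: t act_in V W hom_act[OF g] hom_act[OF h] act_tens_t(1) V1 W1 klinear_in[OF gl] klinear_in[OF hl])
qed

lemma id_hom: "hmod_hom H V V id"
  by (simp add: hmod_hom_def klinear_def)

lemma tprod_mem: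
  assumes V: "left_module H V" and W: "left_module H W" and Y: "kspace Y"
    and F: "klinear (tprod H V W) (whole t) F"
    and m: "\<And>v w. v \<in> carrier V \<Longrightarrow> w \<in> carrier W \<Longrightarrow> F (tens_t H V W v w) \<in> carrier Y"
    and x: "x \<in> carrier (tprod H V W)"
  shows "F x \<in> carrier Y"
proof -
  have xt: "x \<in> carrier (tensor V W)" using x tprod_sub[OF V W] by auto
  have "F x = contract V W (\<lambda>v w. F (tens_t H V W v w)) x"
    using klinear_contract_elem[OF F kspace_tprod[OF V W] xt, of "tens_t H V W"] tprod_expand[OF V W x]
      tens_t_in[OF V W] by simp
  then show ?thesis using contract_in[OF Y xt m] by simp
qed

lemma klinear_tens_t:
  assumes "left_module H V" "left_module H W"
  shows "w \<in> carrier W \<Longrightarrow> klinear V (tprod H V W) (\<lambda>v. tens_t H V W v w)"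
    and "v \<in> carrier V \<Longrightarrow> klinear W (tprod H V W) (tens_t H V W v)"
  using kbilinear_tens_t[OF assms] by (simp_all add: kbilinear_def)

section \<open>Threefold products and associators\<close>

lemma tprod3_ext_left:
  assumes U: "left_module H U" and V: "left_module H V" and W: "left_module H W"
    and F: "klinear (tprod H (tprod H U V) W) X F" and G: "klinear (tprod H (tprod H U V) W) X' G"
    and eq: "\<And>u v w. u \<in> carrier U \<Longrightarrow> v \<in> carrier V \<Longrightarrow> w \<in> carrier W \<Longrightarrow>
      F (tens_t H (tprod H U V) W (tens_t H U V u v) w) = G (tens_t H (tprod H U V) W (tens_t H U V u v) w)"
    and x: "x \<in> carrier (tprod H (tprod H U V) W)"
  shows "F x = G x"
proof (rule tprod_ext[OF tprod_module[OF U V] W F G _ x])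
  fix p w assume p: "p \<in> carrier (tprod H U V)" and w: "w \<in> carrier W"
  note t = klinear_tens_t(1)[OF tprod_module[OF U V] W w]
  show "F (tens_t H (tprod H U V) W p w) = G (tens_t H (tprod H U V) W p w)"
    by (rule tprod_ext[OF U V klinear_comp[OF t F] klinear_comp[OF t G] eq[OF _ _ w] p])
qed

lemma tprod3_ext_right:
  assumes U: "left_module H U" and V: "left_module H V" and W: "left_module H W"
    and F: "klinear (tprod H U (tprod H V W)) X F" and G: "klinear (tprod H U (tprod H V W)) X' G"
    and eq: "\<And>u v w. u \<in> carrier U \<Longrightarrow> v \<in> carrier V \<Longrightarrow> w \<in> carrier W \<Longrightarrow>
      F (tens_t H U (tprod H V W) u (tens_t H V W v w)) = G (tens_t H U (tprod H V W) u (tens_t H V W v w))"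
    and x: "x \<in> carrier (tprod H U (tprod H V W))"
  shows "F x = G x"
proof (rule tprod_ext[OF U tprod_module[OF V W] F G _ x])
  fix u p assume u: "u \<in> carrier U" and p: "p \<in> carrier (tprod H V W)"
  note t = klinear_tens_t(2)[OF U tprod_module[OF V W] u]
  show "F (tens_t H U (tprod H V W) u p) = G (tens_t H U (tprod H V W) u p)"
    by (rule tprod_ext[OF V W klinear_comp[OF t F] klinear_comp[OF t G] eq[OF u] p])
qed

lemma tens_tprod [simp]: "tens (tprod H U V) W = tens (tensor U V) W" "tens Z (tprod H U V) = tens Z (tensor U V)"
  by (intro tens_cong_scl; simp)+

lemma tens_act_left:
  assumes "left_module H U" "left_module H V" "left_module H W"
    and "u \<in> carrier U" "v \<in> carrier V" "w \<in> carrier W"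
  shows "tens_act (tprod H U V) W h (tens_t H U V u v) w
    = D h (\<lambda>a b. D a (\<lambda>c d. tens (tensor U V) W (tens U V (act U c u) (act V d v)) (act W b w)))"
  unfolding tens_act_def[of "tprod H U V"]
  by (simp add: act_tens_t(2) assms) (simp add: tens_act_def klin_contract[OF klin_tens1_tensor[OF klin_id[OF vs_tscl]]])

lemma tens_act_right:
  assumes "left_module H U" "left_module H V" "left_module H W"
    and "u \<in> carrier U" "v \<in> carrier V" "w \<in> carrier W"
  shows "tens_act U (tprod H V W) h u (tens_t H V W v w)
    = D h (\<lambda>a b. D b (\<lambda>c d. tens U (tensor V W) (act U a u) (tens V W (act V c v) (act W d w))))"
  unfolding tens_act_def[of U "tprod H V W"]
  by (simp add: act_tens_t(2) assms) (simp add: tens_act_def klin_contract[OF klin_tens2_tensor[OF klin_id[OF vs_tscl]]])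

lemma tprod_carrier_sub_left:
  assumes U: "left_module H U" and V: "left_module H V" and W: "left_module H W"
  shows "carrier (tprod H (tprod H U V) W) \<subseteq> carrier (tensor (tensor U V) W)"
  using tprod_sub[OF tprod_module[OF U V] W]
    tensor_mono[of "tprod H U V" "tensor U V" W W] tprod_sub[OF U V] by auto

lemma tprod_carrier_sub_right:
  assumes U: "left_module H U" and V: "left_module H V" and W: "left_module H W"
  shows "carrier (tprod H U (tprod H V W)) \<subseteq> carrier (tensor U (tensor V W))"
  using tprod_sub[OF U tprod_module[OF V W]]
    tensor_mono[of U U "tprod H V W" "tensor V W"] tprod_sub[OF V W] by auto

text \<open>Once both sides are expanded into ambient tensors this is coassociativity for h. The
  case h = 1 gives the value of the associator on generators, general h its H-linearity.\<close>

lemma tassoc_tens_act: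
  assumes U: "left_module H U" and V: "left_module H V" and W: "left_module H W"
    and u: "u \<in> carrier U" and v: "v \<in> carrier V" and w: "w \<in> carrier W"
  shows "tassoc U V W (tens_act (tprod H U V) W h (tens_t H U V u v) w) = tens_act U (tprod H V W) h u (tens_t H V W v w)"
proof -
  note ks = module_kspace[OF U] module_kspace[OF V] module_kspace[OF W]
  note ta = klinear_tassoc[OF ks]
  have "tassoc U V W (tens_act (tprod H U V) W h (tens_t H U V u v) w)
    = D h (\<lambda>a b. tassoc U V W (tens (tensor U V) W (tens_act U V a u v) (act W b w)))"
    unfolding tens_act_def[of "tprod H U V"] act_tprod act_tens_t(2)[OF U V u v] tens_tprod
    by (rule klinear_contract_elem[OF ta(1)])
      (auto intro!: kspace_tensor ks tens_in tens_act_in U V u v act_in[OF W w])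
  also have "\<dots> = D h (\<lambda>a b. D a (\<lambda>c d. tens U (tensor V W) (act U c u) (tens V W (act V d v) (act W b w))))"
  proof (rule contract_cong)
    fix a b
    note [lin] = klin_tens1[of _ U] klin_tens1[of _ V]
    have bil: "bil (scl U) (scl V) tscl (\<lambda>x y. tens U (tensor V W) x (tens V W y (act W b w)))"
      by (rule lin ks[THEN kspace_vs])+
    show "tassoc U V W (tens (tensor U V) W (tens_act U V a u v) (act W b w))
      = D a (\<lambda>c d. tens U (tensor V W) (act U c u) (tens V W (act V d v) (act W b w)))"
      by (simp add: ta(2) tens_act_in[OF U V u v] act_in[OF W w] klinear_tens_act[OF U V u v klinear_contract_bil[OF ks(1,2) bil]]
          contract_tens_bil[OF ks(1,2) bil] act_in[OF U u] act_in[OF V v])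
  qed
  also have "\<dots> = D h (\<lambda>a b. D b (\<lambda>c d. tens U (tensor V W) (act U a u) (tens V W (act V c v) (act W d w))))"
    by (rule coassoc) (rule lin modlin U V W u v w)+
  finally show ?thesis by (simp add: tens_act_right[OF U V W u v w])
qed

lemma tassoc_inv_tens_act:
  assumes U: "left_module H U" and V: "left_module H V" and W: "left_module H W"
    and u: "u \<in> carrier U" and v: "v \<in> carrier V" and w: "w \<in> carrier W"
  shows "tassoc_inv U V W (tens_act U (tprod H V W) h u (tens_t H V W v w)) = tens_act (tprod H U V) W h (tens_t H U V u v) w"
proof -
  note ks = module_kspace[OF U] module_kspace[OF V] module_kspace[OF W]
  note ta = klinear_tassoc_inv[OF ks]
  have "tassoc_inv U V W (tens_act U (tprod H V W) h u (tens_t H V W v w))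
    = D h (\<lambda>a b. tassoc_inv U V W (tens U (tensor V W) (act U a u) (tens_act V W b v w)))"
    unfolding tens_act_def[of U "tprod H V W"] act_tprod act_tens_t(2)[OF V W v w] tens_tprod
    by (rule klinear_contract_elem[OF ta(1)])
      (auto intro!: kspace_tensor ks tens_in tens_act_in V W v w act_in[OF U u])
  also have "\<dots> = D h (\<lambda>a b. D b (\<lambda>c d. tens (tensor U V) W (tens U V (act U a u) (act V c v)) (act W d w)))"
  proof (rule contract_cong)
    fix a b
    note [lin] = klin_tens2[of _ V] klin_tens2[of _ W]
    have bil: "bil (scl V) (scl W) tscl (\<lambda>x y. tens (tensor U V) W (tens U V (act U a u) x) y)"
      by (rule lin ks[THEN kspace_vs])+
    show "tassoc_inv U V W (tens U (tensor V W) (act U a u) (tens_act V W b v w))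
      = D b (\<lambda>c d. tens (tensor U V) W (tens U V (act U a u) (act V c v)) (act W d w))"
      by (simp add: ta(2) tens_act_in[OF V W v w] act_in[OF U u] klinear_tens_act[OF V W v w klinear_contract_bil[OF ks(2,3) bil]]
          contract_tens_bil[OF ks(2,3) bil] act_in[OF V v] act_in[OF W w])
  qed
  also have "\<dots> = D h (\<lambda>a b. D a (\<lambda>c d. tens (tensor U V) W (tens U V (act U c u) (act V d v)) (act W b w)))"
    by (rule coassoc[symmetric]) (rule lin modlin U V W u v w)+
  finally show ?thesis by (simp add: tens_act_left[OF U V W u v w])
qed

lemma tassoc_hom:
  assumes U: "left_module H U" and V: "left_module H V" and W: "left_module H W"
  shows "hmod_hom H (tprod H (tprod H U V) W) (tprod H U (tprod H V W)) (tassoc U V W)" (is "hmod_hom H ?A ?B ?F")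
    and "u \<in> carrier U \<Longrightarrow> v \<in> carrier V \<Longrightarrow> w \<in> carrier W \<Longrightarrow>
      tassoc U V W (tens_t H (tprod H U V) W (tens_t H U V u v) w) = tens_t H U (tprod H V W) u (tens_t H V W v w)"
proof -
  note UV = tprod_module[OF U V] and VW = tprod_module[OF V W]
  have t: "?F (tens_t H (tprod H U V) W (tens_t H U V u v) w) = tens_t H U (tprod H V W) u (tens_t H V W v w)"
    if "u \<in> carrier U" "v \<in> carrier V" "w \<in> carrier W" for u v w
    using tassoc_tens_act[OF U V W that, of 1] by (simp add: tens_t_eq)
  then show "u \<in> carrier U \<Longrightarrow> v \<in> carrier V \<Longrightarrow> w \<in> carrier W \<Longrightarrow>
      tassoc U V W (tens_t H (tprod H U V) W (tens_t H U V u v) w) = tens_t H U (tprod H V W) u (tens_t H V W v w)" .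
  have k: "klinear ?A (whole tscl) ?F"
    by (rule klinear_sub[OF klinear_tassoc(1)[OF module_kspace[OF U] module_kspace[OF V] module_kspace[OF W]] tprod_carrier_sub_left[OF U V W]]) simp
  have m: "?F (tens_t H (tprod H U V) W p w) \<in> carrier ?B" if p: "p \<in> carrier (tprod H U V)" and w: "w \<in> carrier W" for p w
    by (rule tprod_mem[OF U V kspace_tprod[OF U VW] klinear_comp[OF klinear_tens_t(1)[OF UV W w] k] _ p])
      (simp add: t w tens_t_in U V W UV VW)
  have kl: "klinear ?A ?B ?F"
    by (rule klinear_into) (use k tprod_mem[OF UV W kspace_tprod[OF U VW] k m] in simp_all)
  show "hmod_hom H ?A ?B ?F"
    unfolding hmod_hom_def
  proof (intro conjI kl allI ballI)
    fix h x assume x: "x \<in> carrier ?A"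
    show "?F (act ?A h x) = act ?B h (?F x)"
      by (rule tprod3_ext_left[OF U V W klinear_comp[OF klinear_act[OF tprod_module[OF UV W]] kl]
            klinear_comp[OF kl klinear_act[OF tprod_module[OF U VW]]] _ x])
        (simp add: t act_tens_t(2)[OF UV W] act_tens_t(2)[OF U VW] tens_t_in U V W tassoc_tens_act)
  qed
qed

lemma tassoc_inv_hom:
  assumes U: "left_module H U" and V: "left_module H V" and W: "left_module H W"
  shows "hmod_hom H (tprod H U (tprod H V W)) (tprod H (tprod H U V) W) (tassoc_inv U V W)" (is "hmod_hom H ?A ?B ?F")
    and "u \<in> carrier U \<Longrightarrow> v \<in> carrier V \<Longrightarrow> w \<in> carrier W \<Longrightarrow>
      tassoc_inv U V W (tens_t H U (tprod H V W) u (tens_t H V W v w)) = tens_t H (tprod H U V) W (tens_t H U V u v) w"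
proof -
  note UV = tprod_module[OF U V] and VW = tprod_module[OF V W]
  have t: "?F (tens_t H U (tprod H V W) u (tens_t H V W v w)) = tens_t H (tprod H U V) W (tens_t H U V u v) w"
    if "u \<in> carrier U" "v \<in> carrier V" "w \<in> carrier W" for u v w
    using tassoc_inv_tens_act[OF U V W that, of 1] by (simp add: tens_t_eq)
  then show "u \<in> carrier U \<Longrightarrow> v \<in> carrier V \<Longrightarrow> w \<in> carrier W \<Longrightarrow>
      tassoc_inv U V W (tens_t H U (tprod H V W) u (tens_t H V W v w)) = tens_t H (tprod H U V) W (tens_t H U V u v) w" .
  have k: "klinear ?A (whole tscl) ?F"
    by (rule klinear_sub[OF klinear_tassoc_inv(1)[OF module_kspace[OF U] module_kspace[OF V] module_kspace[OF W]] tprod_carrier_sub_right[OF U V W]]) simp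
  have m: "?F (tens_t H U (tprod H V W) u p) \<in> carrier ?B" if u: "u \<in> carrier U" and p: "p \<in> carrier (tprod H V W)" for u p
    by (rule tprod_mem[OF V W kspace_tprod[OF UV W] klinear_comp[OF klinear_tens_t(2)[OF U VW u] k] _ p])
      (simp add: t u tens_t_in U V W UV VW)
  have kl: "klinear ?A ?B ?F"
    by (rule klinear_into) (use k tprod_mem[OF U VW kspace_tprod[OF UV W] k m] in simp_all)
  show "hmod_hom H ?A ?B ?F"
    unfolding hmod_hom_def
  proof (intro conjI kl allI ballI)
    fix h x assume x: "x \<in> carrier ?A"
    show "?F (act ?A h x) = act ?B h (?F x)"
      by (rule tprod3_ext_right[OF U V W klinear_comp[OF klinear_act[OF tprod_module[OF U VW]] kl]
            klinear_comp[OF kl klinear_act[OF tprod_module[OF UV W]]] _ x])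
        (simp add: t act_tens_t(2)[OF UV W] act_tens_t(2)[OF U VW] tens_t_in U V W tassoc_inv_tens_act)
  qed
qed

section \<open>The unit object and the unit constraints\<close>

lemma carrier_unit_obj [simp]: "carrier (unit_obj H) = Ht" and scl_unit_obj [simp]: "scl (unit_obj H) = sc"
  and act_unit_obj [simp]: "act (unit_obj H) h z = et (h * z)"
  by (auto simp: unit_obj_def Ht_def intro: range_eqI[OF sym])

lemma et_add: "et (x + y) = et x + et y" and et_sc: "et (sc c x) = sc c (et x)"
  by (rule klin_add[OF lin_et[OF klin_id[OF vs]]], rule klin_scale[OF lin_et[OF klin_id[OF vs]]])

lemma unit_obj_module: "left_module H (unit_obj H)"
  unfolding left_module_def
proof (intro conjI allI ballI)
  have "et 0 = 0" by (rule klin_0[OF lin_et[OF klin_id[OF vs]]])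
  then show "kspace (unit_obj H)"
    using vs by (auto simp: kspace_def module.subspace_def vector_space_def module_def Ht_def et_add et_sc)
  show "kbilinear H (unit_obj H) (unit_obj H) (act (unit_obj H))"
    by (auto simp: kbilinear_def klinear_def et_add et_sc algebra_simps sc_mult[symmetric])
  show "act (unit_obj H) 1 z = z" if "z \<in> carrier (unit_obj H)" for z
    using that by (simp add: Ht_def)
  show "act (unit_obj H) (g * h) z = act (unit_obj H) g (act (unit_obj H) h z)" for g h z
    by (simp add: et_mult_et mult.assoc)
qed

lemma et_Hs_Ht: "y \<in> Hs \<Longrightarrow> z \<in> Ht \<Longrightarrow> et (y * z) = z * S y"
  by (simp add: Hs_Ht_commute[of y z] et_Ht_mult S_Hs)

lemma kbilinear_act_unit:
  assumes V: "left_module H V"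
  shows "kbilinear (unit_obj H) V V (act V)"
  using V by (auto simp: left_module_def kbilinear_def klinear_def)

text \<open>For 1_1 in H_s one has et(1_1 z) = z S(1_1), and S(1_1) 1_2 = es(1) = 1.\<close>

lemma lunit_bal:
  assumes V: "left_module H V" and z: "z \<in> Ht" and v: "v \<in> carrier V"
  shows "D 1 (\<lambda>a b. act V (act (unit_obj H) a z) (act V b v)) = act V z v"
proof -
  have "D 1 (\<lambda>a b. act V (act (unit_obj H) a z) (act V b v)) = D 1 (\<lambda>a b. act V (et (a * z) * b) v)"
    by (simp add: act_mult[OF V v])
  also have "\<dots> = act V (D 1 (\<lambda>a b. et (a * z) * b)) v"
    by (rule klin_contract[OF lin_act[OF klin_id[OF vs] V v], symmetric])
  also have "D 1 (\<lambda>a b. et (a * z) * b) = D 1 (\<lambda>a b. z * (S a * b))"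
    by (rule one_es_et; ((rule lin)+ | simp add: et_Hs_Ht z mult.assoc))
  also have "\<dots> = z" by (simp add: contract_mult_left[symmetric] S_id)
  finally show ?thesis .
qed

lemma lunit:
  assumes V: "left_module H V"
  shows "klinear (tprod H (unit_obj H) V) V (lunit H V)"
    and "z \<in> Ht \<Longrightarrow> v \<in> carrier V \<Longrightarrow> lunit H V (tens_t H (unit_obj H) V z v) = act V z v"
    and "x \<in> carrier (tprod H (unit_obj H) V) \<Longrightarrow> lunit H V x = contract (unit_obj H) V (act V) x"
  unfolding lunit_def
  using contract_t_tens_t[OF unit_obj_module V module_kspace[OF V] kbilinear_act_unit[OF V] lunit_bal[OF V]]
    contract_t_eq[OF unit_obj_module V module_kspace[OF V] kbilinear_act_unit[OF V] lunit_bal[OF V]]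
  by simp_all

abbreviation "iS \<equiv> inv S"

lemma iS_S [simp]: "iS (S x) = x" and S_iS [simp]: "S (iS x) = x"
  using bij_S by (simp_all add: bij_def inv_f_f surj_f_inv_f)

lemma iS_Ht [simp]: "z \<in> Ht \<Longrightarrow> iS z \<in> Hs"
  using Ht_S_Hs by force

lemma lin_iS [lin]: "klin s sc g \<Longrightarrow> klin s sc (\<lambda>x. iS (g x))"
proof -
  assume g: "klin s sc g"
  have "iS (x + y) = iS x + iS y" for x y
    by (rule S_inj) (simp add: klin_add[OF lin_S[OF klin_id[OF vs]]])
  moreover have "iS (sc c x) = sc c (iS x)" for c x
    by (rule S_inj) simp
  ultimately have "klin sc sc iS" using vs by (simp add: Vector_Spaces.linear_iff)
  then show ?thesis by (rule klin_comp[OF _ g])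
qed

lemma kbilinear_runit:
  assumes V: "left_module H V"
  shows "kbilinear V (unit_obj H) V (\<lambda>v z. act V (iS z) v)"
proof -
  have "iS (x + y) = iS x + iS y" "iS (sc c x) = sc c (iS x)" for x y c
    using klin_add[OF lin_iS[OF klin_id[OF vs]]] klin_scale[OF lin_iS[OF klin_id[OF vs]]] by auto
  then show ?thesis using V by (auto simp: left_module_def kbilinear_def klinear_def)
qed

text \<open>Write z = S(y). After the flip of \<Delta>(1), the inverse antipode meets S(1_1) S(y) =
  S(y 1_1), which leaves y 1_1 S(1_2) = y.\<close>

lemma runit_bal:
  assumes V: "left_module H V" and v: "v \<in> carrier V" and z: "z \<in> Ht"
  shows "D 1 (\<lambda>a b. act V (iS (act (unit_obj H) b z)) (act V a v)) = act V (iS z) v"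
proof -
  obtain y where y: "y \<in> Hs" "z = S y" using Ht_S_Hs[OF z] by blast
  have "D 1 (\<lambda>a b. act V (iS (act (unit_obj H) b z)) (act V a v)) = D 1 (\<lambda>a b. act V (iS (et (b * z)) * a) v)"
    by (simp add: act_mult[OF V v])
  also have "\<dots> = act V (D 1 (\<lambda>a b. iS (et (b * z)) * a)) v"
    by (rule klin_contract[OF lin_act[OF klin_id[OF vs] V v], symmetric])
  also have "D 1 (\<lambda>a b. iS (et (b * z)) * a) = D 1 (\<lambda>a b. iS (b * z) * a)"
    by (rule one_es_et; ((rule lin)+ | use z in \<open>simp add: et_Ht_mult Ht_def\<close>))
  also have "\<dots> = D 1 (\<lambda>a b. iS (S a * z) * S b)"
    by (rule one_flip[symmetric, where \<phi> = "\<lambda>a b. iS (a * z) * b"]; (rule lin)+)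
  also have "\<dots> = D 1 (\<lambda>a b. y * (a * S b))"
    by (simp add: y S_mult[symmetric] mult.assoc)
  also have "\<dots> = iS z" by (simp add: contract_mult_left[symmetric] id_S y)
  finally show ?thesis .
qed

lemma runit:
  assumes V: "left_module H V"
  shows "klinear (tprod H V (unit_obj H)) V (runit H V)"
    and "v \<in> carrier V \<Longrightarrow> z \<in> Ht \<Longrightarrow> runit H V (tens_t H V (unit_obj H) v z) = act V (iS z) v"
    and "x \<in> carrier (tprod H V (unit_obj H)) \<Longrightarrow>
      runit H V x = contract V (unit_obj H) (\<lambda>v z. act V (iS z) v) x"
proof -
  have bal: "D 1 (\<lambda>a b. act V (iS (act (unit_obj H) b z)) (act V a v)) = act V (iS z) v"
    if "v \<in> carrier V" "z \<in> carrier (unit_obj H)" for v z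
    using that by (intro runit_bal[OF V]) simp_all
  note * = V unit_obj_module module_kspace[OF V] kbilinear_runit[OF V] bal
  show "klinear (tprod H V (unit_obj H)) V (runit H V)"
    unfolding runit_def by (rule contract_t_tens_t(1)[OF *])
  show "v \<in> carrier V \<Longrightarrow> z \<in> Ht \<Longrightarrow> runit H V (tens_t H V (unit_obj H) v z) = act V (iS z) v"
    unfolding runit_def by (rule contract_t_tens_t(2)[OF *]) simp_all
  show "x \<in> carrier (tprod H V (unit_obj H)) \<Longrightarrow>
      runit H V x = contract V (unit_obj H) (\<lambda>v z. act V (iS z) v) x"
    unfolding runit_def by (rule contract_t_eq[OF *])
qed

end

section \<open>R-matrices\<close>

locale qtriangular = qgroupoid H for H :: "('k::field, 'h::{ring,monoid_mult}) qgroupoid" +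
  fixes R :: "('h, 'h, 'k) tensor"
  assumes quasitriangular_H: "quasitriangular_quantum_groupoid H R"
begin

section \<open>The axioms for R in Sweedler form\<close>

abbreviation RR :: "('h \<Rightarrow> 'h \<Rightarrow> 'u::ab_group_add) \<Rightarrow> 'u" where
  "RR \<phi> \<equiv> contract H H \<phi> R"

lemma comul_cop_in: "comul_cop H h \<in> carrier (tensor H H)"
  unfolding comul_cop_def tflip_def by (rule contract_in_H2) auto

lemma contract_comul_cop: "bil sc sc t \<phi> \<Longrightarrow> contract H H \<phi> (comul_cop H h) = D h (\<lambda>a b. \<phi> b a)"
  unfolding comul_cop_def tflip_def by (simp add: contract_contract_H contract_tens_H)

lemma R_form: "\<exists>x\<in>carrier (tensor H H). R = mult2 H (mult2 H (comul_cop H 1) x) (comul H 1)"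
  using quasitriangular_H by (simp add: quasitriangular_quantum_groupoid_def)

lemma R_in [simp]: "R \<in> carrier (tensor H H)"
  using R_form by (auto intro!: mult2_in comul_cop_in)

text \<open>R ends in a factor \<Delta>(1), which is idempotent; likewise it begins with the flipped
  \<Delta>(1). These two absorptions stand in for counitality of the unit.\<close>

lemma R_one:
  assumes \<phi>: "bil sc sc t \<phi>"
  shows "RR (\<lambda>a b. D 1 (\<lambda>c d. \<phi> (a * c) (b * d))) = RR \<phi>"
proof -
  note [lin] = bilD[OF \<phi>]
  obtain x where x: "x \<in> carrier (tensor H H)" and R: "R = mult2 H (mult2 H (comul_cop H 1) x) (comul H 1)"
    using R_form by blast
  let ?X = "mult2 H (comul_cop H 1) x"
  have X: "?X \<in> carrier (tensor H H)" by (intro mult2_in comul_cop_in x)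
  have "RR (\<lambda>a b. D 1 (\<lambda>c d. \<phi> (a * c) (b * d)))
      = contract H H (\<lambda>a b. D 1 (\<lambda>e g. D 1 (\<lambda>c d. \<phi> (a * e * c) (b * g * d)))) ?X"
    unfolding R by (rule contract_mult2[OF _ X comul_in]; (rule lin)+)
  also have "\<dots> = contract H H (\<lambda>a b. D 1 (\<lambda>c d. \<phi> (a * c) (b * d))) ?X"
    unfolding mult.assoc by (rule contract_cong, rule comul_one; (rule lin)+)
  also have "\<dots> = RR \<phi>"
    unfolding R by (rule contract_mult2[OF _ X comul_in, symmetric]; (rule lin)+)
  finally show ?thesis .
qed

lemma one_R:
  assumes \<phi>: "bil sc sc t \<phi>"
  shows "RR (\<lambda>a b. D 1 (\<lambda>c d. \<phi> (d * a) (c * b))) = RR \<phi>"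
proof -
  note [lin] = bilD[OF \<phi>]
  obtain x where x: "x \<in> carrier (tensor H H)" and R: "R = mult2 H (mult2 H (comul_cop H 1) x) (comul H 1)"
    using R_form by blast
  have X: "mult2 H (comul_cop H 1) x \<in> carrier (tensor H H)" by (intro mult2_in comul_cop_in x)
  have R': "RR \<psi> = D 1 (\<lambda>a b. contract H H (\<lambda>p q. D 1 (\<lambda>e g. \<psi> (b * p * e) (a * q * g))) x)"
    if \<psi>: "bil sc sc t \<psi>" for \<psi>
  proof -
    note [lin] = bilD[OF \<psi>]
    have "RR \<psi> = contract H H (\<lambda>a b. D 1 (\<lambda>e g. \<psi> (a * e) (b * g))) (mult2 H (comul_cop H 1) x)"
      unfolding R by (rule contract_mult2[OF \<psi> X comul_in])
    also have "\<dots> = contract H H (\<lambda>a b. contract H H (\<lambda>p q. D 1 (\<lambda>e g. \<psi> (a * p * e) (b * q * g))) x) (comul_cop H 1)"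
      by (rule contract_mult2[OF _ comul_cop_in x]; (rule lin)+)
    also have "\<dots> = D 1 (\<lambda>a b. contract H H (\<lambda>p q. D 1 (\<lambda>e g. \<psi> (b * p * e) (a * q * g))) x)"
      by (rule contract_comul_cop; (rule lin)+)
    finally show ?thesis .
  qed
  have "RR (\<lambda>a b. D 1 (\<lambda>c d. \<phi> (d * a) (c * b))) =
    D 1 (\<lambda>a b. contract H H (\<lambda>p q. D 1 (\<lambda>e g. D 1 (\<lambda>c d. \<phi> (d * (b * p * e)) (c * (a * q * g))))) x)"
    by (rule R'; (rule lin)+)
  also have "\<dots> = D 1 (\<lambda>c d. D 1 (\<lambda>a b. contract H H (\<lambda>p q. D 1 (\<lambda>e g. \<phi> (d * b * p * e) (c * a * q * g))) x))"
    by (subst (4) contract_swap, subst (3) contract_swap, subst contract_swap) (simp add: mult.assoc)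
  also have "\<dots> = D 1 (\<lambda>a b. contract H H (\<lambda>p q. D 1 (\<lambda>e g. \<phi> (b * p * e) (a * q * g))) x)"
    by (rule one_comul; (rule lin)+)
  also have "\<dots> = RR \<phi>"
    by (rule R'[OF \<phi>, symmetric])
  finally show ?thesis .
qed

lemma klinear_mult2_left: "klinear (tensor H H) (whole tscl) (\<lambda>p. mult2 H p q)"
  unfolding mult2_eq by (rule klinear_contract_bil; (simp | (rule lin)+))

lemma klinear_mult2_right: "klinear (tensor H H) (whole tscl) (mult2 H p)"
  unfolding mult2_eq by (subst contract_swap, rule klinear_contract_bil; (simp | (rule lin)+))

lemma mult3_contract:
  assumes q: "\<And>c d. q c d \<in> carrier (tensor H H)" and p: "\<And>a b. p a b \<in> carrier (tensor H H)"
    and u: "u \<in> carrier (tensor H H)" and v: "v \<in> carrier (tensor H H)"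
  shows "mult3 H (contract H H (\<lambda>a b. tens H (tensor H H) (f a b) (p a b)) u)
      (contract H H (\<lambda>c d. tens H (tensor H H) (g c d) (q c d)) v)
    = contract H H (\<lambda>a b. contract H H (\<lambda>c d. tens H (tensor H H) (f a b * g c d) (mult2 H (p a b) (q c d))) v) u"
proof -
  have kt: "kspace (tensor H H)" by (intro kspace_tensor ks)
  have w: "kspace (whole tscl)" by (intro kspace_whole vs_tscl)
  let ?H3 = "tensor H (tensor H H)"
  let ?y = "contract H H (\<lambda>c d. tens H (tensor H H) (g c d) (q c d)) v"
  have y: "?y \<in> carrier ?H3" by (intro contract_in_H3 v tens_in q) simp
  have k2: "kbilinear H (tensor H H) (whole tscl) (\<lambda>c d. tens H (tensor H H) (a * c) (mult2 H b d))" for a b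
    unfolding kbilinear_def
    by (intro conjI ballI klinear_tens2 klinear_mult2_right klinear_of_klin; (rule lin)+)
  have k1: "kbilinear H (tensor H H) (whole tscl)
     (\<lambda>a b. contract H (tensor H H) (\<lambda>c d. tens H (tensor H H) (a * c) (mult2 H b d)) y)" for y
    unfolding kbilinear_def
    by (intro conjI ballI klinear_contract_fun klinear_tens2 klinear_mult2_left vs_tscl klinear_of_klin; (rule lin)+)
  have "mult3 H (contract H H (\<lambda>a b. tens H (tensor H H) (f a b) (p a b)) u) ?y
      = contract H H (\<lambda>a b. mult3 H (tens H (tensor H H) (f a b) (p a b)) ?y) u"
    unfolding mult3_def tmult_def
    by (rule klinear_contract_elem[OF klinear_contract[OF ks kt w k1]]) (auto intro!: tens_in kspace_tensor u p)
  also have "\<dots> = contract H H (\<lambda>a b. contract H (tensor H H) (\<lambda>c d. tens H (tensor H H) (f a b * c) (mult2 H (p a b) d)) ?y) u"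
    unfolding mult3_def tmult_def
    by (rule contract_cong, rule contract_tens[OF ks kt w k1]) (auto intro: p)
  also have "\<dots> = contract H H (\<lambda>a b. contract H H (\<lambda>c d. contract H (tensor H H)
       (\<lambda>c d. tens H (tensor H H) (f a b * c) (mult2 H (p a b) d)) (tens H (tensor H H) (g c d) (q c d))) v) u"
    by (rule contract_cong, rule klinear_contract_elem[OF klinear_contract[OF ks kt w k2]])
      (auto intro!: tens_in kspace_tensor v q)
  also have "\<dots> = contract H H (\<lambda>a b. contract H H (\<lambda>c d. tens H (tensor H H) (f a b * g c d) (mult2 H (p a b) (q c d))) v) u"
    by (rule contract_cong, rule contract_cong, rule contract_tens[OF ks kt w k2]) (auto intro: q)
  finally show ?thesis .
qed

lemma mult2_tens: "mult2 H (tens H H a b) (tens H H c d) = tens H H (a * c) (b * d)"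
proof -
  have "mult2 H (tens H H a b) (tens H H c d) = contract H H (\<lambda>c d. tens H H (a * c) (b * d)) (tens H H c d)"
    unfolding mult2_eq by (rule contract_tens_H; (rule lin)+)
  also have "\<dots> = tens H H (a * c) (b * d)"
    by (rule contract_tens_H; (rule lin)+)
  finally show ?thesis .
qed

lemma R_hexagon1:
  assumes T: "tri sc sc sc t T"
  shows "RR (\<lambda>a b. D b (\<lambda>c d. T a c d)) = RR (\<lambda>a b. RR (\<lambda>c d. T (a * c) d b))"
proof -
  have "tmap H H H (tensor H H) id (comul H) R
      = mult3 H (RR (\<lambda>a b. tens H (tensor H H) a (tens H H 1 b))) (RR (\<lambda>a b. tens H (tensor H H) a (tens H H b 1)))"
    using quasitriangular_H by (simp add: quasitriangular_quantum_groupoid_def Let_def)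
  also have "\<dots> = RR (\<lambda>a b. RR (\<lambda>c d. tens H (tensor H H) (a * c) (tens H H d b)))"
    by (subst mult3_contract) (simp_all add: mult2_tens)
  finally have "contract3 T (tmap H H H (tensor H H) id (comul H) R)
      = contract3 T (RR (\<lambda>a b. RR (\<lambda>c d. tens H (tensor H H) (a * c) (tens H H d b))))" by simp
  then show ?thesis
    by (simp add: contract3_tmap[OF T] contract3_contract[OF T] contract3_tens[OF T] contract_in_H3 contract_tens_H[OF tri_bil[OF T]])
qed

lemma R_hexagon2:
  assumes T: "tri sc sc sc t T"
  shows "RR (\<lambda>a b. D a (\<lambda>c d. T c d b)) = RR (\<lambda>a b. RR (\<lambda>c d. T a c (b * d)))"
proof -
  have "tassoc H H H (tmap H H (tensor H H) H (comul H) id R)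
      = mult3 H (RR (\<lambda>a b. tens H (tensor H H) a (tens H H 1 b))) (RR (\<lambda>a b. tens H (tensor H H) 1 (tens H H a b)))"
    using quasitriangular_H by (simp add: quasitriangular_quantum_groupoid_def Let_def)
  also have "\<dots> = RR (\<lambda>a b. RR (\<lambda>c d. tens H (tensor H H) a (tens H H c (b * d))))"
    by (subst mult3_contract) (simp_all add: mult2_tens)
  finally have "contract3 T (tassoc H H H (tmap H H (tensor H H) H (comul H) id R))
      = contract3 T (RR (\<lambda>a b. RR (\<lambda>c d. tens H (tensor H H) a (tens H H c (b * d)))))" by simp
  then show ?thesis
    by (simp add: tassoc_comul contract3_contract[OF T] contract3_tens[OF T] contract_in_H3 contract_tens_H[OF tri_bil[OF T]])
qed

lemma R_comul:
  assumes \<phi>: "bil sc sc t \<phi>"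
  shows "RR (\<lambda>r s. D h (\<lambda>a b. \<phi> (b * r) (a * s))) = RR (\<lambda>r s. D h (\<lambda>a b. \<phi> (r * a) (s * b)))"
proof -
  note [lin] = bilD[OF \<phi>]
  have "mult2 H (comul_cop H h) R = mult2 H R (comul H h)"
    using quasitriangular_H by (simp add: quasitriangular_quantum_groupoid_def)
  then have "contract H H (\<lambda>a b. RR (\<lambda>r s. \<phi> (a * r) (b * s))) (comul_cop H h) = RR (\<lambda>r s. D h (\<lambda>a b. \<phi> (r * a) (s * b)))"
    by (metis contract_mult2[OF \<phi> comul_cop_in R_in] contract_mult2[OF \<phi> R_in comul_in])
  moreover have "contract H H (\<lambda>a b. RR (\<lambda>r s. \<phi> (a * r) (b * s))) (comul_cop H h) = D h (\<lambda>a b. RR (\<lambda>r s. \<phi> (b * r) (a * s)))"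
    by (rule contract_comul_cop; (rule lin)+)
  ultimately show ?thesis by (subst contract_swap) simp
qed

lemma R_inverse:
  obtains R' where "R' \<in> carrier (tensor H H)" "mult2 H R R' = comul_cop H 1" "mult2 H R' R = comul H 1"
proof -
  obtain R' x where "x\<in>carrier (tensor H H)" "R' = mult2 H (mult2 H (comul H 1) x) (comul_cop H 1)"
    "mult2 H R R' = comul_cop H 1" "mult2 H R' R = comul H 1"
    using quasitriangular_H unfolding quasitriangular_quantum_groupoid_def by blast
  then show ?thesis using that[of R'] by (simp add: mult2_in comul_cop_in)
qed

section \<open>Counits of R, sliding through R and the element v\<close>

text \<open>Applying \<epsilon> to the middle leg of the first hexagon gives R = R (e \<otimes> 1).
  Multiplying by the inverse from the left leaves \<Delta>(1) = \<Delta>(1) (e \<otimes> 1), and id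
  \<otimes> \<epsilon> gives 1 = e.\<close>

lemma R_counit2: "RR (\<lambda>a b. sc (\<epsilon> b) a) = 1"
proof -
  define e where "e = RR (\<lambda>a b. sc (\<epsilon> b) a)"
  have e: "RR \<phi> = RR (\<lambda>a b. \<phi> (a * e) b)" if \<phi>: "bil sc sc t \<phi>" for t :: "'k \<Rightarrow> 'h \<Rightarrow> 'h" and \<phi>
  proof -
    note [lin] = bilD[OF \<phi>]
    have "RR \<phi> = RR (\<lambda>a b. D b (\<lambda>c d. \<phi> a (sc (\<epsilon> c) d)))"
      by (rule contract_cong, rule counit1[where g = "\<phi> a" for a, symmetric]; (rule lin)+)
    also have "\<dots> = RR (\<lambda>a b. RR (\<lambda>c d. \<phi> (a * c) (sc (\<epsilon> d) b)))"
      by (rule R_hexagon1; (rule lin)+)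
    also have "\<dots> = RR (\<lambda>a b. \<phi> (a * e) b)"
      by (simp add: e_def contract_mult_left bil_contract1[OF \<phi>]
          sc_mult(2)[symmetric] bil_bal[OF \<phi>])
    finally show ?thesis .
  qed
  obtain R' where R': "R' \<in> carrier (tensor H H)" "mult2 H R' R = comul H 1" using R_inverse by blast
  have "1 = D 1 (\<lambda>a b. sc (\<epsilon> b) a)" by (simp add: D_counit2)
  also have "\<dots> = contract H H (\<lambda>a b. RR (\<lambda>c d. sc (\<epsilon> (b * d)) (a * c))) R'"
    unfolding R'(2)[symmetric] by (rule contract_mult2[OF _ R'(1) R_in]; (rule lin)+)
  also have "\<dots> = contract H H (\<lambda>a b. RR (\<lambda>c d. sc (\<epsilon> (b * d)) (a * (c * e)))) R'"
    by (rule contract_cong, rule e; (rule lin)+)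
  also have "\<dots> = D 1 (\<lambda>a b. sc (\<epsilon> b) (a * e))"
    unfolding R'(2)[symmetric] mult.assoc[symmetric]
    by (rule contract_mult2[OF _ R'(1) R_in, symmetric]; (rule lin)+)
  also have "\<dots> = e"
    using contract_mult_right[of H H "\<lambda>a b. sc (\<epsilon> b) a" "comul H 1" e] by (simp add: D_counit2 sc_mult(1)[symmetric] sc_mult(2)[symmetric])
  finally show ?thesis by (simp add: e_def)
qed

text \<open>Here \<epsilon> is applied to the first leg of the second hexagon, so R = (1 \<otimes>
  e) R, and the inverse cancels from the right, leaving the flipped \<Delta>(1).\<close>

lemma R_counit1: "RR (\<lambda>a b. sc (\<epsilon> a) b) = 1"
proof -
  define e where "e = RR (\<lambda>a b. sc (\<epsilon> a) b)"
  have e: "RR \<phi> = RR (\<lambda>a b. \<phi> a (e * b))" if \<phi>: "bil sc sc t \<phi>" for t :: "'k \<Rightarrow> 'h \<Rightarrow> 'h" and \<phi>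
  proof -
    note [lin] = bilD[OF \<phi>]
    have "RR \<phi> = RR (\<lambda>a b. D a (\<lambda>c d. \<phi> (sc (\<epsilon> c) d) b))"
      by (rule contract_cong, rule counit1[where g = "\<lambda>x. \<phi> x b" for b, symmetric]; (rule lin)+)
    also have "\<dots> = RR (\<lambda>a b. RR (\<lambda>c d. \<phi> (sc (\<epsilon> a) c) (b * d)))"
      by (rule R_hexagon2; (rule lin)+)
    also have "\<dots> = RR (\<lambda>c d. RR (\<lambda>a b. \<phi> c (sc (\<epsilon> a) b * d)))"
      by (subst contract_swap) (simp add: bil_bal[OF \<phi>] sc_mult(1)[symmetric])
    also have "\<dots> = RR (\<lambda>a b. \<phi> a (e * b))"
      by (simp add: e_def contract_mult_right bil_contract2[OF \<phi>])
    finally show ?thesis .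
  qed
  obtain R' where R': "R' \<in> carrier (tensor H H)" "mult2 H R R' = comul_cop H 1" using R_inverse by blast
  have cop: "D 1 (\<lambda>a b. \<phi> b a) = RR (\<lambda>a b. contract H H (\<lambda>c d. \<phi> (a * c) (b * d)) R')"
    if \<phi>: "bil sc sc t \<phi>" for t :: "'k \<Rightarrow> 'h \<Rightarrow> 'h" and \<phi>
    using contract_mult2[OF \<phi> R_in R'(1)] contract_comul_cop[OF \<phi>] R'(2) by simp
  have "1 = D 1 (\<lambda>a b. sc (\<epsilon> b) a)" by (simp add: D_counit2)
  also have "\<dots> = RR (\<lambda>a b. contract H H (\<lambda>c d. sc (\<epsilon> (a * c)) (b * d)) R')"
    by (rule cop; (rule lin)+)
  also have "\<dots> = RR (\<lambda>a b. contract H H (\<lambda>c d. sc (\<epsilon> (a * c)) (e * b * d)) R')"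
    by (rule e; (rule lin)+)
  also have "\<dots> = D 1 (\<lambda>a b. sc (\<epsilon> b) (e * a))"
    unfolding mult.assoc by (rule cop[symmetric]; (rule lin)+)
  also have "\<dots> = e"
    using contract_mult_left[of e H H "\<lambda>a b. sc (\<epsilon> b) a" "comul H 1"] by (simp add: D_counit2 sc_mult(1)[symmetric] sc_mult(2)[symmetric])
  finally show ?thesis by (simp add: e_def)
qed

text \<open>The intertwining property of R applied to \<Delta>(z), which is \<Delta>(1) with z in
  its first leg; R absorbs \<Delta>(1) on both sides.\<close>

lemma R_slide_Ht:
  assumes \<phi>: "bil sc sc t \<phi>" and z: "z \<in> Ht"
  shows "RR (\<lambda>a b. \<phi> a (z * b)) = RR (\<lambda>a b. \<phi> (a * z) b)"
proof -
  note [lin] = bilD[OF \<phi>]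
  have "RR (\<lambda>a b. \<phi> a (z * b)) = RR (\<lambda>r s. D 1 (\<lambda>a b. \<phi> (b * r) (z * (a * s))))"
    by (rule one_R[symmetric]; (rule lin)+)
  also have "\<dots> = RR (\<lambda>r s. D z (\<lambda>a b. \<phi> (b * r) (a * s)))"
    unfolding mult.assoc[symmetric] by (rule contract_cong, rule comul_Ht(2)[OF _ z, symmetric]; (rule lin)+)
  also have "\<dots> = RR (\<lambda>r s. D z (\<lambda>a b. \<phi> (r * a) (s * b)))"
    by (rule R_comul; (rule lin)+)
  also have "\<dots> = RR (\<lambda>r s. D 1 (\<lambda>a b. \<phi> (r * (a * z)) (s * b)))"
    by (rule contract_cong, rule comul_Ht(1)[OF _ z]; (rule lin)+)
  also have "\<dots> = RR (\<lambda>a b. \<phi> (a * z) b)"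
    unfolding mult.assoc[symmetric] by (rule R_one; (rule lin)+)
  finally show ?thesis .
qed

lemma R_slide_Hs:
  assumes \<phi>: "bil sc sc t \<phi>" and y: "y \<in> Hs"
  shows "RR (\<lambda>a b. \<phi> (y * a) b) = RR (\<lambda>a b. \<phi> a (b * y))"
proof -
  note [lin] = bilD[OF \<phi>]
  have "RR (\<lambda>a b. \<phi> (y * a) b) = RR (\<lambda>r s. D 1 (\<lambda>a b. \<phi> (y * (b * r)) (a * s)))"
    by (rule one_R[symmetric]; (rule lin)+)
  also have "\<dots> = RR (\<lambda>r s. D y (\<lambda>a b. \<phi> (b * r) (a * s)))"
    unfolding mult.assoc[symmetric] by (rule contract_cong, rule comul_Hs(2)[OF _ y, symmetric]; (rule lin)+)
  also have "\<dots> = RR (\<lambda>r s. D y (\<lambda>a b. \<phi> (r * a) (s * b)))"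
    by (rule R_comul; (rule lin)+)
  also have "\<dots> = RR (\<lambda>r s. D 1 (\<lambda>a b. \<phi> (r * a) (s * (b * y))))"
    by (rule contract_cong, rule comul_Hs(1)[OF _ y]; (rule lin)+)
  also have "\<dots> = RR (\<lambda>a b. \<phi> a (b * y))"
    unfolding mult.assoc[symmetric] by (rule R_one; (rule lin)+)
  finally show ?thesis .
qed

text \<open>No intertwining takes place: S(z) slides inside the copy of \<Delta>(1) that R carries
  on its left.\<close>

lemma R_S_Ht:
  assumes \<phi>: "bil sc sc t \<phi>" and z: "z \<in> Ht"
  shows "RR (\<lambda>a b. \<phi> a (S z * b)) = RR (\<lambda>a b. \<phi> (z * a) b)"
proof -
  note [lin] = bilD[OF \<phi>]
  have "RR (\<lambda>a b. \<phi> a (S z * b)) = RR (\<lambda>r s. D 1 (\<lambda>a b. \<phi> (b * r) (S z * (a * s))))"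
    by (rule one_R[symmetric]; (rule lin)+)
  also have "\<dots> = RR (\<lambda>r s. D 1 (\<lambda>a b. \<phi> (z * b * r) (a * s)))"
    unfolding mult.assoc[symmetric] by (rule contract_cong, rule one_slide_Ht[OF _ z, symmetric]; (rule lin)+)
  also have "\<dots> = RR (\<lambda>a b. \<phi> (z * a) b)"
    unfolding mult.assoc by (rule one_R; (rule lin)+)
  finally show ?thesis .
qed

lemma R_S_Hs:
  assumes \<phi>: "bil sc sc t \<phi>" and y: "y \<in> Hs"
  shows "RR (\<lambda>a b. \<phi> a (b * S y)) = RR (\<lambda>a b. \<phi> (a * y) b)"
proof -
  note [lin] = bilD[OF \<phi>]
  have "RR (\<lambda>a b. \<phi> a (b * S y)) = RR (\<lambda>r s. D 1 (\<lambda>a b. \<phi> (r * a) (s * b * S y)))"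
    by (rule R_one[symmetric]; (rule lin)+)
  also have "\<dots> = RR (\<lambda>r s. D 1 (\<lambda>a b. \<phi> (r * (a * y)) (s * b)))"
    unfolding mult.assoc by (rule contract_cong, rule one_slide_Hs[OF _ y, symmetric]; (rule lin)+)
  also have "\<dots> = RR (\<lambda>a b. \<phi> (a * y) b)"
    unfolding mult.assoc[symmetric] by (rule R_one; (rule lin)+)
  finally show ?thesis .
qed

text \<open>Expand \<open>es\<close> over the flipped \<Delta>(1). The factor S(y) next to the
  second leg of R passes to the first leg by \<open>R_S_Hs\<close>, after which only the counit of
  the second leg remains. Under \<open>es\<close> the matrix R thus degenerates to \<Delta>(1),
  which is how it disappears from the counit and antipode axioms.\<close>

lemma R_es:
  assumes \<phi>: "bil sc sc t \<phi>"
  shows "RR (\<lambda>a b. \<phi> a (es b)) = D 1 (\<lambda>a b. \<phi> a (S b))"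
proof -
  note [lin] = bilD[OF \<phi>]
  have es: "es h = D 1 (\<lambda>a b. sc (\<epsilon> (h * S a)) (S b))" for h
    unfolding es_eq by (rule one_flip[symmetric]; (rule lin)+)
  have y: "RR (\<lambda>a b. \<phi> (sc (\<epsilon> (b * S y)) a) w) = \<phi> y w" if "y \<in> Hs" for y w
  proof -
    have "RR (\<lambda>a b. \<phi> (sc (\<epsilon> (b * S y)) a) w) = RR (\<lambda>a b. \<phi> (sc (\<epsilon> b) (a * y)) w)"
      by (rule R_S_Hs[OF _ that]; (rule lin)+)
    also have "\<dots> = \<phi> (RR (\<lambda>a b. sc (\<epsilon> b) a) * y) w"
      by (simp add: contract_mult_right bil_contract1[OF \<phi>] sc_mult(1)[symmetric])
    finally show ?thesis by (simp add: R_counit2)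
  qed
  have "RR (\<lambda>a b. \<phi> a (es b)) = D 1 (\<lambda>c d. RR (\<lambda>a b. \<phi> (sc (\<epsilon> (b * S c)) a) (S d)))"
    by (subst contract_swap) (simp add: es bil_contract2[OF \<phi>] bil_bal[OF \<phi>])
  also have "\<dots> = D 1 (\<lambda>a b. \<phi> a (S b))"
    by (rule one_es_et; ((rule lin)+ | simp add: y))
  finally show ?thesis .
qed

text \<open>The same with the legs exchanged: y moves from the first leg to the second by
  \<open>R_slide_Hs\<close>, and \<open>R_counit1\<close> applies.\<close>

lemma R_et:
  assumes \<phi>: "bil sc sc t \<phi>"
  shows "RR (\<lambda>a b. \<phi> (et a) b) = D 1 (\<lambda>a b. \<phi> b a)"
proof -
  note [lin] = bilD[OF \<phi>]
  have y: "RR (\<lambda>a b. \<phi> w (sc (\<epsilon> (y * a)) b)) = \<phi> w y" if "y \<in> Hs" for y w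
  proof -
    have "RR (\<lambda>a b. \<phi> w (sc (\<epsilon> (y * a)) b)) = RR (\<lambda>a b. \<phi> w (sc (\<epsilon> a) (b * y)))"
      by (rule R_slide_Hs[OF _ that]; (rule lin)+)
    also have "\<dots> = \<phi> w (RR (\<lambda>a b. sc (\<epsilon> a) b) * y)"
      by (simp add: contract_mult_right bil_contract2[OF \<phi>] sc_mult(1)[symmetric])
    finally show ?thesis by (simp add: R_counit1)
  qed
  have "RR (\<lambda>a b. \<phi> (et a) b) = D 1 (\<lambda>c d. RR (\<lambda>a b. \<phi> d (sc (\<epsilon> (c * a)) b)))"
    by (subst contract_swap, rule contract_cong)
      (simp add: et_eq bil_contract1[OF \<phi>] bil_bal[OF \<phi>])
  also have "\<dots> = D 1 (\<lambda>a b. \<phi> b a)"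
    by (rule one_es_et; ((rule lin)+ | simp add: y))
  finally show ?thesis .
qed

text \<open>In a quasitriangular Hopf algebra this is the inverse of the Drinfeld element.\<close>

definition drinfeld_inv where "drinfeld_inv = RR (\<lambda>r s. s * S (S r))"

text \<open>The Hopf algebra computation with counits replaced by counital maps. The \<Delta>(1)
  absorbed by R provides es(h_2) = S(h_2) h_3, whose factor h_2 is intertwined with h_1 through R.
  The factor h_2 S(h_3) obtained on the other side is et(h_2), and R absorbs the \<Delta>(1) it
  produces.\<close>

lemma drinfeld_inv_S_S: "drinfeld_inv * S (S h) = h * drinfeld_inv"
proof -
  have "h * drinfeld_inv = RR (\<lambda>r s. h * (s * S (S r)))"
    by (simp add: drinfeld_inv_def contract_mult_left)
  also have "\<dots> = RR (\<lambda>r s. D 1 (\<lambda>c d. h * (c * s * S (S (d * r)))))"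
    by (rule one_R[symmetric]; (rule lin)+)
  also have "\<dots> = RR (\<lambda>r s. D 1 (\<lambda>c d. h * c * s * S (S r * S d)))"
    by (simp add: S_mult mult.assoc)
  also have "\<dots> = RR (\<lambda>r s. D h (\<lambda>a b. a * s * S (S r * es b)))"
    by (rule contract_cong, rule comul_es'[symmetric]; (rule lin)+)
  also have "\<dots> = RR (\<lambda>r s. D h (\<lambda>a b. D b (\<lambda>c d. a * s * S (S (c * r) * d))))"
    by (simp add: S_id[symmetric] contract_mult_left S_contract S_mult mult.assoc)
  also have "\<dots> = RR (\<lambda>r s. D h (\<lambda>a b. D a (\<lambda>c d. c * s * S (S (d * r) * b))))"
    by (rule contract_cong, rule coassoc[symmetric]; (rule lin)+)
  also have "\<dots> = D h (\<lambda>a b. RR (\<lambda>r s. D a (\<lambda>c d. c * s * S (S (d * r) * b))))"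
    by (rule contract_swap)
  also have "\<dots> = D h (\<lambda>a b. RR (\<lambda>r s. D a (\<lambda>c d. s * d * S (S (r * c) * b))))"
    by (rule contract_cong, rule R_comul; (rule lin)+)
  also have "\<dots> = RR (\<lambda>r s. D h (\<lambda>a b. D a (\<lambda>c d. s * d * S (S (r * c) * b))))"
    by (rule contract_swap)
  also have "\<dots> = RR (\<lambda>r s. D h (\<lambda>a b. D b (\<lambda>c d. s * c * S (S (r * a) * d))))"
    by (rule contract_cong, rule coassoc; (rule lin)+)
  also have "\<dots> = RR (\<lambda>r s. D h (\<lambda>a b. s * et b * S (S (r * a))))"
    by (simp add: id_S[symmetric] contract_mult_left contract_mult_right S_mult mult.assoc)
  also have "\<dots> = RR (\<lambda>r s. D 1 (\<lambda>a b. s * b * S (S (r * (a * h)))))"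
    by (rule contract_cong, rule comul_et; (rule lin)+)
  also have "\<dots> = RR (\<lambda>r s. D 1 (\<lambda>a b. s * b * S (S (r * a)))) * S (S h)"
    by (simp add: S_mult contract_mult_right mult.assoc)
  also have "RR (\<lambda>r s. D 1 (\<lambda>a b. s * b * S (S (r * a)))) = drinfeld_inv"
    unfolding drinfeld_inv_def by (rule R_one; (rule lin)+)
  finally show ?thesis ..
qed

text \<open>The second hexagon fuses the copy of R inside v with the outer one. The first legs then
  meet as r_1 S(r_2) = et(r), and \<open>R_et\<close> reduces the sum to 1_1 S(1_2) = 1.\<close>

lemma R_drinfeld_inv: "RR (\<lambda>r s. s * drinfeld_inv * S r) = 1"
proof -
  have "RR (\<lambda>r s. s * drinfeld_inv * S r) = RR (\<lambda>a b. RR (\<lambda>c d. b * d * S (a * S c)))"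
    by (simp add: drinfeld_inv_def contract_mult_left contract_mult_right S_mult mult.assoc)
  also have "\<dots> = RR (\<lambda>a b. D a (\<lambda>c d. b * S (c * S d)))"
    by (rule R_hexagon2[symmetric]; (rule lin)+)
  also have "\<dots> = RR (\<lambda>a b. b * S (et a))"
    by (simp add: id_S[symmetric] contract_mult_left S_contract)
  also have "\<dots> = D 1 (\<lambda>a b. a * S b)"
    by (rule R_et; (rule lin)+)
  finally show ?thesis by (simp add: id_S)
qed

section \<open>The braiding\<close>

text \<open>The flipped \<Delta>(1) at the left end of R performs the truncation, so the braiding
  takes values in the truncated product.\<close>

lemma braiding_gen:
  assumes V: "left_module H V" and W: "left_module H W" and v: "v \<in> carrier V" and w: "w \<in> carrier W"
  shows "RR (\<lambda>r s. tens W V (act W s w) (act V r v)) = RR (\<lambda>r s. tens_t H W V (act W s w) (act V r v))"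
proof -
  have "RR (\<lambda>r s. tens_t H W V (act W s w) (act V r v))
    = RR (\<lambda>r s. D 1 (\<lambda>a b. tens W V (act W (a * s) w) (act V (b * r) v)))"
    by (simp add: tens_t_def act_mult V W v w)
  also have "\<dots> = RR (\<lambda>r s. tens W V (act W s w) (act V r v))"
    by (rule one_R) (rule lin modlin V W v w)+
  finally show ?thesis ..
qed

lemma braiding_hom:
  assumes V: "left_module H V" and W: "left_module H W"
  shows "hmod_hom H (tprod H V W) (tprod H W V) (braiding H R V W)"
    and "v \<in> carrier V \<Longrightarrow> w \<in> carrier W \<Longrightarrow>
      braiding H R V W (tens_t H V W v w) = RR (\<lambda>r s. tens_t H W V (act W s w) (act V r v))"
proof -
  let ?\<phi> = "\<lambda>v w. RR (\<lambda>r s. tens W V (act W s w) (act V r v))"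
  note WV = tprod_module[OF W V]
  have m: "?\<phi> v w \<in> carrier (tprod H W V)" if "v \<in> carrier V" "w \<in> carrier W" for v w
    unfolding braiding_gen[OF V W that]
    by (rule contract_in[OF kspace_tprod[OF W V] R_in]) (simp add: tens_t_in act_in V W that)
  have k: "kbilinear V W (whole tscl) ?\<phi>"
    unfolding kbilinear_def
    by (intro conjI ballI klinear_contract_fun klinear_tens_left klinear_tens_right klinear_whole klinear_act V W vs_tscl)
  then have k: "kbilinear V W (tprod H W V) ?\<phi>"
    using m by (auto simp: kbilinear_def klinear_def)
  have eq: "D h (\<lambda>a b. ?\<phi> (act V a v) (act W b w)) = act (tprod H W V) h (?\<phi> v w)"
    if v: "v \<in> carrier V" and w: "w \<in> carrier W" for h v w
  proof -
    have "D h (\<lambda>a b. ?\<phi> (act V a v) (act W b w)) = RR (\<lambda>r s. D h (\<lambda>a b. tens W V (act W (s * b) w) (act V (r * a) v)))"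
      by (subst contract_swap) (simp add: act_mult V W v w)
    also have "\<dots> = RR (\<lambda>r s. D h (\<lambda>a b. tens W V (act W (a * s) w) (act V (b * r) v)))"
      by (rule R_comul[symmetric]) (rule lin modlin V W v w)+
    also have "\<dots> = RR (\<lambda>r s. diag_act H W V h (tens W V (act W s w) (act V r v)))"
      by (simp add: diag_act_tens tens_act_def act_mult act_in V W v w)
    also have "\<dots> = diag_act H W V h (?\<phi> v w)"
      by (rule klinear_contract_elem[OF klinear_diag_act[OF W V] kspace_tensor[OF module_kspace[OF W]] R_in, symmetric])
        (simp add: act_in V W v w)
    finally show ?thesis by simp
  qed
  show "hmod_hom H (tprod H V W) (tprod H W V) (braiding H R V W)"
    unfolding braiding_def by (rule contract_t_hom(1)[OF V W WV k eq])
  show "v \<in> carrier V \<Longrightarrow> w \<in> carrier W \<Longrightarrow>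
      braiding H R V W (tens_t H V W v w) = RR (\<lambda>r s. tens_t H W V (act W s w) (act V r v))"
    unfolding braiding_def using contract_t_hom(2)[OF V W WV k eq] braiding_gen[OF V W] by simp
qed

text \<open>The map is a composite of five morphisms, and each is known through its values on
  generators. The names \<open>F1\<close> to \<open>F5\<close> keep its definition folded
  meanwhile.\<close>

lemma middle_braiding:
  assumes V: "left_module H V"
  defines "VV \<equiv> tprod H V V"
  shows "klinear (tprod H VV VV) (tprod H VV VV) (middle_braiding H R V)"
    and "a \<in> carrier V \<Longrightarrow> b \<in> carrier V \<Longrightarrow> c \<in> carrier V \<Longrightarrow> d \<in> carrier V \<Longrightarrow>
      middle_braiding H R V (tens_t H VV VV (tens_t H V V a b) (tens_t H V V c d))
        = RR (\<lambda>r s. tens_t H VV VV (tens_t H V V a (act V s c)) (tens_t H V V (act V r b) d))"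
proof -
  have VV: "left_module H VV" unfolding VV_def by (rule tprod_module[OF V V])
  define V_VV where "V_VV = tprod H V VV"
  define VV_V where "VV_V = tprod H VV V"
  have V_VV: "left_module H V_VV" and VV_V: "left_module H VV_V"
    unfolding V_VV_def VV_V_def by (intro tprod_module V VV)+
  define F1 where "F1 = tassoc V V VV"
  define F2 where "F2 = tmap V V_VV V VV_V id (tassoc_inv V V V)"
  define F3 where "F3 = tmap V VV_V V VV_V id (tmap VV V VV V (braiding H R V V) id)"
  define F4 where "F4 = tmap V VV_V V V_VV id (tassoc V V V)"
  define F5 where "F5 = tassoc_inv V V VV"
  have mb: "middle_braiding H R V = (\<lambda>x. F5 (F4 (F3 (F2 (F1 x)))))"
    by (simp add: middle_braiding_def Let_def F1_def F2_def F3_def F4_def F5_def VV_def V_VV_def VV_V_def fun_eq_iff)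
  note as = tassoc_hom[OF V V V, folded VV_def, folded V_VV_def VV_V_def]
  note ai = tassoc_inv_hom[OF V V V, folded VV_def, folded V_VV_def VV_V_def]
  note br = braiding_hom[OF V V, folded VV_def]
  note bi = tmap_hom[OF VV V VV V br(1) id_hom, folded VV_V_def]
  note h1 = tassoc_hom[OF V V VV, folded VV_def, folded V_VV_def, folded F1_def]
  note h2 = tmap_hom[OF V V_VV V VV_V id_hom ai(1), folded F2_def]
  note h3 = tmap_hom[OF V VV_V V VV_V id_hom bi(1), folded F3_def]
  note h4 = tmap_hom[OF V VV_V V V_VV id_hom as(1), folded F4_def]
  note h5 = tassoc_inv_hom[OF V V VV, folded VV_def, folded V_VV_def, folded F5_def]
  note k45 = klinear_comp[OF hom_klinear[OF h4(1)] hom_klinear[OF h5(1)]]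
  show "klinear (tprod H VV VV) (tprod H VV VV) (middle_braiding H R V)"
    unfolding mb by (intro klinear_comp[OF hom_klinear[OF h1(1)] klinear_comp[OF hom_klinear[OF h2(1)]
          klinear_comp[OF hom_klinear[OF h3(1)] k45]]])
  assume m: "a \<in> carrier V" "b \<in> carrier V" "c \<in> carrier V" "d \<in> carrier V"
  have i2: "tens_t H V V x y \<in> carrier VV" if "x \<in> carrier V" "y \<in> carrier V" for x y
    unfolding VV_def by (rule tens_t_in[OF V V that])
  have i3: "tens_t H VV V p y \<in> carrier VV_V" if "p \<in> carrier VV" "y \<in> carrier V" for p y
    unfolding VV_V_def by (rule tens_t_in[OF VV V that])
  have i3': "tens_t H V VV y p \<in> carrier V_VV" if "p \<in> carrier VV" "y \<in> carrier V" for p y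
    unfolding V_VV_def by (rule tens_t_in[OF V VV that(2,1)])
  have i4: "tens_t H V VV_V y p \<in> carrier (tprod H V VV_V)" if "p \<in> carrier VV_V" "y \<in> carrier V" for p y
    by (rule tens_t_in[OF V VV_V that(2,1)])
  have s1: "F2 (F1 (tens_t H VV VV (tens_t H V V a b) (tens_t H V V c d)))
      = tens_t H V VV_V a (tens_t H VV V (tens_t H V V b c) d)"
    by (simp add: h1(2) h2(2) ai(2) m i2 i3')
  have "F3 (F2 (F1 (tens_t H VV VV (tens_t H V V a b) (tens_t H V V c d))))
      = tens_t H V VV_V a (tens_t H VV V (RR (\<lambda>r s. tens_t H V V (act V s c) (act V r b))) d)"
    by (simp add: s1 h3(2) bi(2) br(2) m i2 i3)
  \<comment> \<open>The sum over R has to leave both truncated tensors before the two remaining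
    associators see generators.\<close>
  also have "\<dots> = tens_t H V VV_V a (RR (\<lambda>r s. tens_t H VV V (tens_t H V V (act V s c) (act V r b)) d))"
    by (subst klinear_contract_elem[OF klinear_tens_t(1)[OF VV V m(4)] module_kspace[OF VV] R_in])
      (auto intro!: i2 act_in V m)
  also have "\<dots> = RR (\<lambda>r s. tens_t H V VV_V a (tens_t H VV V (tens_t H V V (act V s c) (act V r b)) d))"
    by (rule klinear_contract_elem[OF klinear_tens_t(2)[OF V VV_V m(1)] module_kspace[OF VV_V] R_in])
      (auto intro!: i2 i3 act_in V m)
  finally have s3: "F3 (F2 (F1 (tens_t H VV VV (tens_t H V V a b) (tens_t H V V c d))))
      = RR (\<lambda>r s. tens_t H V VV_V a (tens_t H VV V (tens_t H V V (act V s c) (act V r b)) d))" .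
  have "middle_braiding H R V (tens_t H VV VV (tens_t H V V a b) (tens_t H V V c d))
      = RR (\<lambda>r s. F5 (F4 (tens_t H V VV_V a (tens_t H VV V (tens_t H V V (act V s c) (act V r b)) d))))"
    unfolding mb s3
    by (rule klinear_contract_elem[OF k45 module_kspace[OF tprod_module[OF V VV_V]] R_in])
      (auto intro!: i2 i3 i4 act_in V m)
  also have "\<dots> = RR (\<lambda>r s. tens_t H VV VV (tens_t H V V a (act V s c)) (tens_t H V V (act V r b) d))"
    by (simp add: h4(2) as(2) h5(2) m i2 i3 i3' act_in V)
  finally show "middle_braiding H R V (tens_t H VV VV (tens_t H V V a b) (tens_t H V V c d))
        = RR (\<lambda>r s. tens_t H VV VV (tens_t H V V a (act V s c)) (tens_t H V V (act V r b) d))" .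
qed

end

section \<open>The centralizer of the source space\<close>

locale transmutation = qtriangular H R + L: qgroupoid L
  for H :: "('k::field, 'h::{ring,monoid_mult}) qgroupoid"
    and R :: "('h, 'h, 'k) tensor"
    and L :: "('k, 'l::{ring,monoid_mult}) qgroupoid" +
  fixes f :: "'h \<Rightarrow> 'l"
  assumes fmap: "quantum_groupoid_map H L f"
begin

section \<open>Compatibility of f with the structure maps\<close>

lemma f_mult [simp]: "f (x * y) = f x * f y" and f_1 [simp]: "f 1 = 1"
  and f_counit [simp]: "L.\<epsilon> (f x) = \<epsilon> x"
  using fmap by (auto simp: quantum_groupoid_map_def)

lemma lin_f [lin]: "klin s sc g \<Longrightarrow> klin s L.sc (\<lambda>x. f (g x))"
  using fmap L.vs by (auto simp: quantum_groupoid_map_def klinear_def Vector_Spaces.linear_iff)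

lemmas f_contract = klin_contract[OF lin_f[OF klin_id[OF vs]]]
  and f_sc [simp] = klin_scale[OF lin_f[OF klin_id[OF vs]]]

lemma f_comul:
  assumes \<phi>: "bil L.sc L.sc t \<phi>"
  shows "L.D (f h) \<phi> = D h (\<lambda>a b. \<phi> (f a) (f b))"
proof -
  have "comul L (f h) = D h (\<lambda>a b. tens L L (f a) (f b))"
    using fmap by (simp add: quantum_groupoid_map_def tmap_def)
  then show ?thesis
    by (simp add: contract_contract[OF L.ks L.ks \<phi> ks] L.contract_tens_H[OF \<phi>])
qed

lemma L_one: "bil L.sc L.sc t \<phi> \<Longrightarrow> L.D 1 \<phi> = D 1 (\<lambda>a b. \<phi> (f a) (f b))"
  using f_comul[of t \<phi> 1] by simp

lemma f_et: "f (et h) = L.et (f h)" and f_es: "f (es h) = L.es (f h)"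
proof -
  have "L.et (f h) = D 1 (\<lambda>a b. L.sc (L.\<epsilon> (f a * f h)) (f b))"
    unfolding L.et_eq by (rule L_one; (rule lin)+)
  then show "f (et h) = L.et (f h)" by (simp add: et_eq f_contract f_mult[symmetric] del: f_mult)
  have "L.es (f h) = D 1 (\<lambda>a b. L.sc (L.\<epsilon> (f h * f b)) (f a))"
    unfolding L.es_eq by (rule L_one; (rule lin)+)
  then show "f (es h) = L.es (f h)" by (simp add: es_eq f_contract f_mult[symmetric] del: f_mult)
qed

text \<open>Both sides are convolution inverses of f in the weak sense: associativity applied to
  \<open>L.S\<close> after f, then f, then f after \<open>S\<close> can be read from either
  end.\<close>

lemma f_S: "L.S (f h) = f (S h)"
proof -
  have "L.S (f h) = D h (\<lambda>a b. L.S (f a) * L.et (f b))"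
    unfolding L.S_et[symmetric, of "f h"] by (rule f_comul; (rule lin)+)
  also have "\<dots> = D h (\<lambda>a b. D b (\<lambda>c d. L.S (f a) * f c * f (S d)))"
    by (simp add: f_et[symmetric] id_S[symmetric] f_contract contract_mult_left mult.assoc)
  also have "\<dots> = D h (\<lambda>a b. D a (\<lambda>c d. L.S (f c) * f d * f (S b)))"
    by (rule coassoc[symmetric]; (rule lin)+)
  also have "\<dots> = D h (\<lambda>a b. L.es (f a) * f (S b))"
  proof (rule contract_cong)
    fix a b
    have "L.es (f a) = D a (\<lambda>c d. L.S (f c) * f d)"
      unfolding L.S_id[symmetric] by (rule f_comul; (rule lin)+)
    then show "D a (\<lambda>c d. L.S (f c) * f d * f (S b)) = L.es (f a) * f (S b)"
      by (simp add: contract_mult_right)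
  qed
  also have "\<dots> = f (S h)"
    by (simp add: es_S[symmetric, of h] f_es[symmetric] f_contract)
  finally show ?thesis .
qed

lemma f_Hs [simp]: "y \<in> Hs \<Longrightarrow> f y \<in> L.Hs" and f_Ht [simp]: "z \<in> Ht \<Longrightarrow> f z \<in> L.Ht"
  using f_es[of y] f_et[of z] by (simp_all add: Hs_def Ht_def L.Hs_def L.Ht_def)

section \<open>The adjoint action and the centralizer\<close>

abbreviation A where "A \<equiv> adjoint_act H f"

lemma A_eq: "A h l = D h (\<lambda>a b. f a * l * f (S b))"
  by (simp add: adjoint_act_def)

lemma lin_A1 [lin]:
  assumes "klin s sc g"
  shows "klin s L.sc (\<lambda>x. A (g x) l)"
  unfolding A_eq by (rule lin_D[OF assms]; (rule lin)+)

lemma lin_A2 [lin]: "klin s L.sc g \<Longrightarrow> klin s L.sc (\<lambda>x. A h (g x))"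
  unfolding A_eq by (rule klin_contract_fun) (auto intro: lin_mult1 L.lin_mult1 L.lin_mult2 L.vs dest: klin_vs)

lemma A_mult: "A (g * h) l = A g (A h l)"
proof -
  have "A (g * h) l = D g (\<lambda>a b. D h (\<lambda>c d. f (a * c) * l * f (S (b * d))))"
    unfolding A_eq by (rule D_mult; (rule lin)+)
  then show ?thesis by (simp add: A_eq S_mult contract_mult_left contract_mult_right mult.assoc)
qed

definition V where "V = {l. \<forall>y\<in>Hs. l * f y = f y * l}"

lemma V_comm: "x \<in> V \<Longrightarrow> y \<in> Hs \<Longrightarrow> x * f y = f y * x"
  by (simp add: V_def)

text \<open>f preserves \<Delta>(1), so es(x) in L is f(1_1) scaled by \<epsilon>(x f(1_2)). Thus
  L_s is the image of H_s, and commutation can be tested on elements f y.\<close>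

lemma source_centralizer_eq: "source_centralizer L = V"
proof -
  have "\<exists>y\<in>Hs. L.es x = f y" for x
  proof -
    let ?y = "D 1 (\<lambda>a b. sc (L.\<epsilon> (x * f b)) a)"
    have "L.es x = D 1 (\<lambda>a b. L.sc (L.\<epsilon> (x * f b)) (f a))"
      unfolding L.es_eq by (rule L_one; (rule lin)+)
    then have "L.es x = f ?y" by (simp add: f_contract)
    moreover have "es ?y = ?y"
    proof -
      have "es ?y = D 1 (\<lambda>a b. es (sc (L.\<epsilon> (x * f b)) a))"
        by (rule klin_contract; (rule lin)+)
      also have "\<dots> = ?y"
        by (rule one_es_et; ((rule lin)+ | simp add: klin_scale[OF lin_es[OF klin_id[OF vs]]] Hs_def))
      finally show ?thesis .
    qed
    ultimately show ?thesis by (auto simp: Hs_def)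
  qed
  moreover have "f y \<in> range L.es" if "y \<in> Hs" for y
    using f_es[of y] that by (intro range_eqI[of _ _ "f y"]) (simp add: Hs_def)
  ultimately have "range L.es = f ` Hs" by (auto simp: image_iff)
  then show ?thesis by (auto simp: source_centralizer_def V_def)
qed

lemma V_mult [simp]: "x \<in> V \<Longrightarrow> y \<in> V \<Longrightarrow> x * y \<in> V"
proof -
  assume x: "x \<in> V" and y: "y \<in> V"
  have "x * y * f u = f u * (x * y)" if "u \<in> Hs" for u
  proof -
    have "x * y * f u = x * f u * y" by (simp add: mult.assoc V_comm[OF y that])
    then show ?thesis by (simp add: V_comm[OF x that] mult.assoc)
  qed
  then show ?thesis by (simp add: V_def)
qed

lemma f_Ht_V [simp]: "z \<in> Ht \<Longrightarrow> f z \<in> V"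
  by (simp add: V_def f_mult[symmetric] Hs_Ht_commute[of _ z] del: f_mult)

text \<open>An element of H_s has the form S(z). It slides from the first leg of \<Delta>(1) to the
  second as z, and S(z 1_2) = S(1_2) S(z) delivers it on the right of l.\<close>

lemma A_one_V: "A 1 l \<in> V"
  unfolding V_def
proof (intro CollectI ballI)
  fix y assume "y \<in> Hs"
  then obtain z where z: "z \<in> Ht" "y = S z" using Hs_S_Ht by blast
  have "f y * A 1 l = D 1 (\<lambda>a b. f (S z * a) * l * f (S b))"
    by (simp add: A_eq contract_mult_left z mult.assoc)
  also have "\<dots> = D 1 (\<lambda>a b. f a * l * f (S (z * b)))"
    by (rule one_slide_Ht[OF _ z(1), symmetric]; (rule lin)+)
  also have "\<dots> = A 1 l * f y"
    by (simp add: A_eq contract_mult_right z S_mult mult.assoc)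
  finally show "A 1 l * f y = f y * A 1 l" ..
qed

lemma A_V [simp]: "A h l \<in> V"
  using A_one_V[of "A h l"] A_mult[of 1 h l] by simp

lemma A_one: "x \<in> V \<Longrightarrow> A 1 x = x"
proof -
  assume x: "x \<in> V"
  have "A 1 x = D 1 (\<lambda>a b. x * f (a * S b))"
    unfolding A_eq by (rule one_es_et; ((rule lin)+ | simp add: V_comm[OF x] mult.assoc[symmetric]))
  also have "\<dots> = x * f (D 1 (\<lambda>a b. a * S b))" by (simp only: f_contract contract_mult_left)
  finally show ?thesis by (simp only: id_S) simp
qed

lemma V_iff: "x \<in> V \<longleftrightarrow> A 1 x = x"
  using A_one A_V by metis

lemma A_A_one [simp]: "A h (A 1 x) = A h x" "A 1 (A h x) = A h x"
  by (simp_all add: A_mult[symmetric])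

text \<open>The tail S(h_2) h_3 = es(h_2) lies in H_s, hence commutes with x and is absorbed by
  h_1.\<close>

lemma V_move:
  assumes x: "x \<in> V"
  shows "D h (\<lambda>a b. A a x * f b) = f h * x"
proof -
  have "D h (\<lambda>a b. A a x * f b) = D h (\<lambda>a b. D a (\<lambda>c d. f c * x * f (S d) * f b))"
    by (simp add: A_eq contract_mult_right)
  also have "\<dots> = D h (\<lambda>a b. D b (\<lambda>c d. f a * x * f (S c) * f d))"
    by (rule coassoc; (rule lin)+)
  also have "\<dots> = D h (\<lambda>a b. f a * (x * f (es b)))"
    by (simp add: S_id[symmetric] f_contract contract_mult_left mult.assoc)
  also have "\<dots> = f (D h (\<lambda>a b. a * es b)) * x"
    by (simp add: V_comm[OF x es_Hs] f_contract contract_mult_right mult.assoc)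
  finally show ?thesis by (simp add: id_es)
qed

lemma V_S:
  assumes x: "x \<in> V"
  shows "D h (\<lambda>a b. f (S a) * A b x) = x * f (S h)"
proof -
  have "D h (\<lambda>a b. f (S a) * A b x) = D h (\<lambda>a b. D b (\<lambda>c d. f (S a) * f c * x * f (S d)))"
    by (simp add: A_eq contract_mult_left mult.assoc)
  also have "\<dots> = D h (\<lambda>a b. D a (\<lambda>c d. f (S c) * f d * x * f (S b)))"
    by (rule coassoc[symmetric]; (rule lin)+)
  also have "\<dots> = D h (\<lambda>a b. f (es a) * x * f (S b))"
    by (simp add: S_id[symmetric] f_contract contract_mult_right)
  also have "\<dots> = x * f (D h (\<lambda>a b. es a * S b))"
    by (simp add: V_comm[OF x es_Hs, symmetric] f_contract contract_mult_left mult.assoc)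
  finally show ?thesis by (simp add: es_S)
qed

text \<open>The inner factor S(h_2) h_3 = es(h_2) passes x and is absorbed by h_1. The second factor
  w ranges over all of L because legs of a coproduct will be put there.\<close>

lemma A_mult_V:
  assumes x: "x \<in> V"
  shows "A h (x * w) = D h (\<lambda>a b. A a x * A b w)"
proof -
  have "D h (\<lambda>a b. A a x * A b w) = D h (\<lambda>a b. D a (\<lambda>p q. D b (\<lambda>r s. f p * x * f (S q) * f r * w * f (S s))))"
    by (simp add: A_eq contract_mult_right, simp add: contract_mult_left mult.assoc)
  also have "\<dots> = D h (\<lambda>a b. D b (\<lambda>p q. D q (\<lambda>r s. f a * x * f (S p) * f r * w * f (S s))))"
    by (rule coassoc; (rule lin)+)
  also have "\<dots> = D h (\<lambda>a b. D b (\<lambda>p q. D p (\<lambda>r s. f a * x * f (S r) * f s * w * f (S q))))"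
    by (rule contract_cong, rule coassoc[symmetric]; (rule lin)+)
  also have "\<dots> = D h (\<lambda>a b. D b (\<lambda>p q. f a * (x * f (es p)) * w * f (S q)))"
    by (simp add: S_id[symmetric] f_contract contract_mult_left contract_mult_right mult.assoc)
  also have "\<dots> = D h (\<lambda>a b. D b (\<lambda>p q. f a * f (es p) * x * w * f (S q)))"
    by (simp add: V_comm[OF x es_Hs] mult.assoc)
  also have "\<dots> = D h (\<lambda>a b. D a (\<lambda>p q. f p * f (es q) * x * w * f (S b)))"
    by (rule coassoc[symmetric]; (rule lin)+)
  also have "\<dots> = D h (\<lambda>a b. f (D a (\<lambda>p q. p * es q)) * x * w * f (S b))"
    by (simp add: f_contract contract_mult_right)
  also have "\<dots> = A h (x * w)"
    by (simp add: id_es A_eq mult.assoc)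
  finally show ?thesis ..
qed

lemma A_Ht: assumes "z \<in> Ht" shows "A z x = f z * A 1 x"
proof -
  have "A z x = D 1 (\<lambda>a b. f (z * a) * x * f (S b))"
    unfolding A_eq by (rule comul_Ht(2)[OF _ assms]; (rule lin)+)
  then show ?thesis by (simp add: A_eq contract_mult_left mult.assoc)
qed

text \<open>The factor y sits in the second leg of \<Delta>(1), so S(y) comes out next to x. With y
  the inverse antipode of z, this identifies the right unit constraint with right multiplication by
  f z.\<close>

lemma A_Hs: assumes x: "x \<in> V" and y: "y \<in> Hs" shows "A y x = x * f (S y)"
proof -
  have "A y x = D 1 (\<lambda>a b. f a * x * f (S (b * y)))"
    unfolding A_eq by (rule comul_Hs(1)[OF _ y]; (rule lin)+)
  also have "\<dots> = A 1 (x * f (S y))" by (simp add: A_eq S_mult mult.assoc)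
  also have "\<dots> = x * f (S y)" by (rule A_one) (simp add: x y)
  finally show ?thesis .
qed

lemma A_f: assumes "z \<in> Ht" shows "A h (f z) = f (et (h * z))"
proof -
  have "D (h * z) (\<lambda>a b. a * S b) = D h (\<lambda>a b. a * z * S b)"
    by (rule D_mult_Ht(2)[OF _ assms]; (rule lin)+)
  then show ?thesis by (simp add: id_S[symmetric] A_eq f_contract)
qed

lemma A_one_Ht: assumes z: "z \<in> Ht" shows "A 1 (f z * x) = f z * A 1 x"
proof -
  have "A 1 (f z * x) = D 1 (\<lambda>a b. f (z * a) * x * f (S b))"
    unfolding A_eq
    by (rule one_es_et; ((rule lin)+ | simp add: mult.assoc[symmetric] f_mult[symmetric] Hs_Ht_commute[OF _ z] del: f_mult))
  then show ?thesis by (simp add: A_eq contract_mult_left mult.assoc)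
qed

section \<open>The transmuted comultiplication\<close>

text \<open>Since S reverses coproducts, of the four legs of h the outer two surround l_1 and the
  inner two form the action on l_2.\<close>

lemma comul_A:
  assumes \<phi>: "bil L.sc L.sc t \<phi>"
  shows "L.D (A h l) \<phi> = D h (\<lambda>a b. D b (\<lambda>c d. L.D l (\<lambda>p q. \<phi> (f a * p * f (S d)) (A c q))))"
proof -
  note [lin] = bilD[OF \<phi>]
  have "L.D (A h l) \<phi> = D h (\<lambda>a b. L.D (f a * l * f (S b)) \<phi>)"
    unfolding A_eq by (rule L.D_contract[OF \<phi>])
  also have "\<dots> = D h (\<lambda>a b. L.D (f a * l) (\<lambda>x y. L.D (f (S b)) (\<lambda>r s. \<phi> (x * r) (y * s))))"
    by (simp only: L.D_mult[OF \<phi>])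
  also have "\<dots> = D h (\<lambda>a b. L.D (f a) (\<lambda>m n. L.D l (\<lambda>p q. L.D (f (S b)) (\<lambda>r s. \<phi> (m * p * r) (n * q * s)))))"
    by (rule contract_cong, rule L.D_mult; (rule lin)+)
  also have "\<dots> = D h (\<lambda>a b. D a (\<lambda>m n. L.D l (\<lambda>p q. L.D (f (S b)) (\<lambda>r s. \<phi> (f m * p * r) (f n * q * s)))))"
    by (rule contract_cong, rule f_comul; (rule lin)+)
  also have "\<dots> = D h (\<lambda>a b. D a (\<lambda>m n. L.D l (\<lambda>p q. D (S b) (\<lambda>r s. \<phi> (f m * p * f r) (f n * q * f s)))))"
    by (rule contract_cong, rule contract_cong, rule contract_cong, rule f_comul; (rule lin)+)
  also have "\<dots> = D h (\<lambda>a b. D a (\<lambda>m n. L.D l (\<lambda>p q. D b (\<lambda>r s. \<phi> (f m * p * f (S s)) (f n * q * f (S r))))))"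
    by (rule contract_cong, rule contract_cong, rule contract_cong, rule S_comul; (rule lin)+)
  also have "\<dots> = D h (\<lambda>a b. D b (\<lambda>m n. L.D l (\<lambda>p q. D n (\<lambda>r s. \<phi> (f a * p * f (S s)) (f m * q * f (S r))))))"
    by (rule coassoc; (rule lin)+)
  also have "\<dots> = D h (\<lambda>a b. D b (\<lambda>m n. D n (\<lambda>r s. L.D l (\<lambda>p q. \<phi> (f a * p * f (S s)) (f m * q * f (S r))))))"
    by (rule contract_cong, rule contract_cong, rule contract_swap)
  also have "\<dots> = D h (\<lambda>a b. D b (\<lambda>m n. D m (\<lambda>r s. L.D l (\<lambda>p q. \<phi> (f a * p * f (S n)) (f r * q * f (S s))))))"
    by (rule contract_cong, rule coassoc[symmetric]; (rule lin)+)
  also have "\<dots> = D h (\<lambda>a b. D b (\<lambda>m n. L.D l (\<lambda>p q. D m (\<lambda>r s. \<phi> (f a * p * f (S n)) (f r * q * f (S s))))))"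
    by (rule contract_cong, rule contract_cong, rule contract_swap)
  also have "\<dots> = D h (\<lambda>a b. D b (\<lambda>c d. L.D l (\<lambda>p q. \<phi> (f a * p * f (S d)) (A c q))))"
    by (simp add: A_eq bil_contract2[OF \<phi>])
  finally show ?thesis .
qed

text \<open>Multiplying l by f y on either side multiplies l_2 on that side, so for l in V the
  factor f y may be moved through l_2. Hence f(1_1) l_2 f(S(1_2)) collapses, and the second leg may
  be treated as an element of V.\<close>

lemma comul_V:
  assumes \<phi>: "bil L.sc L.sc t \<phi>" and l: "l \<in> V"
  shows "L.D l (\<lambda>p q. \<phi> p (A 1 q)) = L.D l \<phi>"
proof -
  note [lin] = bilD[OF \<phi>]
  have y: "L.D l (\<lambda>p q. \<phi> p (f y * q * w)) = L.D l (\<lambda>p q. \<phi> p (q * f y * w))" if "y \<in> Hs" for y w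
  proof -
    have "L.D l (\<lambda>p q. \<phi> p (f y * q * w)) = L.D (f y * l) (\<lambda>p q. \<phi> p (q * w))"
      by (rule L.D_mult_Hs(1)[where \<phi> = "\<lambda>p q. \<phi> p (q * w)" for w, symmetric]; ((rule lin)+ | simp add: that))
    also have "\<dots> = L.D (l * f y) (\<lambda>p q. \<phi> p (q * w))" by (simp add: V_comm[OF l that])
    also have "\<dots> = L.D l (\<lambda>p q. \<phi> p (q * f y * w))"
      by (rule L.D_mult_Hs(2); ((rule lin)+ | simp add: that))
    finally show ?thesis .
  qed
  have "L.D l (\<lambda>p q. \<phi> p (A 1 q)) = D 1 (\<lambda>a b. L.D l (\<lambda>p q. \<phi> p (f a * q * f (S b))))"
    by (subst contract_swap, rule contract_cong) (simp add: A_eq bil_contract2[OF \<phi>])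
  also have "\<dots> = D 1 (\<lambda>a b. L.D l (\<lambda>p q. \<phi> p (q * f a * f (S b))))"
    by (rule one_es_et; ((rule lin)+ | simp add: y))
  also have "\<dots> = L.D l (\<lambda>p q. \<phi> p (q * f (D 1 (\<lambda>a b. a * S b))))"
    by (subst contract_swap, rule contract_cong)
      (simp add: f_contract contract_mult_left bil_contract2[OF \<phi>] mult.assoc)
  also have "\<dots> = L.D l \<phi>" by (simp add: id_S)
  finally show ?thesis .
qed

text \<open>\<open>DR l \<phi>\<close> is \<open>\<phi>\<close> evaluated on the transmuted comultiplication of \<open>l\<close>.\<close>

abbreviation DR :: "'l \<Rightarrow> ('l \<Rightarrow> 'l \<Rightarrow> 'u::ab_group_add) \<Rightarrow> 'u" where
  "DR l \<phi> \<equiv> L.D l (\<lambda>p q. RR (\<lambda>r s. \<phi> (p * f (S s)) (A r q)))"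

text \<open>In \<open>comul_A\<close> the leg h_3 stands beside l_1 and h_2 acts on l_2.
  Intertwining with R exchanges the two, so h_1 and h_2 surround l_1 S(s) as an adjoint
  action.\<close>

lemma DR_A:
  assumes \<phi>: "bil L.sc L.sc t \<phi>"
  shows "DR (A h l) \<phi> = D h (\<lambda>a b. DR l (\<lambda>x y. \<phi> (A a x) (A b y)))"
proof -
  note [lin] = bilD[OF \<phi>]
  have "DR (A h l) \<phi> = D h (\<lambda>a b. D b (\<lambda>c d. L.D l (\<lambda>p q. RR (\<lambda>r s. \<phi> (f a * p * f (S d) * f (S s)) (A r (A c q))))))"
    by (rule comul_A; (rule lin)+)
  also have "\<dots> = D h (\<lambda>a b. L.D l (\<lambda>p q. RR (\<lambda>r s. D b (\<lambda>c d. \<phi> (f a * p * f (S (s * d))) (A (r * c) q)))))"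
    by (rule contract_cong, subst contract_swap, rule contract_cong, subst contract_swap)
      (simp add: S_mult A_mult mult.assoc)
  also have "\<dots> = D h (\<lambda>a b. L.D l (\<lambda>p q. RR (\<lambda>r s. D b (\<lambda>c d. \<phi> (f a * p * f (S (c * s))) (A (d * r) q)))))"
    by (rule contract_cong, rule contract_cong, rule R_comul[symmetric]; (rule lin)+)
  also have "\<dots> = D h (\<lambda>a b. D b (\<lambda>c d. L.D l (\<lambda>p q. RR (\<lambda>r s. \<phi> (f a * p * f (S (c * s))) (A (d * r) q)))))"
    by (subst (3) contract_swap, subst (2) contract_swap) (rule refl)
  also have "\<dots> = D h (\<lambda>a b. D a (\<lambda>c d. L.D l (\<lambda>p q. RR (\<lambda>r s. \<phi> (f c * p * f (S (d * s))) (A (b * r) q)))))"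
    by (rule coassoc[symmetric]; (rule lin)+)
  also have "\<dots> = D h (\<lambda>a b. L.D l (\<lambda>p q. RR (\<lambda>r s. D a (\<lambda>c d. \<phi> (f c * p * f (S (d * s))) (A (b * r) q)))))"
    by (subst (2) contract_swap, subst (3) contract_swap) (rule refl)
  also have "\<dots> = D h (\<lambda>a b. DR l (\<lambda>x y. \<phi> (A a x) (A b y)))"
    by (simp add: A_eq[of _ "_ * f _"] bil_contract1[OF \<phi>] S_mult A_mult mult.assoc)
  finally show ?thesis .
qed

text \<open>On the left the first hexagon resolves the coproduct of S(s); on the right
  \<open>DR_A\<close> creates a coproduct of r, which the second hexagon resolves. Both sides then
  contain three copies of R arranged as in \<open>X\<close>, and differ only in how l is
  comultiplied.\<close>

lemma DR_coassoc:
  assumes T: "tri L.sc L.sc L.sc t T"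
  shows "DR l (\<lambda>x y. DR x (\<lambda>u v. T u v y)) = DR l (\<lambda>x y. DR y (\<lambda>u v. T x u v))"
proof -
  note [lin] = tri1[OF T] tri2[OF T] tri3[OF T]
  have [lin]: "vector_space t" using T by (auto simp: tri_def Vector_Spaces.linear_iff)
  \<comment> \<open>The common normal form, trilinear in the legs of l so that coassociativity of L
    applies to it.\<close>
  define X where "X p q1 q2 = RR (\<lambda>a b. RR (\<lambda>c d. RR (\<lambda>r' s'.
      T (p * f (S (s' * b))) (A r' (q1 * f (S d))) (A (a * c) q2))))" for p q1 q2
  have X: "tri L.sc L.sc L.sc t X" unfolding X_def by (rule lin)+
  have "DR l (\<lambda>x y. DR x (\<lambda>u v. T u v y))
    = L.D l (\<lambda>p q. RR (\<lambda>r s. L.D p (\<lambda>p1 p2. L.D (f (S s)) (\<lambda>m1 m2. RR (\<lambda>r' s'.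
        T (p1 * m1 * f (S s')) (A r' (p2 * m2)) (A r q))))))"
    by (rule contract_cong, rule contract_cong, rule L.D_mult; (rule lin)+)
  also have "\<dots> = L.D l (\<lambda>p q. RR (\<lambda>r s. L.D p (\<lambda>p1 p2. D (S s) (\<lambda>m1 m2. RR (\<lambda>r' s'.
        T (p1 * f m1 * f (S s')) (A r' (p2 * f m2)) (A r q))))))"
    by (rule contract_cong, rule contract_cong, rule contract_cong, rule f_comul; (rule lin)+)
  also have "\<dots> = L.D l (\<lambda>p q. RR (\<lambda>r s. L.D p (\<lambda>p1 p2. D s (\<lambda>c d. RR (\<lambda>r' s'.
        T (p1 * f (S d) * f (S s')) (A r' (p2 * f (S c))) (A r q))))))"
    by (rule contract_cong, rule contract_cong, rule contract_cong, rule S_comul; (rule lin)+)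
  also have "\<dots> = L.D l (\<lambda>p q. L.D p (\<lambda>p1 p2. RR (\<lambda>r s. D s (\<lambda>c d. RR (\<lambda>r' s'.
        T (p1 * f (S d) * f (S s')) (A r' (p2 * f (S c))) (A r q))))))"
    by (rule contract_cong, rule contract_swap)
  also have "\<dots> = L.D l (\<lambda>p q. L.D p (\<lambda>p1 p2. RR (\<lambda>a b. RR (\<lambda>c d. RR (\<lambda>r' s'.
        T (p1 * f (S b) * f (S s')) (A r' (p2 * f (S d))) (A (a * c) q))))))"
    by (rule contract_cong, rule contract_cong, rule R_hexagon1; (rule lin)+)
  also have "\<dots> = L.D l (\<lambda>p q. L.D p (\<lambda>p1 p2. X p1 p2 q))"
    by (simp add: X_def S_mult mult.assoc)
  also have "\<dots> = L.D l (\<lambda>p q. L.D q (\<lambda>q1 q2. X p q1 q2))"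
    by (rule L.coassoc[OF X])
  finally have 1: "DR l (\<lambda>x y. DR x (\<lambda>u v. T u v y)) = L.D l (\<lambda>p q. L.D q (\<lambda>q1 q2. X p q1 q2))" .
  have "DR l (\<lambda>x y. DR y (\<lambda>u v. T x u v))
    = L.D l (\<lambda>p q. RR (\<lambda>r s. D r (\<lambda>a b. L.D q (\<lambda>q1 q2. RR (\<lambda>r' s'.
        T (p * f (S s)) (A a (q1 * f (S s'))) (A b (A r' q2)))))))"
    by (rule contract_cong, rule contract_cong, rule DR_A; (rule lin)+)
  also have "\<dots> = L.D l (\<lambda>p q. RR (\<lambda>a b. RR (\<lambda>c d. L.D q (\<lambda>q1 q2. RR (\<lambda>r' s'.
        T (p * f (S (b * d))) (A a (q1 * f (S s'))) (A c (A r' q2)))))))"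
    by (rule contract_cong, rule R_hexagon2; (rule lin)+)
  also have "\<dots> = L.D l (\<lambda>p q. L.D q (\<lambda>q1 q2. RR (\<lambda>a b. RR (\<lambda>c d. RR (\<lambda>r' s'.
        T (p * f (S (b * d))) (A a (q1 * f (S s'))) (A (c * r') q2))))))"
    by (rule contract_cong, subst (2) contract_swap, subst contract_swap) (simp only: A_mult)
  also have "\<dots> = L.D l (\<lambda>p q. L.D q (\<lambda>q1 q2. X p q1 q2))"
    unfolding X_def
    by (rule contract_cong, rule contract_cong, subst contract_swap, rule contract_cong, rule contract_swap)
  finally show ?thesis using 1 by simp
qed

text \<open>The action of 1 on the first leg surrounds it with the legs of a \<Delta>(1). Its
  H_t-leg slides through R onto l_2, which yields \<Delta>(1) \<Delta>(l). Hence the transmuted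
  coproduct takes values in V \<otimes> V.\<close>

lemma DR_V:
  assumes \<phi>: "bil L.sc L.sc t \<phi>" and l: "l \<in> V"
  shows "DR l (\<lambda>x y. \<phi> (A 1 x) (A 1 y)) = DR l \<phi>"
proof -
  note [lin] = bilD[OF \<phi>]
  have "DR l (\<lambda>x y. \<phi> (A 1 x) (A 1 y))
      = L.D l (\<lambda>p q. RR (\<lambda>r s. \<phi> (A 1 (p * f (S s))) (A r (A 1 q))))"
    by simp
  also have "\<dots> = D 1 (\<lambda>m n. L.D l (\<lambda>p q. RR (\<lambda>r s. \<phi> (f m * p * f (S (n * s))) (A r (A 1 q)))))"
    by (subst contract_swap, rule contract_cong, subst contract_swap, rule contract_cong)
      (simp add: A_eq[of 1 "_ * f _"] bil_contract1[OF \<phi>] S_mult mult.assoc)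
  also have "\<dots> = D 1 (\<lambda>m n. L.D l (\<lambda>p q. RR (\<lambda>r s. \<phi> (f m * p * f (S s)) (A r (A 1 (f n * q))))))"
  proof (rule one_es_et)
    fix y z assume z: "z \<in> Ht"
    have "RR (\<lambda>r s. \<phi> (f y * p * f (S (z * s))) (A r (A 1 q))) = RR (\<lambda>r s. \<phi> (f y * p * f (S s)) (A (r * z) (A 1 q)))" for p q
      by (rule R_slide_Ht[OF _ z]; (rule lin)+)
    then show "L.D l (\<lambda>p q. RR (\<lambda>r s. \<phi> (f y * p * f (S (z * s))) (A r (A 1 q))))
      = L.D l (\<lambda>p q. RR (\<lambda>r s. \<phi> (f y * p * f (S s)) (A r (A 1 (f z * q)))))"
      by (simp only: A_mult A_Ht[OF z] A_one_Ht[OF z] A_A_one)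
  qed (rule lin)+
  also have "\<dots> = L.D 1 (\<lambda>m n. L.D l (\<lambda>p q. RR (\<lambda>r s. \<phi> (m * p * f (S s)) (A r (n * q)))))"
    unfolding A_A_one by (rule L_one[symmetric]; (rule lin)+)
  also have "\<dots> = DR l \<phi>"
    by (rule L.one_comul; (rule lin)+)
  finally show ?thesis .
qed

text \<open>This plays for the transmuted coproduct the role that \<open>one_es_et\<close> plays for
  \<Delta>(1).\<close>

lemma DR_cong_V:
  assumes "bil L.sc L.sc t \<phi>" "bil L.sc L.sc t \<psi>" "l \<in> V" "\<And>x y. x \<in> V \<Longrightarrow> y \<in> V \<Longrightarrow> \<phi> x y = \<psi> x y"
  shows "DR l \<phi> = DR l \<psi>"
proof -
  have "DR l (\<lambda>x y. \<phi> (A 1 x) (A 1 y)) = DR l (\<lambda>x y. \<psi> (A 1 x) (A 1 y))"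
    by (intro contract_cong assms(4) A_V)
  then show ?thesis unfolding DR_V[OF assms(1,3)] DR_V[OF assms(2,3)] .
qed

text \<open>The R of the braiding and the one in the coproduct of l fuse by the first hexagon, and
  \<open>V_S\<close> reduces them to a single R with S(s) moved to the right of u. That R fuses with
  the one in the coproduct of m by the second hexagon into an action on the product of second
  legs.\<close>

lemma DR_mult:
  assumes \<phi>: "bil L.sc L.sc t \<phi>" and l: "l \<in> V" and m: "m \<in> V"
  shows "DR l (\<lambda>x y. DR m (\<lambda>u v. RR (\<lambda>r s. \<phi> (x * A s u) (A r y * v)))) = DR (l * m) \<phi>"
proof -
  note [lin] = bilD[OF \<phi>]
  have "DR l (\<lambda>x y. DR m (\<lambda>u v. RR (\<lambda>r s. \<phi> (x * A s u) (A r y * v))))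
    = L.D l (\<lambda>p q. RR (\<lambda>r' s'. DR m (\<lambda>u v. RR (\<lambda>r s. \<phi> (p * f (S s') * A s u) (A (r * r') q * v)))))"
    by (simp only: A_mult)
  also have "\<dots> = L.D l (\<lambda>p q. DR m (\<lambda>u v. RR (\<lambda>r' s'. RR (\<lambda>r s. \<phi> (p * f (S s') * A s u) (A (r * r') q * v)))))"
    by (rule contract_cong, subst contract_swap, rule contract_cong, rule contract_swap)
  \<comment> \<open>\<open>V_S\<close> applies to u in V; \<open>DR_cong_V\<close> permits this
    assumption on the legs of the transmuted coproduct of m.\<close>
  also have "\<dots> = L.D l (\<lambda>p q. DR m (\<lambda>u v. RR (\<lambda>r s. \<phi> (p * (u * f (S s))) (A r q * v))))"
  proof (rule contract_cong, rule DR_cong_V[OF _ _ m])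
    fix p q u v assume u: "u \<in> V"
    have "RR (\<lambda>r' s'. RR (\<lambda>r s. \<phi> (p * f (S s') * A s u) (A (r * r') q * v)))
        = RR (\<lambda>a b. RR (\<lambda>c d. \<phi> (p * f (S d) * A b u) (A (a * c) q * v)))"
      by (rule contract_swap)
    also have "\<dots> = RR (\<lambda>a b. D b (\<lambda>c d. \<phi> (p * f (S c) * A d u) (A a q * v)))"
      by (rule R_hexagon1[symmetric]; (rule lin)+)
    also have "\<dots> = RR (\<lambda>r s. \<phi> (p * (u * f (S s))) (A r q * v))"
      by (simp add: V_S[OF u, symmetric] contract_mult_left mult.assoc bil_contract1[OF \<phi>])
    finally show "RR (\<lambda>r' s'. RR (\<lambda>r s. \<phi> (p * f (S s') * A s u) (A (r * r') q * v)))
        = RR (\<lambda>r s. \<phi> (p * (u * f (S s))) (A r q * v))" .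
  qed (rule lin)+
  also have "\<dots> = L.D l (\<lambda>p q. L.D m (\<lambda>m1 m2. RR (\<lambda>r' s'. RR (\<lambda>r s. \<phi> (p * m1 * f (S (s * s'))) (A r q * A r' m2)))))"
    by (simp add: S_mult mult.assoc)
  also have "\<dots> = L.D l (\<lambda>p q. L.D m (\<lambda>m1 m2. RR (\<lambda>r s. RR (\<lambda>r' s'. \<phi> (p * m1 * f (S (s * s'))) (A r q * A r' m2)))))"
    by (rule contract_cong, rule contract_cong, rule contract_swap)
  also have "\<dots> = L.D l (\<lambda>p q. L.D m (\<lambda>m1 m2. RR (\<lambda>r s. D r (\<lambda>c d. \<phi> (p * m1 * f (S s)) (A c q * A d m2)))))"
    by (rule contract_cong, rule contract_cong, rule R_hexagon2[symmetric]; (rule lin)+)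
  \<comment> \<open>The leg q is projected to V so that \<open>A_mult_V\<close> applies;
    \<open>comul_V\<close> removes the projection afterwards.\<close>
  also have "\<dots> = L.D l (\<lambda>p q. L.D m (\<lambda>m1 m2. RR (\<lambda>r s. D r (\<lambda>c d. \<phi> (p * m1 * f (S s)) (A c (A 1 q) * A d m2)))))"
    by simp
  also have "\<dots> = L.D l (\<lambda>p q. L.D m (\<lambda>m1 m2. RR (\<lambda>r s. \<phi> (p * m1 * f (S s)) (A r (A 1 q * m2)))))"
    by (simp only: A_mult_V[OF A_V] bil_contract2[OF \<phi>])
  also have "\<dots> = L.D l (\<lambda>p q. L.D m (\<lambda>m1 m2. RR (\<lambda>r s. \<phi> (p * m1 * f (S s)) (A r (q * m2)))))"
    by (rule comul_V[OF _ l]; (rule lin)+)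
  also have "\<dots> = DR (l * m) \<phi>"
    by (rule L.D_mult[symmetric]; (rule lin)+)
  finally show ?thesis .
qed

section \<open>The counit\<close>

abbreviation "cR \<equiv> counit_R H L f"

lemma cR_eq: "cR l = D 1 (\<lambda>a b. sc (L.\<epsilon> (f a * l)) b)"
  by (simp add: counit_R_def)

lemma lin_cR [lin]: "klin s L.sc g \<Longrightarrow> klin s sc (\<lambda>x. cR (g x))"
  unfolding cR_eq
  by (rule klin_contract_fun) (auto intro!: klin_scale_fun[OF vs] L.lin_counit L.lin_mult2 vs dest: klin_vs)

lemma cR_Ht [simp]: "cR l \<in> Ht"
proof -
  have "et (cR l) = D 1 (\<lambda>a b. et (sc (L.\<epsilon> (f a * l)) b))"
    unfolding cR_eq by (rule klin_contract; (rule lin)+)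
  also have "\<dots> = cR l"
    unfolding cR_eq
    by (rule one_es_et; ((rule lin)+ | simp add: klin_scale[OF lin_et[OF klin_id[OF vs]]] Ht_def))
  finally show ?thesis by (simp add: Ht_def)
qed

text \<open>The counit has its values in H. Composed with f it becomes the target map of L, to which
  the identities of L apply.\<close>

lemma f_cR: "f (cR l) = L.et l"
proof -
  have "L.et l = D 1 (\<lambda>a b. L.sc (L.\<epsilon> (f a * l)) (f b))"
    unfolding L.et_eq by (rule L_one; (rule lin)+)
  then show ?thesis by (simp add: cR_eq f_contract)
qed

text \<open>This characterizes \<open>cR l\<close> among the elements of \<open>H\<^sub>t\<close>, see \<open>cR_eqI\<close>.\<close>

lemma eps_cR: "L.\<epsilon> (f h * l) = \<epsilon> (h * cR l)"
proof -
  have "L.\<epsilon> (f h * l) = L.D 1 (\<lambda>a b. L.\<epsilon> (f h * b) * L.\<epsilon> (a * l))"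
    using L.eps_mult2[of "f h" 1 l] by simp
  also have "\<dots> = D 1 (\<lambda>a b. L.\<epsilon> (f h * f b) * L.\<epsilon> (f a * l))"
    by (rule L_one; (rule lin)+)
  also have "\<dots> = \<epsilon> (h * cR l)"
    by (simp add: cR_eq contract_mult_left counit_contract sc_mult(2)[symmetric] f_mult[symmetric] mult.commute del: f_mult)
  finally show ?thesis .
qed

lemma cR_eqI: "w \<in> Ht \<Longrightarrow> (\<And>h. L.\<epsilon> (f h * l) = \<epsilon> (h * w)) \<Longrightarrow> cR l = w"
  by (simp add: cR_eq et_eq[symmetric] Ht_def)

lemma eps_f_S_Hs: "y \<in> Hs \<Longrightarrow> L.\<epsilon> (g * f (S y)) = L.\<epsilon> (g * f y)"
  by (simp add: f_S[symmetric] L.eps_S_Hs)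

text \<open>Under the counit of L the factor b may be replaced by et(b) = f(S y), and S may then be
  dropped. The element f y commutes with a and joins h.\<close>

lemma cR_mult:
  assumes a: "a \<in> V" and b: "b \<in> V"
  shows "cR (a * b) = cR a * cR b"
proof (rule cR_eqI)
  show "cR a * cR b \<in> Ht" by simp
  fix h
  obtain y where y: "y \<in> Hs" "cR b = S y" using Ht_S_Hs[OF cR_Ht] by blast
  have "L.\<epsilon> (f h * (a * b)) = L.\<epsilon> (f h * a * f (S y))"
    by (simp add: mult.assoc L.eps_et[of "f h * a" b, symmetric, unfolded mult.assoc] f_cR[symmetric] y)
  also have "\<dots> = L.\<epsilon> (f (h * y) * a)"
    by (simp add: eps_f_S_Hs[OF y(1), of "f h * a"], simp add: V_comm[OF a y(1)] mult.assoc)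
  also have "\<dots> = \<epsilon> (h * (y * cR a))"
    by (simp only: eps_cR mult.assoc)
  also have "\<dots> = \<epsilon> (h * cR a * y)"
    by (simp add: Hs_Ht_commute[OF y(1) cR_Ht] mult.assoc)
  also have "\<dots> = \<epsilon> (h * (cR a * cR b))"
    by (simp add: y eps_S_Hs mult.assoc[symmetric])
  finally show "L.\<epsilon> (f h * (a * b)) = \<epsilon> (h * (cR a * cR b))" .
qed

text \<open>The factor S(h_2) stands last under the counit, so it may be replaced by et(S(h_2)) =
  S(es(h_2)). This trades the coproduct of h for \<Delta>(1), which acts trivially on l.\<close>

lemma cR_A:
  assumes l: "l \<in> V"
  shows "cR (A h l) = et (h * cR l)"
proof (rule cR_eqI)
  fix g
  have "L.\<epsilon> (f g * A h l) = D h (\<lambda>a b. L.\<epsilon> (f (g * a) * l * f (S b)))"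
    by (simp add: A_eq contract_mult_left L.counit_contract mult.assoc)
  also have "\<dots> = D h (\<lambda>a b. L.\<epsilon> (f (g * a) * l * f (S (es b))))"
    by (simp add: et_S[symmetric] f_et L.eps_et)
  also have "\<dots> = D 1 (\<lambda>a b. L.\<epsilon> (f (g * (h * a)) * l * f (S (S b))))"
    by (rule comul_es'; (rule lin)+)
  also have "\<dots> = D 1 (\<lambda>a b. L.\<epsilon> (f (g * (h * a)) * l * f (S b)))"
    by (rule one_es_et; ((rule lin)+ | simp add: eps_f_S_Hs))
  also have "\<dots> = L.\<epsilon> (f (g * h) * A 1 l)"
    by (simp add: A_eq contract_mult_left L.counit_contract mult.assoc)
  also have "\<dots> = \<epsilon> (g * et (h * cR l))"
    by (simp only: A_one[OF l] eps_cR mult.assoc eps_et)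
  finally show "L.\<epsilon> (f g * A h l) = \<epsilon> (g * et (h * cR l))" .
qed simp

lemma L_et_f_S: "y \<in> Hs \<Longrightarrow> L.et (g * f (S y)) = L.et (g * f y)"
  by (simp only: L.et_eq mult.assoc[symmetric] eps_f_S_Hs)

text \<open>The target map sees S(s) only through S(es(s)), so \<open>R_es\<close> replaces R by
  \<Delta>(1). Its flip is absorbed by \<Delta>(l), which leaves et(l_1) l_2 = l.\<close>

lemma DR_counit1:
  assumes l: "l \<in> V"
  shows "DR l (\<lambda>x y. f (cR x) * y) = l"
proof -
  have "DR l (\<lambda>x y. f (cR x) * y) = L.D l (\<lambda>p q. RR (\<lambda>r s. L.et (p * f (S (es s))) * A r q))"
    by (simp add: f_cR et_S[symmetric] f_et L.et_mult_et)
  also have "\<dots> = L.D l (\<lambda>p q. D 1 (\<lambda>a b. L.et (p * f (S (S b))) * A a q))"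
    by (rule contract_cong, rule R_es; (rule lin)+)
  also have "\<dots> = L.D l (\<lambda>p q. D 1 (\<lambda>a b. L.et (p * f (S (S b))) * A a (A 1 q)))"
    by simp
  also have "\<dots> = L.D l (\<lambda>p q. D 1 (\<lambda>a b. L.et (p * f (S b)) * (A 1 q * f (S a))))"
    by (rule contract_cong, rule one_es_et; ((rule lin)+ | simp add: L_et_f_S A_Hs del: A_A_one))
  also have "\<dots> = L.D l (\<lambda>p q. D 1 (\<lambda>a b. L.et (p * f (S b)) * (q * f (S a))))"
    by (rule comul_V[OF _ l]; (rule lin)+)
  also have "\<dots> = L.D l (\<lambda>p q. D 1 (\<lambda>a b. L.et (p * f a) * (q * f b)))"
    by (rule contract_cong, rule one_flip[where \<phi> = "\<lambda>a b. L.et (p * f b) * (q * f a)" for p q]; (rule lin)+)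
  also have "\<dots> = L.D l (\<lambda>p q. L.D 1 (\<lambda>a b. L.et (p * a) * (q * b)))"
    by (rule contract_cong, rule L_one[symmetric]; (rule lin)+)
  also have "\<dots> = L.D l (\<lambda>p q. L.et p * q)"
    by (rule L.comul_one; (rule lin)+)
  finally show ?thesis by (simp add: L.et_id)
qed

text \<open>By \<open>cR_A\<close>, et(r \<cdot> l_2) depends only on et(l_2), so the coproduct of l
  becomes 1_1 l \<otimes> 1_2. After 1_2 has slid through R, the leg r occurs only under
  \<open>et\<close>, R becomes the flipped \<Delta>(1), and the rest is 1_1 l S(1_2), the action of
  1 on l.\<close>

lemma DR_counit2:
  assumes l: "l \<in> V"
  shows "DR l (\<lambda>x y. x * f (cR y)) = l"
proof -
  have et: "L.et (A h q) = L.et (f h * L.et q)" if "q \<in> V" for h q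
    using arg_cong[OF cR_A[OF that, of h], of f] by (simp add: f_cR f_et)
  have "DR l (\<lambda>x y. x * f (cR y)) = L.D l (\<lambda>p q. RR (\<lambda>r s. p * f (S s) * L.et (A r (A 1 q))))"
    by (simp add: f_cR)
  also have "\<dots> = L.D l (\<lambda>p q. RR (\<lambda>r s. p * f (S s) * L.et (f r * L.et (A 1 q))))"
    by (simp only: et[OF A_one_V])
  also have "\<dots> = L.D l (\<lambda>p q. RR (\<lambda>r s. p * f (S s) * L.et (f r * L.et q)))"
    by (rule comul_V[OF _ l]; (rule lin)+)
  also have "\<dots> = L.D 1 (\<lambda>a b. RR (\<lambda>r s. a * l * f (S s) * L.et (f r * b)))"
    by (rule L.comul_et; (rule lin)+)
  also have "\<dots> = D 1 (\<lambda>a b. RR (\<lambda>r s. f a * l * f (S s) * L.et (f r * f b)))"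
    by (rule L_one; (rule lin)+)
  also have "\<dots> = D 1 (\<lambda>a b. RR (\<lambda>r s. f a * l * f (S (b * s)) * f (et r)))"
  proof (rule one_es_et)
    fix y z assume z: "z \<in> Ht"
    have "RR (\<lambda>r s. f y * l * f (S (z * s)) * f (et r)) = RR (\<lambda>r s. f y * l * f (S s) * f (et (r * z)))"
      by (rule R_slide_Ht[OF _ z]; (rule lin)+)
    then show "RR (\<lambda>r s. f y * l * f (S s) * L.et (f r * f z)) = RR (\<lambda>r s. f y * l * f (S (z * s)) * f (et r))"
      by (simp add: f_et)
  qed (rule lin)+
  also have "\<dots> = D 1 (\<lambda>a b. D 1 (\<lambda>c d. f a * l * f (S (b * c)) * f d))"
    by (rule contract_cong, rule R_et; (rule lin)+)
  also have "\<dots> = D 1 (\<lambda>a b. D 1 (\<lambda>c d. f a * l * f (S c * d) * f (S b)))"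
  proof (rule one_es_et)
    fix y z assume z: "z \<in> Ht"
    show "D 1 (\<lambda>c d. f y * l * f (S (z * c)) * f d) = D 1 (\<lambda>c d. f y * l * f (S c * d) * f (S z))"
    proof (rule one_es_et)
      fix y' z' assume z': "z' \<in> Ht"
      have "S z * z' = z' * S z" by (rule Hs_Ht_commute) (simp_all add: z z')
      then show "f y * l * f (S (z * y')) * f z' = f y * l * f (S y' * z') * f (S z)"
        by (simp add: mult.assoc S_mult f_mult[symmetric] del: f_mult)
    qed (rule lin)+
  qed (rule lin)+
  also have "\<dots> = D 1 (\<lambda>a b. f a * l * f (D 1 (\<lambda>c d. S c * d)) * f (S b))"
    by (simp only: f_contract contract_mult_left contract_mult_right)
  also have "\<dots> = A 1 l" by (simp add: S_id A_eq)
  finally show ?thesis by (simp add: A_one[OF l])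
qed

text \<open>The normal form in which the coproduct of the unit map is compared with
  \<open>f_tens_f\<close>. The action of r on f z is f(et(r z)), so once z has slid away R
  contributes only its value from \<open>R_et\<close>.\<close>

lemma DR_f:
  assumes \<phi>: "bil L.sc L.sc t \<phi>" and u: "u \<in> Ht"
  shows "DR (f u) \<phi> = D 1 (\<lambda>a b. \<phi> (f (u * S a)) (f b))"
proof -
  note [lin] = bilD[OF \<phi>]
  have "DR (f u) \<phi> = D u (\<lambda>p q. RR (\<lambda>r s. \<phi> (f p * f (S s)) (A r (f q))))"
    by (rule f_comul; (rule lin)+)
  also have "\<dots> = D 1 (\<lambda>p q. RR (\<lambda>r s. \<phi> (f (u * p) * f (S s)) (A r (f q))))"
    by (rule comul_Ht(2)[OF _ u]; (rule lin)+)
  also have "\<dots> = D 1 (\<lambda>p q. RR (\<lambda>r s. \<phi> (f (u * p * S (q * s))) (f (et r))))"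
  proof (rule one_es_et)
    fix y z assume z: "z \<in> Ht"
    have "RR (\<lambda>r s. \<phi> (f (u * y * S (z * s))) (f (et r))) = RR (\<lambda>r s. \<phi> (f (u * y * S s)) (f (et (r * z))))"
      by (rule R_slide_Ht[OF _ z]; (rule lin)+)
    then show "RR (\<lambda>r s. \<phi> (f (u * y) * f (S s)) (A r (f z))) = RR (\<lambda>r s. \<phi> (f (u * y * S (z * s))) (f (et r)))"
      by (simp add: A_f[OF z])
  qed (rule lin)+
  also have "\<dots> = D 1 (\<lambda>p q. D 1 (\<lambda>a b. \<phi> (f (u * p * S (q * a))) (f b)))"
    by (rule contract_cong, rule R_et; (rule lin)+)
  also have "\<dots> = D 1 (\<lambda>p q. D 1 (\<lambda>a b. \<phi> (f (u * (S a * (p * S q)))) (f b)))"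
  proof (rule one_es_et)
    fix y z assume y: "y \<in> Hs"
    show "D 1 (\<lambda>a b. \<phi> (f (u * y * S (z * a))) (f b)) = D 1 (\<lambda>a b. \<phi> (f (u * (S a * (y * S z)))) (f b))"
    proof (rule one_es_et)
      fix y' z' assume y': "y' \<in> Hs"
      have "y * S y' = S y' * y" by (rule Hs_Ht_commute) (simp_all add: y y')
      then have "u * y * S (z * y') = u * (S y' * (y * S z))"
        by (simp add: S_mult mult.assoc) (simp add: mult.assoc[symmetric])
      then show "\<phi> (f (u * y * S (z * y'))) (f z') = \<phi> (f (u * (S y' * (y * S z)))) (f z')"
        by simp
    qed (rule lin)+
  qed (rule lin)+
  also have "\<dots> = D 1 (\<lambda>a b. \<phi> (f (u * (S a * D 1 (\<lambda>p q. p * S q)))) (f b))"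
    by (subst contract_swap) (simp only: contract_mult_left f_contract bil_contract1[OF \<phi>])
  also have "\<dots> = D 1 (\<lambda>a b. \<phi> (f (u * S a)) (f b))" by (simp add: id_S)
  finally show ?thesis .
qed

text \<open>With w = S(y), et(1_2 w) = 1_2 S(y), and S(y) slides to the first leg, where S(1_1 y) =
  w S(1_1).\<close>

lemma f_tens_f:
  assumes \<phi>: "bil L.sc L.sc t \<phi>" and z: "z \<in> Ht" and w: "w \<in> Ht"
  shows "D 1 (\<lambda>a b. \<phi> (f (et (a * z))) (f (et (b * w)))) = D 1 (\<lambda>a b. \<phi> (f (z * w * S a)) (f b))"
proof -
  note [lin] = bilD[OF \<phi>]
  obtain y where y: "y \<in> Hs" "w = S y" using Ht_S_Hs[OF w] by blast
  have "D 1 (\<lambda>a b. \<phi> (f (et (a * z))) (f (et (b * w)))) = D 1 (\<lambda>a b. \<phi> (f (z * S a)) (f (b * S y)))"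
  proof (rule one_es_et)
    fix a b assume a: "a \<in> Hs" and b: "b \<in> Ht"
    have "et (a * z) = z * S a" using Hs_Ht_commute[OF a z] et_Ht_mult[OF z, of a] S_Hs[OF a] by simp
    moreover have "et (b * w) = b * S y" using et_Ht_mult[OF b, of w] w y by (simp add: Ht_def)
    ultimately show "\<phi> (f (et (a * z))) (f (et (b * w))) = \<phi> (f (z * S a)) (f (b * S y))" by simp
  qed (rule lin)+
  also have "\<dots> = D 1 (\<lambda>a b. \<phi> (f (z * S (a * y))) (f b))"
    by (rule one_slide_Hs[symmetric, OF _ y(1)]; (rule lin)+)
  finally show ?thesis by (simp add: y S_mult mult.assoc)
qed

section \<open>The antipode\<close>

abbreviation "SR \<equiv> antipode_R H R L f"

lemma SR_eq: "SR l = RR (\<lambda>r s. f s * L.S (A r l))"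
  by (simp add: antipode_R_def)

lemma lin_SR [lin]: "klin s L.sc g \<Longrightarrow> klin s L.sc (\<lambda>x. SR (g x))"
  unfolding SR_eq
  by (rule klin_contract_fun) (auto intro!: L.lin_mult2 L.lin_S lin_A2 L.vs dest: klin_vs)

text \<open>The factor S(z) in front of s moves to the first leg of R as z, acts there as left
  multiplication by f z, and \<open>L.S\<close> returns it on the right.\<close>

lemma SR_V [simp]: "SR l \<in> V"
  unfolding V_def
proof (intro CollectI ballI)
  fix y assume "y \<in> Hs"
  then obtain z where z: "z \<in> Ht" "y = S z" using Hs_S_Ht by blast
  have "f y * SR l = RR (\<lambda>r s. f (S z * s) * L.S (A r l))"
    by (simp add: SR_eq contract_mult_left z mult.assoc)
  also have "\<dots> = RR (\<lambda>r s. f s * L.S (A (z * r) l))"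
    by (rule R_S_Ht[OF _ z(1)]; (rule lin)+)
  also have "\<dots> = SR l * f y"
    by (simp add: A_mult A_Ht[OF z(1)] L.S_mult f_S z SR_eq contract_mult_right mult.assoc)
  finally show "SR l * f y = f y * SR l" ..
qed

text \<open>\<open>V_move\<close> turns f(h_2) times r \<cdot> l into h_2 r \<cdot> l times f(h_3).
  Intertwining h_1 and h_2 with R brings a leg of h next to S(h_3), they form \<open>et\<close>, and
  R absorbs the resulting \<Delta>(1).\<close>

lemma SR_A: "SR (A h l) = A h (SR l)"
proof -
  have "A h (SR l) = D h (\<lambda>a b. RR (\<lambda>r s. f (a * s) * L.S (f b * A r l)))"
    by (simp add: A_eq[of h] SR_eq contract_mult_left contract_mult_right L.S_mult f_S mult.assoc)
  also have "\<dots> = RR (\<lambda>r s. D h (\<lambda>a b. D b (\<lambda>c d. f (a * s) * L.S (A (c * r) l * f d))))"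
    by (subst contract_swap) (simp add: V_move[OF A_V, symmetric] contract_mult_left L.S_contract A_mult)
  also have "\<dots> = RR (\<lambda>r s. D h (\<lambda>a b. D a (\<lambda>c d. f (c * s) * L.S (A (d * r) l * f b))))"
    by (rule contract_cong, rule coassoc[symmetric]; (rule lin)+)
  also have "\<dots> = D h (\<lambda>a b. RR (\<lambda>r s. D a (\<lambda>c d. f (c * s) * L.S (A (d * r) l * f b))))"
    by (rule contract_swap)
  also have "\<dots> = D h (\<lambda>a b. RR (\<lambda>r s. D a (\<lambda>c d. f (s * d) * L.S (A (r * c) l * f b))))"
    by (rule contract_cong, rule R_comul; (rule lin)+)
  also have "\<dots> = RR (\<lambda>r s. D h (\<lambda>a b. D a (\<lambda>c d. f (s * d * S b) * L.S (A (r * c) l))))"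
    by (subst contract_swap) (simp add: L.S_mult f_S mult.assoc)
  also have "\<dots> = RR (\<lambda>r s. D h (\<lambda>a b. D b (\<lambda>c d. f (s * c * S d) * L.S (A (r * a) l))))"
    by (rule contract_cong, rule coassoc; (rule lin)+)
  also have "\<dots> = RR (\<lambda>r s. D h (\<lambda>a b. f (s * et b) * L.S (A (r * a) l)))"
    by (simp add: id_S[symmetric] f_contract contract_mult_left contract_mult_right mult.assoc)
  also have "\<dots> = RR (\<lambda>r s. D 1 (\<lambda>a b. f (s * b) * L.S (A (r * (a * h)) l)))"
    by (rule contract_cong, rule comul_et; (rule lin)+)
  also have "\<dots> = RR (\<lambda>r s. f s * L.S (A (r * h) l))"
    unfolding mult.assoc[symmetric] by (rule R_one[where \<phi> = "\<lambda>r s. f s * L.S (A (r * h) l)"]; (rule lin)+)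
  also have "\<dots> = SR (A h l)" by (simp add: SR_eq A_mult)
  finally show ?thesis ..
qed

text \<open>As l commutes with f(1_1), the counit can be taken on either side of l; the flip of
  \<Delta>(1) does the rest. It is needed because S(l_1) l_2 in the left antipode axiom is es(l),
  while the counit gives et(l).\<close>

lemma es_V:
  assumes l: "l \<in> V"
  shows "L.es l = f (S (cR l))"
proof -
  have "f (S (cR l)) = D 1 (\<lambda>a b. L.sc (L.\<epsilon> (f a * l)) (f (S b)))"
    by (simp add: cR_eq S_contract f_contract)
  also have "\<dots> = D 1 (\<lambda>a b. L.sc (L.\<epsilon> (l * f (S a))) (f (S b)))"
    by (rule one_es_et; ((rule lin)+ | simp add: V_comm[OF l, symmetric] eps_f_S_Hs))
  also have "\<dots> = D 1 (\<lambda>a b. L.sc (L.\<epsilon> (l * f b)) (f a))"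
    by (rule one_flip; (rule lin)+)
  also have "\<dots> = L.es l"
    unfolding L.es_eq by (rule L_one[symmetric]; (rule lin)+)
  finally show ?thesis ..
qed

text \<open>The antipode of l_1 S(s) begins with S^2(s). The second hexagon splits the R of
  \<open>SR\<close>, one copy sums to v, and v S^2(s) = s v restores a product that the hexagon
  folds back. \<open>V_S\<close> brings S(l_1) and l_2 together as es(l), and
  \<open>R_drinfeld_inv\<close> removes the remaining R.\<close>

lemma SR_left:
  assumes l: "l \<in> V"
  shows "DR l (\<lambda>x y. SR x * y) = f (cR l)"
proof -
  have 1: "L.S (A r (p * m)) = D r (\<lambda>a b. f (S (S b)) * L.S m * L.S p * f (S a))" for r p m
    by (simp add: A_eq L.S_contract L.S_mult f_S mult.assoc)
  have "DR l (\<lambda>x y. SR x * y) = L.D l (\<lambda>p q. RR (\<lambda>r s. RR (\<lambda>r' s'. D r' (\<lambda>a b.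
      f s' * f (S (S b)) * f (S (S s)) * L.S p * f (S a) * A r q))))"
    by (simp add: SR_eq 1 f_S contract_mult_right contract_mult_left mult.assoc)
  also have "\<dots> = L.D l (\<lambda>p q. RR (\<lambda>r s. RR (\<lambda>r' s'. RR (\<lambda>a b.
      f (s' * b) * f (S (S a)) * f (S (S s)) * L.S p * f (S r') * A r q))))"
    by (rule contract_cong, rule contract_cong, rule R_hexagon2; (rule lin)+)
  also have "\<dots> = L.D l (\<lambda>p q. RR (\<lambda>r s. RR (\<lambda>r' s'. f (s' * (drinfeld_inv * S (S s))) * L.S p * f (S r') * A r q)))"
    by (simp add: drinfeld_inv_def f_contract contract_mult_left contract_mult_right mult.assoc)
  \<comment> \<open>Moving v to the right replaces S^2(s) by s, and s' s is the product of second
    legs occurring in the second hexagon.\<close>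
  also have "\<dots> = L.D l (\<lambda>p q. RR (\<lambda>r' s'. RR (\<lambda>r s. f (s' * s * drinfeld_inv) * L.S p * f (S r') * A r q)))"
    by (subst (2) contract_swap) (simp only: drinfeld_inv_S_S mult.assoc)
  also have "\<dots> = L.D l (\<lambda>p q. RR (\<lambda>r s. D r (\<lambda>a b. f (s * drinfeld_inv) * L.S p * f (S a) * A b q)))"
    by (rule contract_cong, rule R_hexagon2[symmetric]; (rule lin)+)
  also have "\<dots> = L.D l (\<lambda>p q. RR (\<lambda>r s. D r (\<lambda>a b. f (s * drinfeld_inv) * L.S p * f (S a) * A b (A 1 q))))"
    by simp
  also have "\<dots> = L.D l (\<lambda>p q. RR (\<lambda>r s. f (s * drinfeld_inv) * L.S p * (A 1 q * f (S r))))"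
    by (simp only: V_S[OF A_one_V, symmetric] contract_mult_left mult.assoc)
  also have "\<dots> = L.D l (\<lambda>p q. RR (\<lambda>r s. f (s * drinfeld_inv) * L.S p * (q * f (S r))))"
    by (rule comul_V[OF _ l]; (rule lin)+)
  also have "\<dots> = RR (\<lambda>r s. f (s * drinfeld_inv) * L.es l * f (S r))"
    by (subst contract_swap) (simp add: L.S_id[symmetric] contract_mult_left contract_mult_right mult.assoc)
  also have "\<dots> = RR (\<lambda>r s. f (s * drinfeld_inv * S (r * cR l)))"
    by (simp add: es_V[OF l] S_mult mult.assoc)
  \<comment> \<open>As an element of H_t, \<open>cR l\<close> slides from behind r to the front of
    s, out of the sum.\<close>
  also have "\<dots> = RR (\<lambda>r s. f (cR l * s * drinfeld_inv * S r))"
    by (rule R_slide_Ht[symmetric, OF _ cR_Ht]; (rule lin)+)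
  also have "\<dots> = f (cR l * RR (\<lambda>r s. s * drinfeld_inv * S r))"
    by (simp only: f_contract contract_mult_left mult.assoc)
  also have "\<dots> = f (cR l)" by (simp add: R_drinfeld_inv)
  finally show ?thesis .
qed

text \<open>The first hexagon fuses both copies of R, whose second legs meet as S(s_1) s_2 = es(s).
  By \<open>R_es\<close> only \<Delta>(1) remains, and its flip is absorbed into l_1 S(l_2) =
  et(l).\<close>

lemma SR_right:
  assumes l: "l \<in> V"
  shows "DR l (\<lambda>x y. x * SR y) = f (cR l)"
proof -
  have "DR l (\<lambda>x y. x * SR y) = L.D l (\<lambda>p q. RR (\<lambda>r s. RR (\<lambda>r' s'. p * f (S s) * f s' * L.S (A (r' * r) q))))"
    by (simp add: SR_eq contract_mult_left A_mult mult.assoc)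
  also have "\<dots> = L.D l (\<lambda>p q. RR (\<lambda>a b. RR (\<lambda>c d. p * f (S d) * f b * L.S (A (a * c) q))))"
    by (rule contract_cong, rule contract_swap)
  also have "\<dots> = L.D l (\<lambda>p q. RR (\<lambda>a b. D b (\<lambda>c d. p * f (S c) * f d * L.S (A a q))))"
    by (rule contract_cong, rule R_hexagon1[symmetric]; (rule lin)+)
  also have "\<dots> = L.D l (\<lambda>p q. RR (\<lambda>a b. p * f (es b) * L.S (A a q)))"
    by (simp add: S_id[symmetric] f_contract contract_mult_left contract_mult_right mult.assoc)
  also have "\<dots> = L.D l (\<lambda>p q. D 1 (\<lambda>a b. p * f (S b) * L.S (A a q)))"
    by (rule contract_cong, rule R_es; (rule lin)+)
  also have "\<dots> = L.D l (\<lambda>p q. D 1 (\<lambda>a b. p * f (S b) * L.S (A a (A 1 q))))"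
    by simp
  also have "\<dots> = L.D l (\<lambda>p q. D 1 (\<lambda>a b. p * f (S b) * L.S (A 1 q * f (S a))))"
    by (rule contract_cong, rule one_es_et; ((rule lin)+ | simp add: A_Hs del: A_A_one))
  also have "\<dots> = L.D l (\<lambda>p q. D 1 (\<lambda>a b. p * f (S b) * L.S (q * f (S a))))"
    by (rule comul_V[OF _ l]; (rule lin)+)
  also have "\<dots> = L.D l (\<lambda>p q. D 1 (\<lambda>a b. p * f a * L.S (q * f b)))"
    by (rule contract_cong, rule one_flip[where \<phi> = "\<lambda>a b. p * f b * L.S (q * f a)" for p q]; (rule lin)+)
  also have "\<dots> = L.D l (\<lambda>p q. L.D 1 (\<lambda>a b. p * a * L.S (q * b)))"
    by (rule contract_cong, rule L_one[symmetric]; (rule lin)+)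
  also have "\<dots> = L.D l (\<lambda>p q. p * L.S q)"
    by (rule L.comul_one; (rule lin)+)
  finally show ?thesis by (simp add: L.id_S f_cR)
qed

lemma contract_comul_R:
  assumes \<phi>: "bil L.sc L.sc t \<phi>"
  shows "contract L L \<phi> (comul_R H R L f l) = DR l \<phi>"
  unfolding comul_R_def
  by (simp add: contract_contract[OF L.ks L.ks \<phi>] L.contract_tens_H[OF \<phi>] contract_in kspace_tensor)

section \<open>The braided Hopf algebra\<close>

abbreviation M where "M \<equiv> centralizer_module H L f"
abbreviation MM where "MM \<equiv> tprod H M M"
abbreviation I where "I \<equiv> unit_obj H"
abbreviation \<mu> where "\<mu> \<equiv> mult_R H L f"
abbreviation \<Delta> where "\<Delta> \<equiv> comul_R H R L f"

lemma carrier_M [simp]: "carrier M = V" and scl_M [simp]: "scl M = L.sc" and act_M [simp]: "act M = A"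
  by (simp_all add: centralizer_module_def source_centralizer_eq)

lemma A_add: "A h (x + y) = A h x + A h y" and A_sc: "A h (L.sc c x) = L.sc c (A h x)"
  by (rule klin_add[OF lin_A2[OF klin_id[OF L.vs]]], rule klin_scale[OF lin_A2[OF klin_id[OF L.vs]]])

lemma M_module: "left_module H M"
  unfolding left_module_def
proof (intro conjI allI ballI)
  have "A 1 0 = 0" by (rule klin_0[OF lin_A2[OF klin_id[OF L.vs]]])
  then show "kspace M"
    using L.vs by (auto simp: kspace_def module.subspace_def vector_space_def module_def V_iff A_add A_sc)
  show "kbilinear H M M (act M)"
    using klin_add[OF lin_A1[OF klin_id[OF vs]]] klin_scale[OF lin_A1[OF klin_id[OF vs]]]
    by (auto simp: kbilinear_def klinear_def A_add A_sc)
  show "act M 1 x = x" if "x \<in> carrier M" for x using that by (simp add: A_one)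
  show "act M (g * h) x = act M g (act M h x)" for g h x by (simp add: A_mult)
qed

lemmas M_kspace = module_kspace[OF M_module] and MM_module = tprod_module[OF M_module M_module]
  and I_module = unit_obj_module

lemma lin_comul_R [lin]: "klin s L.sc g \<Longrightarrow> klin s tscl (\<lambda>x. \<Delta> (g x))"
proof -
  assume g: "klin s L.sc g"
  note [lin] = klin_tens1[of _ L] klin_tens2[of _ L]
  have "klin L.sc tscl (\<lambda>x. \<Delta> x)"
    unfolding comul_R_def by (rule lin)+
  then show ?thesis by (rule klin_comp[OF _ g])
qed

lemma comul_R_DR: "\<Delta> l = DR l (tens L L)"
  by (simp add: comul_R_def)

lemma tens_M [simp]: "tens M W = tens L W"
  by (rule tens_cong_scl) simp_all

lemma tens_M' [simp]: "tens Z M = tens Z L"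
  by (rule tens_cong_scl) simp_all

lemma A_in_M [simp]: "A h x \<in> carrier M"
  by simp

lemma comul_R_in:
  assumes l: "l \<in> V"
  shows "\<Delta> l \<in> carrier (tensor M M)"
proof -
  note [lin] = klin_tens1[of _ L] klin_tens2[of _ L]
  have "\<Delta> l = DR l (\<lambda>x y. tens M M (A 1 x) (A 1 y))"
    unfolding comul_R_DR tens_M tens_M' by (rule DR_V[OF _ l, symmetric]) (rule lin L.vs)+
  also have "\<dots> \<in> carrier (tensor M M)"
    by (rule contract_in[OF kspace_tensor[OF M_kspace] L.comul_in], rule contract_in[OF kspace_tensor[OF M_kspace] R_in])
      (intro tens_in A_in_M)
  finally show ?thesis .
qed

text \<open>The passage from identities in L to the module: for l in V a contraction over V
  \<otimes> V may be computed with the pairs representing \<Delta>(l) in L \<otimes> L.\<close>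

lemma contract_M_comul_R:
  assumes \<phi>: "bil L.sc L.sc t \<phi>" and l: "l \<in> V"
  shows "contract M M \<phi> (\<Delta> l) = DR l \<phi>"
proof -
  have "contract M M \<phi> (\<Delta> l) = contract L L \<phi> (\<Delta> l)"
    by (rule contract_mono[OF M_kspace L.ks M_kspace L.ks kspace_whole[OF bil_vs[OF \<phi>]] _ _ _ _ kbilinear_of_bil[OF \<phi>] comul_R_in[OF l]])
      simp_all
  then show ?thesis by (simp add: contract_comul_R[OF \<phi>])
qed

lemma bil_tens_act_M: "bil L.sc L.sc tscl (tens_act M M h)"
proof -
  note [lin] = klin_tens1[of _ L] klin_tens2[of _ L]
  show ?thesis unfolding tens_act_def act_M tens_M tens_M' by (rule lin)+
qed

lemma diag_act_comul_R:
  assumes l: "l \<in> V"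
  shows "diag_act H M M h (\<Delta> l) = \<Delta> (A h l)"
proof -
  note [lin] = klin_tens1[of _ L] klin_tens2[of _ L]
  have "diag_act H M M h (\<Delta> l) = DR l (tens_act M M h)"
    unfolding diag_act_eq by (rule contract_M_comul_R[OF bil_tens_act_M l])
  also have "\<dots> = D h (\<lambda>a b. DR l (\<lambda>x y. tens L L (A a x) (A b y)))"
    unfolding tens_act_def act_M tens_M tens_M'
    by (subst (3) contract_swap, subst contract_swap) (rule refl)
  also have "\<dots> = \<Delta> (A h l)"
    unfolding comul_R_DR by (rule DR_A[symmetric]) (rule lin L.vs)+
  finally show ?thesis .
qed

lemma comul_R_hom: "hmod_hom H M MM \<Delta>"
proof -
  have "\<Delta> l \<in> carrier MM" if "l \<in> V" for l
    using diag_act_comul_R[OF that, of 1] comul_R_in[OF that] by (simp add: tprod_iff[OF M_module M_module] A_one that)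
  moreover have "klinear M (whole tscl) \<Delta>"
    by (rule klinear_of_klin) (unfold scl_M, (rule lin L.vs)+)
  ultimately have "klinear M MM \<Delta>" by (simp add: klinear_def)
  then show ?thesis by (simp add: hmod_hom_def diag_act_comul_R)
qed

lemma kbilinear_mult: "kbilinear M M M (*)"
  by (auto simp: kbilinear_def klinear_def algebra_simps L.sc_mult[symmetric])

lemma A_mult_eq: "x \<in> carrier M \<Longrightarrow> y \<in> carrier M \<Longrightarrow> D h (\<lambda>a b. act M a x * act M b y) = act M h (x * y)"
  by (simp add: A_mult_V)

lemma mult_R:
  shows "hmod_hom H MM M \<mu>"
    and "x \<in> carrier M \<Longrightarrow> y \<in> carrier M \<Longrightarrow> \<mu> (tens_t H M M x y) = x * y"
    and "t \<in> carrier MM \<Longrightarrow> \<mu> t = contract M M (*) t"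
proof -
  note r = contract_t_hom[OF M_module M_module M_module kbilinear_mult, folded mult_R_def]
  show "hmod_hom H MM M \<mu>" by (rule r(1)) (rule A_mult_eq)
  show "x \<in> carrier M \<Longrightarrow> y \<in> carrier M \<Longrightarrow> \<mu> (tens_t H M M x y) = x * y" by (rule r(2)) (rule A_mult_eq)
  show "t \<in> carrier MM \<Longrightarrow> \<mu> t = contract M M (*) t" by (rule r(3)) (rule A_mult_eq)
qed

lemma A_Ht_V: "z \<in> Ht \<Longrightarrow> x \<in> V \<Longrightarrow> A z x = f z * x"
  using A_Ht[of z x] by (simp add: A_one)

lemma f_hom: "hmod_hom H I M f"
  using klin_add[OF lin_f[OF klin_id[OF vs]]]
  by (auto simp: hmod_hom_def klinear_def A_f)

lemma cR_hom: "hmod_hom H M I cR"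
  using klin_add[OF lin_cR[OF klin_id[OF L.vs]]] klin_scale[OF lin_cR[OF klin_id[OF L.vs]]]
  by (auto simp: hmod_hom_def klinear_def cR_A)

lemma SR_hom: "hmod_hom H M M SR"
  using klin_add[OF lin_SR[OF klin_id[OF L.vs]]] klin_scale[OF lin_SR[OF klin_id[OF L.vs]]]
  by (auto simp: hmod_hom_def klinear_def SR_A)

section \<open>The axioms in the module category\<close>

lemma centralizer_algebra: "algebra_in H M \<mu> f"
  unfolding algebra_in_def Let_def
proof (intro conjI ballI)
  show "left_module H M" by (rule M_module)
  show "hmod_hom H MM M \<mu>" by (rule mult_R(1))
  show "hmod_hom H I M f" by (rule f_hom)
next
  fix x assume x: "x \<in> carrier (tprod H MM M)"
  note m1 = tmap_hom[OF MM_module M_module M_module M_module mult_R(1) id_hom]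
  note m2 = tmap_hom[OF M_module MM_module M_module M_module id_hom mult_R(1)]
  note as = tassoc_hom[OF M_module M_module M_module]
  show "\<mu> (tmap MM M M M \<mu> id x) = \<mu> (tmap M MM M M id \<mu> (tassoc M M M x))"
  proof (rule tprod3_ext_left[OF M_module M_module M_module
        klinear_comp[OF hom_klinear[OF m1(1)] hom_klinear[OF mult_R(1)]]
        klinear_comp[OF hom_klinear[OF as(1)] klinear_comp[OF hom_klinear[OF m2(1)] hom_klinear[OF mult_R(1)]]] _ x])
    fix u v w assume uvw: "u \<in> carrier M" "v \<in> carrier M" "w \<in> carrier M"
    then have "u * v \<in> carrier M" "v * w \<in> carrier M" by simp_all
    then show "\<mu> (tmap MM M M M \<mu> id (tens_t H MM M (tens_t H M M u v) w))
      = \<mu> (tmap M MM M M id \<mu> (tassoc M M M (tens_t H MM M (tens_t H M M u v) w)))"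
      by (simp only: as(2)[OF uvw] m1(2)[OF tens_t_in[OF M_module M_module uvw(1,2)] uvw(3)]
          m2(2)[OF uvw(1) tens_t_in[OF M_module M_module uvw(2,3)]] mult_R(2) id_apply uvw mult.assoc)
  qed
next
  fix x assume x: "x \<in> carrier (tprod H I M)"
  note m = tmap_hom[OF I_module M_module M_module M_module f_hom id_hom]
  show "\<mu> (tmap I M M M f id x) = lunit H M x"
    by (rule tprod_ext[OF I_module M_module klinear_comp[OF hom_klinear[OF m(1)] hom_klinear[OF mult_R(1)]] lunit(1)[OF M_module] _ x])
      (simp add: m(2) mult_R(2) lunit(2)[OF M_module] A_Ht_V)
next
  fix x assume x: "x \<in> carrier (tprod H M I)"
  note m = tmap_hom[OF M_module I_module M_module M_module id_hom f_hom]
  show "\<mu> (tmap M I M M id f x) = runit H M x"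
    by (rule tprod_ext[OF M_module I_module klinear_comp[OF hom_klinear[OF m(1)] hom_klinear[OF mult_R(1)]] runit(1)[OF M_module] _ x])
      (simp add: m(2) mult_R(2) runit(2)[OF M_module] A_Hs)
qed

lemma centralizer_coalgebra: "coalgebra_in H M \<Delta> cR"
  unfolding coalgebra_in_def Let_def
proof (intro conjI ballI)
  show "left_module H M" by (rule M_module)
  show "hmod_hom H M MM \<Delta>" by (rule comul_R_hom)
  show "hmod_hom H M I cR" by (rule cR_hom)
  note [lin] = klin_tens1[of _ L] klin_tens2[of _ L]
  fix v assume v: "v \<in> carrier M"
  then have vV: "v \<in> V" by simp
  note \<Delta>v = comul_R_in[OF vV]
  have \<Delta>_MM: "\<Delta> v \<in> carrier MM" by (rule klinear_in[OF hom_klinear[OF comul_R_hom] v])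
  show "tassoc M M M (tmap M M MM M \<Delta> id (\<Delta> v)) = tmap M M M MM id \<Delta> (\<Delta> v)"
  proof -
    have b: "bil L.sc L.sc tscl (\<lambda>u w. tens M (tensor M M) u (tens M M w y))" for y
      unfolding tens_M tens_M' by (rule lin L.vs)+
    have b2: "bil L.sc L.sc tscl (\<lambda>x y. DR x (\<lambda>u w. tens L (tensor M M) u (tens L L w y)))"
      by (rule lin L.vs)+
    have "tassoc M M M (tmap M M MM M \<Delta> id (\<Delta> v))
        = contract M M (\<lambda>x y. tassoc M M M (tens (tensor M M) M (\<Delta> x) y)) (\<Delta> v)"
      unfolding tmap_def tens_tprod id_apply
      by (rule klinear_contract_elem[OF klinear_tassoc(1)[OF M_kspace M_kspace M_kspace] kspace_tensor[OF kspace_tensor[OF M_kspace]] \<Delta>v])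
        (intro tens_in comul_R_in; simp)
    also have "\<dots> = contract M M (\<lambda>x y. DR x (\<lambda>u w. tens L (tensor M M) u (tens L L w y))) (\<Delta> v)"
    proof (rule contract_cong_carrier[OF \<Delta>v])
      fix x y assume xy: "x \<in> carrier M" "y \<in> carrier M"
      then have "x \<in> V" by simp
      then show "tassoc M M M (tens (tensor M M) M (\<Delta> x) y) = DR x (\<lambda>u w. tens L (tensor M M) u (tens L L w y))"
        using klinear_tassoc(2)[OF M_kspace M_kspace M_kspace comul_R_in xy(2)] contract_M_comul_R[OF b, of x y] by simp
    qed
    also have "\<dots> = DR v (\<lambda>x y. DR x (\<lambda>u w. tens L (tensor M M) u (tens L L w y)))"
      by (rule contract_M_comul_R[OF b2 vV])
    also have "\<dots> = DR v (\<lambda>x y. DR y (\<lambda>u w. tens L (tensor M M) x (tens L L u w)))"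
      by (rule DR_coassoc) (rule lin L.vs)+
    also have "\<dots> = DR v (\<lambda>x y. tens L (tensor M M) x (\<Delta> y))"
      unfolding comul_R_DR by (simp add: klin_contract[OF klin_tens2_tensor[OF klin_id[OF vs_tscl]]])
    also have "\<dots> = contract M M (\<lambda>x y. tens L (tensor M M) x (\<Delta> y)) (\<Delta> v)"
      by (rule contract_M_comul_R[OF _ vV, symmetric]) (rule lin L.vs)+
    also have "\<dots> = tmap M M M MM id \<Delta> (\<Delta> v)"
      by (simp add: tmap_def)
    finally show ?thesis .
  qed
  show "lunit H M (tmap M M I M cR id (\<Delta> v)) = v"
  proof -
    have t: "tmap M M I M cR id (\<Delta> v) \<in> carrier (tprod H I M)"
      by (rule klinear_in[OF hom_klinear[OF tmap_hom(1)[OF M_module M_module I_module M_module cR_hom id_hom]] \<Delta>_MM])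
    have "lunit H M (tmap M M I M cR id (\<Delta> v)) = contract M M (\<lambda>x y. act M (cR x) (id y)) (\<Delta> v)"
      unfolding lunit(3)[OF M_module t]
      by (rule contract_tmap[OF M_kspace M_kspace module_kspace[OF I_module] M_kspace M_kspace hom_klinear[OF cR_hom] hom_klinear[OF id_hom]
            kbilinear_act_unit[OF M_module] \<Delta>v])
    also have "\<dots> = contract M M (\<lambda>x y. f (cR x) * y) (\<Delta> v)"
      by (rule contract_cong_carrier[OF \<Delta>v]) (simp add: A_Ht_V)
    also have "\<dots> = DR v (\<lambda>x y. f (cR x) * y)"
      by (rule contract_M_comul_R[OF _ vV]) (rule lin L.vs)+
    finally show ?thesis by (simp add: DR_counit1[OF vV])
  qed
  show "runit H M (tmap M M M I id cR (\<Delta> v)) = v"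
  proof -
    have t: "tmap M M M I id cR (\<Delta> v) \<in> carrier (tprod H M I)"
      by (rule klinear_in[OF hom_klinear[OF tmap_hom(1)[OF M_module M_module M_module I_module id_hom cR_hom]] \<Delta>_MM])
    have "runit H M (tmap M M M I id cR (\<Delta> v)) = contract M M (\<lambda>x y. act M (iS (cR y)) (id x)) (\<Delta> v)"
      unfolding runit(3)[OF M_module t]
      by (rule contract_tmap[OF M_kspace M_kspace M_kspace module_kspace[OF I_module] M_kspace hom_klinear[OF id_hom] hom_klinear[OF cR_hom]
            kbilinear_runit[OF M_module] \<Delta>v])
    also have "\<dots> = contract M M (\<lambda>x y. x * f (cR y)) (\<Delta> v)"
      by (rule contract_cong_carrier[OF \<Delta>v]) (simp add: A_Hs)
    also have "\<dots> = DR v (\<lambda>x y. x * f (cR y))"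
      by (rule contract_M_comul_R[OF _ vV]) (rule lin L.vs)+
    finally show ?thesis by (simp add: DR_counit2[OF vV])
  qed
qed

lemma bil_tens_t_M: "bil L.sc L.sc tscl (tens_t H M M)"
  unfolding tens_t_eq by (rule bil_tens_act_M)

lemma comul_R_mult:
  assumes x: "x \<in> carrier MM"
  shows "\<Delta> (\<mu> x) = tmap MM MM M M \<mu> \<mu> (middle_braiding H R M (tmap M M MM MM \<Delta> \<Delta> x))"
proof -
  define G where "G = (\<lambda>y. tmap MM MM M M \<mu> \<mu> (middle_braiding H R M y))"
  note dd = tmap_hom[OF M_module M_module MM_module MM_module comul_R_hom comul_R_hom]
  note mm = tmap_hom[OF MM_module MM_module M_module M_module mult_R(1) mult_R(1)]
  note mb = middle_braiding[OF M_module]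
  note i2 = tens_t_in[OF M_module M_module]
  have kG: "klinear (tprod H MM MM) MM G"
    unfolding G_def by (rule klinear_comp[OF mb(1) hom_klinear[OF mm(1)]])
  have G4: "G (tens_t H MM MM (tens_t H M M a b) (tens_t H M M c d)) = RR (\<lambda>r s. tens_t H M M (a * A s c) (A r b * d))"
    if m: "a \<in> carrier M" "b \<in> carrier M" "c \<in> carrier M" "d \<in> carrier M" for a b c d
  proof -
    have "G (tens_t H MM MM (tens_t H M M a b) (tens_t H M M c d))
      = RR (\<lambda>r s. tmap MM MM M M \<mu> \<mu> (tens_t H MM MM (tens_t H M M a (act M s c)) (tens_t H M M (act M r b) d)))"
      unfolding G_def mb(2)[OF m]
      by (rule klinear_contract_elem[OF hom_klinear[OF mm(1)] kspace_tprod[OF MM_module MM_module] R_in])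
        (intro tens_t_in[OF MM_module MM_module] i2 act_in[OF M_module] m)
    also have "\<dots> = RR (\<lambda>r s. tens_t H M M (a * A s c) (A r b * d))"
      by (simp only: mm(2) mult_R(2) i2 act_in[OF M_module] m) simp
    finally show ?thesis .
  qed
  \<comment> \<open>The coproducts to be inserted are not generators of \<open>MM\<close>;
    \<open>tprod_expand\<close> writes them as sums of generators, on which \<open>G4\<close> gives
    the value.\<close>
  have G2: "G (tens_t H MM MM p q)
      = contract M M (\<lambda>a b. contract M M (\<lambda>c d. RR (\<lambda>r s. tens_t H M M (a * A s c) (A r b * d))) q) p"
    if p: "p \<in> carrier MM" and q: "q \<in> carrier MM" for p q
  proof -
    have pt: "p \<in> carrier (tensor M M)" and quasitriangular_H: "q \<in> carrier (tensor M M)"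
      using p q tprod_sub[OF M_module M_module] by auto
    have "G (tens_t H MM MM p q) = contract M M (\<lambda>a b. G (tens_t H MM MM (tens_t H M M a b) q)) p"
      using klinear_contract_elem[OF klinear_comp[OF klinear_tens_t(1)[OF MM_module MM_module q] kG]
          module_kspace[OF MM_module] pt, of "tens_t H M M"] tprod_expand[OF M_module M_module p] i2 by simp
    also have "\<dots> = contract M M (\<lambda>a b. contract M M (\<lambda>c d. G (tens_t H MM MM (tens_t H M M a b) (tens_t H M M c d))) q) p"
    proof (rule contract_cong_carrier[OF pt])
      fix a b assume ab: "a \<in> carrier M" "b \<in> carrier M"
      show "G (tens_t H MM MM (tens_t H M M a b) q)
        = contract M M (\<lambda>c d. G (tens_t H MM MM (tens_t H M M a b) (tens_t H M M c d))) q"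
        using klinear_contract_elem[OF klinear_comp[OF klinear_tens_t(2)[OF MM_module MM_module i2[OF ab]] kG]
            module_kspace[OF MM_module] quasitriangular_H, of "tens_t H M M"] tprod_expand[OF M_module M_module q] i2 by simp
    qed
    also have "\<dots> = contract M M (\<lambda>a b. contract M M (\<lambda>c d. RR (\<lambda>r s. tens_t H M M (a * A s c) (A r b * d))) q) p"
      by (intro contract_cong_carrier[OF pt] contract_cong_carrier[OF quasitriangular_H] G4)
    finally show ?thesis .
  qed
  have "\<Delta> (\<mu> x) = G (tmap M M MM MM \<Delta> \<Delta> x)"
  proof (rule tprod_ext[OF M_module M_module klinear_comp[OF hom_klinear[OF mult_R(1)] hom_klinear[OF comul_R_hom]]
        klinear_comp[OF hom_klinear[OF dd(1)] kG]])
    fix a b assume ab: "a \<in> carrier M" "b \<in> carrier M"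
    then have abV: "a \<in> V" "b \<in> V" by simp_all
    note \<Delta>_MM = klinear_in[OF hom_klinear[OF comul_R_hom]]
    note [lin] = bil1[OF bil_tens_t_M] bil2[OF bil_tens_t_M]
    have "G (tmap M M MM MM \<Delta> \<Delta> (tens_t H M M a b))
      = contract M M (\<lambda>x y. contract M M (\<lambda>u v. RR (\<lambda>r s. tens_t H M M (x * A s u) (A r y * v))) (\<Delta> b)) (\<Delta> a)"
      by (simp only: dd(2)[OF ab] G2 \<Delta>_MM ab)
    also have "\<dots> = contract M M (\<lambda>x y. DR b (\<lambda>u v. RR (\<lambda>r s. tens_t H M M (x * A s u) (A r y * v)))) (\<Delta> a)"
      by (rule contract_cong, rule contract_M_comul_R[OF _ abV(2)]) (rule lin L.vs)+
    also have "\<dots> = DR a (\<lambda>x y. DR b (\<lambda>u v. RR (\<lambda>r s. tens_t H M M (x * A s u) (A r y * v))))"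
      by (rule contract_M_comul_R[OF _ abV(1)]) (rule lin L.vs)+
    also have "\<dots> = DR (a * b) (tens_t H M M)"
      by (rule DR_mult[OF bil_tens_t_M abV])
    also have "\<dots> = contract M M (tens_t H M M) (\<Delta> (a * b))"
      using abV by (intro contract_M_comul_R[OF bil_tens_t_M, symmetric]) simp
    also have "\<dots> = \<Delta> (a * b)"
      using abV by (intro tprod_expand[OF M_module M_module] \<Delta>_MM) simp
    finally show "\<Delta> (\<mu> (tens_t H M M a b)) = G (tmap M M MM MM \<Delta> \<Delta> (tens_t H M M a b))"
      by (simp add: mult_R(2)[OF ab])
  qed (rule x)
  then show ?thesis by (simp add: G_def)
qed

lemma centralizer_bialgebra: "bialgebra_in H R M \<mu> f \<Delta> cR"
  unfolding bialgebra_in_def Let_def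
proof (intro conjI ballI centralizer_algebra centralizer_coalgebra comul_R_mult)
  fix x assume x: "x \<in> carrier MM"
  note cc = tmap_hom[OF M_module M_module I_module I_module cR_hom cR_hom]
  show "cR (\<mu> x) = lunit H I (tmap M M I I cR cR x)"
  proof (rule tprod_ext[OF M_module M_module klinear_comp[OF hom_klinear[OF mult_R(1)] hom_klinear[OF cR_hom]]
        klinear_comp[OF hom_klinear[OF cc(1)] lunit(1)[OF I_module]] _ x])
    fix a b assume ab: "a \<in> carrier M" "b \<in> carrier M"
    have e: "et (cR a * cR b) = cR a * cR b" using Ht_mult[OF cR_Ht cR_Ht, of a b] by (simp add: Ht_def)
    show "cR (\<mu> (tens_t H M M a b)) = lunit H I (tmap M M I I cR cR (tens_t H M M a b))"
      using ab by (simp add: mult_R(2) cc(2) lunit(2)[OF I_module] cR_mult e)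
  qed
next
  fix x assume x: "x \<in> carrier (tprod H I I)"
  note ff = tmap_hom[OF I_module I_module M_module M_module f_hom f_hom]
  show "\<Delta> (f (lunit H I x)) = tmap I I M M f f x"
  proof (rule tprod_ext[OF I_module I_module klinear_comp[OF lunit(1)[OF I_module]
          klinear_comp[OF hom_klinear[OF f_hom] hom_klinear[OF comul_R_hom]]] hom_klinear[OF ff(1)] _ x])
    fix z w assume "z \<in> carrier I" "w \<in> carrier I"
    then have zw: "z \<in> Ht" "w \<in> Ht" by simp_all
    note [lin] = klin_tens1[of _ L] klin_tens2[of _ L]
    have b: "bil L.sc L.sc tscl (tens L L)" by (rule lin L.vs)+
    have e: "et (z * w) = z * w" using Ht_mult[OF zw] by (simp add: Ht_def)
    have "\<Delta> (f (lunit H I (tens_t H I I z w))) = DR (f (z * w)) (tens L L)"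
      by (simp add: lunit(2)[OF I_module] zw e comul_R_DR del: f_mult)
    also have "\<dots> = D 1 (\<lambda>a b. tens L L (f (z * w * S a)) (f b))"
      by (rule DR_f[OF b Ht_mult[OF zw]])
    also have "\<dots> = D 1 (\<lambda>a b. tens L L (f (et (a * z))) (f (et (b * w))))"
      by (rule f_tens_f[OF b zw, symmetric])
    also have "\<dots> = tens_t H M M (f z) (f w)"
      by (simp add: tens_t_def A_f zw)
    also have "\<dots> = tmap I I M M f f (tens_t H I I z w)"
      by (simp add: ff(2) zw)
    finally show "\<Delta> (f (lunit H I (tens_t H I I z w))) = tmap I I M M f f (tens_t H I I z w)" .
  qed
qed

text \<open>Both antipode axioms have this shape, with the antipode and the identity as g and
  h.\<close>

lemma mult_tmap_comul:
  assumes g: "hmod_hom H M M g" and h: "hmod_hom H M M h" and l: "l \<in> V"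
    and b: "bil L.sc L.sc L.sc (\<lambda>x y. g x * h y)"
  shows "\<mu> (tmap M M M M g h (\<Delta> l)) = DR l (\<lambda>x y. g x * h y)"
proof -
  have \<Delta>_MM: "\<Delta> l \<in> carrier MM" using l by (intro klinear_in[OF hom_klinear[OF comul_R_hom]]) simp
  note t = klinear_in[OF hom_klinear[OF tmap_hom(1)[OF M_module M_module M_module M_module g h]] \<Delta>_MM]
  have "\<mu> (tmap M M M M g h (\<Delta> l)) = contract M M (\<lambda>x y. g x * h y) (\<Delta> l)"
    unfolding mult_R(3)[OF t]
    by (rule contract_tmap[OF M_kspace M_kspace M_kspace M_kspace M_kspace hom_klinear[OF g] hom_klinear[OF h] kbilinear_mult comul_R_in[OF l]])
  then show ?thesis by (simp add: contract_M_comul_R[OF b l])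
qed

lemma centralizer_hopf_algebra: "hopf_algebra_in H R M \<mu> f \<Delta> cR SR"
  unfolding hopf_algebra_in_def
proof (intro conjI ballI centralizer_bialgebra SR_hom)
  fix l assume "l \<in> carrier M"
  then have l: "l \<in> V" by simp
  have b: "bil L.sc L.sc L.sc (\<lambda>x y. SR x * id y)" "bil L.sc L.sc L.sc (\<lambda>x y. id x * SR y)"
    unfolding id_apply by (rule lin L.vs)+
  show "\<mu> (tmap M M M M SR id (\<Delta> l)) = f (cR l)"
    using mult_tmap_comul[where g = SR and h = id, OF SR_hom id_hom l b(1)] SR_left[OF l] by simp
  show "\<mu> (tmap M M M M id SR (\<Delta> l)) = f (cR l)"
    using mult_tmap_comul[where g = id and h = SR, OF id_hom SR_hom l b(2)] SR_right[OF l] by simp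
qed

end

theorem theorem2p4:
  fixes H :: "('k::field, 'h::{ring,monoid_mult}) qgroupoid"
    and R :: "('h, 'h, 'k) tensor"
    and L :: "('k, 'l::{ring,monoid_mult}) qgroupoid"
    and f :: "'h \<Rightarrow> 'l"
  assumes "quasitriangular_quantum_groupoid H R"
    and "quantum_groupoid L"
    and "quantum_groupoid_map H L f"
  shows "hopf_algebra_in H R (centralizer_module H L f)
           (mult_R H L f) f (comul_R H R L f) (counit_R H L f) (antipode_R H R L f)"
proof -
  interpret transmutation H R L f
    using assms
    by unfold_locales (simp_all add: quasitriangular_quantum_groupoid_def)
  show ?thesis by (rule centralizer_hopf_algebra)
qed

end
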